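(* Let $R$ be a commutative ring, let $\alpha,z\in R^\times$, let $\zeta\in R^\times$ be such that $\zeta^{-1}-\zeta=z$, and let $n\ge 2$. There exists a unique rigid braided monoidal functor $$Z_{\alpha,\zeta}:\mathbf{TD}\to\mathbf{MOY}_{\alpha,\zeta}$$ such that $Z_{\alpha,\zeta}(\uparrow)=\uparrow^1$. Moreover, $Z_{\alpha,\zeta}$ factors through $\mathbf{HOMFLY\text{-}PT}_{\alpha,z}$.
   Context: All categories are enriched in $R$-modules and functors are $R$-linear. Diagrams are read bottom to top, up to plane isotopy; $\circ$ is stacking (left factor on top), $\otimes$ juxtaposition. **Tangles.** $\mathbf{TD}$: objects are finite sequences of $\uparrow,\downarrow$; morphisms are $R$-linear combinations of oriented plane tangle diagrams modulo the tensor ideal generated by all oriented Reidemeister moves; it is rigid (cups and caps) and braided untwisted. $X_+$ (resp. $X_-$) is the crossing of two upward strands with over-strand running from bottom left to top right (resp. bottom right to top left); $X_+$ and $X_-=X_+^{-1}$ are the braidings. $\mathbf{HOMFLY\text{-}PT}_{\alpha,z}$ is the quotient of $\mathbf{TD}$ by the tensor ideal generated by $\alpha X_+-\alpha^{-1}X_--z\,\mathrm{id}_{\uparrow\uparrow}$ and $\bigcirc-\frac{\alpha-\alpha^{-1}}{z}\emptyset$, with $\bigcirc$ the unknot. A rigid braided monoidal functor preserves tensor products, evaluations, coevaluations and braidings. **$\mathbf{MOY}_{\alpha,\zeta}$.** $\mathbf{TrPD}$: objects are finite sequences of $\uparrow^1,\downarrow^1$; morphisms are $R$-linear combinations of oriented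 plane trivalent graphs with edges labelled in $\{1,2\}$, boundary edges labelled 1, such that at each vertex the sum of incoming labels equals the sum of outgoing labels. It is rigid monoidal; morphisms are generated by identities, caps $\overrightarrow{ev}:\uparrow^1\downarrow^1\to\emptyset$, $\overleftarrow{ev}:\downarrow^1\uparrow^1\to\emptyset$, cups $\overrightarrow{coev}:\emptyset\to\uparrow^1\downarrow^1$, $\overleftarrow{coev}:\emptyset\to\downarrow^1\uparrow^1$, the graph $S:\uparrow^1\uparrow^1\to\uparrow^1\uparrow^1$ (two 1-edges merge into a 2-edge which splits into two 1-edges) and its dual $S^\vee$ (reversed orientations). Write $\mathrm{id}=\mathrm{id}_{\uparrow^1}$, $\mathrm{id}^\vee=\mathrm{id}_{\downarrow^1}$. Put $[k]_{\alpha,\zeta}=\dfrac{\alpha^{-1}(-\zeta)^{k-n}-\alpha(-\zeta)^{n-k}}{\zeta-\zeta^{-1}}$. $\mathbf{MOY}_{\alpha,\zeta}$ is the quotient of $\mathbf{TrPD}$ by the tensor ideal generated by the following relations and their duals (all orientations reversed): (1) the circle labelled 1 equals $[n]_{\alpha,\zeta}\,\emptyset$; (2) $S\circ S=-(\zeta+\zeta^{-1})S$; (3) $(\overleftarrow{ev}\otimes\mathrm{id})\circ(\mathrm{id}^\vee\otimes S)\circ(\overleftarrow{coev}\otimes\mathrm{id})=[n-1]_{\alpha,\zeta}\,\mathrm{id}$; (4) $(\mathrm{id}\otimes\overrightarrow{ev}\otimes\mathrm{id}^\vee)\circ(S\otimes S^\vee)\circ(\mathrm{id}\otimes\overrightarrow{coev}\otimes\mathrm{id}^\vee)=\overrightarrow{coev}\circ\overrightarrow{ev}+[n-2]_{\alpha,\zeta}\,\mathrm{id}\otimes\mathrm{id}^\vee$;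 (5) $(S\otimes\mathrm{id})(\mathrm{id}\otimes S)(S\otimes\mathrm{id})+\mathrm{id}\otimes S=(\mathrm{id}\otimes S)(S\otimes\mathrm{id})(\mathrm{id}\otimes S)+S\otimes\mathrm{id}$. It is rigid braided untwisted with braidings $\sigma^+=\alpha^{-1}(\zeta^{-1}\mathrm{id}_{\uparrow^1\uparrow^1}+S)$ and $\sigma^-=\alpha(\zeta\,\mathrm{id}_{\uparrow^1\uparrow^1}+S)$. *)

theory Defs
  imports Main "HOL-Library.FuncSet" "HOL-Library.Poly_Mapping"
begin

text \<open>
  Rings of coefficients have sort \<open>{comm_ring, comm_monoid_mult}\<close>: commutative rings with unit,
  the zero ring included (which the class \<open>comm_ring_1\<close> would exclude).
\<close>

section \<open>Linear rigid (braided) strict monoidal categories\<close>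

text \<open>
  The records hold the data of such a category; every element of the type \<open>'o\<close> is an object.
  Hom-sets need not be disjoint (e.g. zero morphisms may coincide), so the operations take
  the objects as arguments:
  \<open>cmp C x y z g f\<close> is the composite \<open>g \<circ> f\<close> of \<open>f : x \<rightarrow> y\<close> and \<open>g : y \<rightarrow> z\<close>, and
  \<open>tens C x x' y y' f g\<close> is \<open>f \<otimes> g : x \<otimes> y \<rightarrow> x' \<otimes> y'\<close> for \<open>f : x \<rightarrow> x'\<close>, \<open>g : y \<rightarrow> y'\<close>.
  With \<open>x\<^sup>*\<close> for \<open>dual x\<close>, the dualities are
  \<open>ev_r x : x \<otimes> x\<^sup>* \<rightarrow> 1\<close>, \<open>ev_l x : x\<^sup>* \<otimes> x \<rightarrow> 1\<close>, \<open>coev_r x : 1 \<rightarrow> x \<otimes> x\<^sup>*\<close>,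
  \<open>coev_l x : 1 \<rightarrow> x\<^sup>* \<otimes> x\<close>.  The braiding is \<open>braiding x y : x \<otimes> y \<rightarrow> y \<otimes> x\<close>.
\<close>

record ('o, 'm, 'r) rigid_cat =
  hom :: "'o \<Rightarrow> 'o \<Rightarrow> 'm set"
  ident :: "'o \<Rightarrow> 'm"
  cmp :: "'o \<Rightarrow> 'o \<Rightarrow> 'o \<Rightarrow> 'm \<Rightarrow> 'm \<Rightarrow> 'm"
  zer :: "'o \<Rightarrow> 'o \<Rightarrow> 'm"
  add :: "'o \<Rightarrow> 'o \<Rightarrow> 'm \<Rightarrow> 'm \<Rightarrow> 'm"
  scal :: "'o \<Rightarrow> 'o \<Rightarrow> 'r \<Rightarrow> 'm \<Rightarrow> 'm"
  unit_ob :: "'o"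
  tens_ob :: "'o \<Rightarrow> 'o \<Rightarrow> 'o"
  tens :: "'o \<Rightarrow> 'o \<Rightarrow> 'o \<Rightarrow> 'o \<Rightarrow> 'm \<Rightarrow> 'm \<Rightarrow> 'm"
  dual :: "'o \<Rightarrow> 'o"
  ev_r :: "'o \<Rightarrow> 'm"
  ev_l :: "'o \<Rightarrow> 'm"
  coev_r :: "'o \<Rightarrow> 'm"
  coev_l :: "'o \<Rightarrow> 'm"

record ('o, 'm, 'r) rigid_braided_cat = "('o, 'm, 'r) rigid_cat" +
  braiding :: "'o \<Rightarrow> 'o \<Rightarrow> 'm"

text \<open>The tensor ideal generated by a family \<open>G\<close> of morphisms (\<open>G x y f\<close> for \<open>f : x \<rightarrow> y\<close>).\<close>

inductive tensor_ideal ::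
  "('o, 'm, 'r, 'e) rigid_cat_scheme \<Rightarrow> ('o \<Rightarrow> 'o \<Rightarrow> 'm \<Rightarrow> bool) \<Rightarrow> 'o \<Rightarrow> 'o \<Rightarrow> 'm \<Rightarrow> bool"
  for C G where
  gen: "G x y f \<Longrightarrow> tensor_ideal C G x y f"
| zer: "tensor_ideal C G x y (zer C x y)"
| add: "tensor_ideal C G x y f \<Longrightarrow> tensor_ideal C G x y g \<Longrightarrow> tensor_ideal C G x y (add C x y f g)"
| scal: "tensor_ideal C G x y f \<Longrightarrow> tensor_ideal C G x y (scal C x y r f)"
| cmp_left: "tensor_ideal C G x y f \<Longrightarrow> g \<in> hom C y z \<Longrightarrow> tensor_ideal C G x z (cmp C x y z g f)"
| cmp_right: "tensor_ideal C G y z g \<Longrightarrow> f \<in> hom C x y \<Longrightarrow> tensor_ideal C G x z (cmp C x y z g f)"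
| tens_left: "tensor_ideal C G x x' f \<Longrightarrow> g \<in> hom C y y' \<Longrightarrow>
    tensor_ideal C G (tens_ob C y x) (tens_ob C y' x') (tens C y y' x x' g f)"
| tens_right: "tensor_ideal C G x x' f \<Longrightarrow> g \<in> hom C y y' \<Longrightarrow>
    tensor_ideal C G (tens_ob C x y) (tens_ob C x' y') (tens C x x' y y' f g)"

definition congruent_mod ::
  "('o, 'm, 'r::{comm_ring,comm_monoid_mult}, 'e) rigid_cat_scheme \<Rightarrow> ('o \<Rightarrow> 'o \<Rightarrow> 'm \<Rightarrow> bool)
    \<Rightarrow> 'o \<Rightarrow> 'o \<Rightarrow> ('m \<times> 'm) set" where
  "congruent_mod C G x y =
    {(f, g). f \<in> hom C x y \<and> g \<in> hom C x y \<and>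
             tensor_ideal C G x y (add C x y f (scal C x y (- 1) g))}"

definition coset ::
  "('o, 'm, 'r::{comm_ring,comm_monoid_mult}, 'e) rigid_cat_scheme \<Rightarrow> ('o \<Rightarrow> 'o \<Rightarrow> 'm \<Rightarrow> bool)
    \<Rightarrow> 'o \<Rightarrow> 'o \<Rightarrow> 'm \<Rightarrow> 'm set" where
  "coset C G x y f = congruent_mod C G x y `` {f}"

text \<open>
  The quotient of \<open>C\<close> by the tensor ideal generated by \<open>G\<close>, with braiding given by the cosets of
  the morphisms \<open>br x y\<close>; \<open>C\<close> itself may be only rigid.
\<close>

definition quotient_cat ::
  "('o, 'm, 'r::{comm_ring,comm_monoid_mult}, 'e) rigid_cat_scheme \<Rightarrow> ('o \<Rightarrow> 'o \<Rightarrow> 'm \<Rightarrow> bool)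
    \<Rightarrow> ('o \<Rightarrow> 'o \<Rightarrow> 'm) \<Rightarrow> ('o, 'm set, 'r) rigid_braided_cat" where
  "quotient_cat C G br = \<lparr>
    hom = \<lambda>x y. hom C x y // congruent_mod C G x y,
    ident = \<lambda>x. coset C G x x (ident C x),
    cmp = \<lambda>x y z B A. \<Union>g\<in>B. \<Union>f\<in>A. coset C G x z (cmp C x y z g f),
    zer = \<lambda>x y. coset C G x y (zer C x y),
    add = \<lambda>x y A B. \<Union>f\<in>A. \<Union>g\<in>B. coset C G x y (add C x y f g),
    scal = \<lambda>x y r A. \<Union>f\<in>A. coset C G x y (scal C x y r f),
    unit_ob = unit_ob C,
    tens_ob = tens_ob C,
    tens = \<lambda>x x' y y' A B. \<Union>f\<in>A. \<Union>g\<in>B.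
      coset C G (tens_ob C x y) (tens_ob C x' y') (tens C x x' y y' f g),
    dual = dual C,
    ev_r = \<lambda>x. coset C G (tens_ob C x (dual C x)) (unit_ob C) (ev_r C x),
    ev_l = \<lambda>x. coset C G (tens_ob C (dual C x) x) (unit_ob C) (ev_l C x),
    coev_r = \<lambda>x. coset C G (unit_ob C) (tens_ob C x (dual C x)) (coev_r C x),
    coev_l = \<lambda>x. coset C G (unit_ob C) (tens_ob C (dual C x) x) (coev_l C x),
    braiding = \<lambda>x y. coset C G (tens_ob C x y) (tens_ob C y x) (br x y) \<rparr>"

text \<open>
  The maps on morphisms are required to be extensional, so that equality of functors is equality
  on objects and on hom-sets.
\<close>

record ('o, 'm, 'p, 'n) cat_map =
  ob_map :: "'o \<Rightarrow> 'p"
  mor_map :: "'o \<Rightarrow> 'o \<Rightarrow> 'm \<Rightarrow> 'n"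

definition linear_functor ::
  "('o, 'm, 'r, 'e) rigid_cat_scheme \<Rightarrow> ('p, 'n, 'r, 'd) rigid_cat_scheme
    \<Rightarrow> ('o, 'm, 'p, 'n) cat_map \<Rightarrow> bool" where
  "linear_functor C D F \<longleftrightarrow>
    (\<forall>x y. mor_map F x y \<in> hom C x y \<rightarrow>\<^sub>E hom D (ob_map F x) (ob_map F y)) \<and>
    (\<forall>x. mor_map F x x (ident C x) = ident D (ob_map F x)) \<and>
    (\<forall>x y z. \<forall>f\<in>hom C x y. \<forall>g\<in>hom C y z.
       mor_map F x z (cmp C x y z g f) =
       cmp D (ob_map F x) (ob_map F y) (ob_map F z) (mor_map F y z g) (mor_map F x y f)) \<and>
    (\<forall>x y. \<forall>f\<in>hom C x y. \<forall>g\<in>hom C x y.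
       mor_map F x y (add C x y f g) =
       add D (ob_map F x) (ob_map F y) (mor_map F x y f) (mor_map F x y g)) \<and>
    (\<forall>x y r. \<forall>f\<in>hom C x y.
       mor_map F x y (scal C x y r f) = scal D (ob_map F x) (ob_map F y) r (mor_map F x y f))"

definition rigid_braided_functor ::
  "('o, 'm, 'r) rigid_braided_cat \<Rightarrow> ('p, 'n, 'r) rigid_braided_cat
    \<Rightarrow> ('o, 'm, 'p, 'n) cat_map \<Rightarrow> bool" where
  "rigid_braided_functor C D F \<longleftrightarrow>
    linear_functor C D F \<and>
    ob_map F (unit_ob C) = unit_ob D \<and>
    (\<forall>x y. ob_map F (tens_ob C x y) = tens_ob D (ob_map F x) (ob_map F y)) \<and>
    (\<forall>x x' y y'. \<forall>f\<in>hom C x x'. \<forall>g\<in>hom C y y'.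
       mor_map F (tens_ob C x y) (tens_ob C x' y') (tens C x x' y y' f g) =
       tens D (ob_map F x) (ob_map F x') (ob_map F y) (ob_map F y')
         (mor_map F x x' f) (mor_map F y y' g)) \<and>
    (\<forall>x. ob_map F (dual C x) = dual D (ob_map F x)) \<and>
    (\<forall>x. mor_map F (tens_ob C x (dual C x)) (unit_ob C) (ev_r C x) = ev_r D (ob_map F x)) \<and>
    (\<forall>x. mor_map F (tens_ob C (dual C x) x) (unit_ob C) (ev_l C x) = ev_l D (ob_map F x)) \<and>
    (\<forall>x. mor_map F (unit_ob C) (tens_ob C x (dual C x)) (coev_r C x) = coev_r D (ob_map F x)) \<and>
    (\<forall>x. mor_map F (unit_ob C) (tens_ob C (dual C x) x) (coev_l C x) = coev_l D (ob_map F x)) \<and>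
    (\<forall>x y. mor_map F (tens_ob C x y) (tens_ob C y x) (braiding C x y) =
       braiding D (ob_map F x) (ob_map F y))"

definition functor_comp ::
  "('o, 'm, 'r, 'e) rigid_cat_scheme \<Rightarrow> ('p, 'n, 'q, 'l) cat_map \<Rightarrow> ('o, 'm, 'p, 'n) cat_map
    \<Rightarrow> ('o, 'm, 'q, 'l) cat_map" where
  "functor_comp C G F = \<lparr>
    ob_map = (\<lambda>x. ob_map G (ob_map F x)),
    mor_map = (\<lambda>x y. \<lambda>f\<in>hom C x y. mor_map G (ob_map F x) (ob_map F y) (mor_map F x y f)) \<rparr>"

definition quotient_functor ::
  "('o, 'm, 'r::{comm_ring,comm_monoid_mult}, 'e) rigid_cat_scheme \<Rightarrow> ('o \<Rightarrow> 'o \<Rightarrow> 'm \<Rightarrow> bool)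
    \<Rightarrow> ('o, 'm, 'o, 'm set) cat_map" where
  "quotient_functor C G = \<lparr>
    ob_map = (\<lambda>x. x),
    mor_map = (\<lambda>x y. \<lambda>f\<in>hom C x y. coset C G x y f) \<rparr>"


section \<open>Oriented plane diagrams\<close>

datatype orient = Up | Down

fun opp :: "orient \<Rightarrow> orient" where
  "opp Up = Down"
| "opp Down = Up"

type_synonym obj = "orient list"

definition dual_obj :: "obj \<Rightarrow> obj" where
  "dual_obj x = rev (map opp x)"

text \<open>
  \<open>Cap a : a a\<^sup>* \<rightarrow> \<emptyset>\<close> and \<open>Cup a : \<emptyset> \<rightarrow> a a\<^sup>*\<close>, where \<open>a\<^sup>* = opp a\<close>.  So \<open>Cap Up\<close>, \<open>Cap Down\<close>,
  \<open>Cup Up\<close>, \<open>Cup Down\<close> are respectively the right ev, left ev, right coev and left coev of the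
  upward strand (right: \<open>\<up>\<down>\<close>, left: \<open>\<down>\<up>\<close>).
\<close>

datatype 'v piece = Cap orient | Cup orient | Vertex 'v

text \<open>
  The layer \<open>(u, p, w)\<close> is the piece \<open>p\<close> with vertical strands \<open>u\<close> on its left and \<open>w\<close> on its
  right.  A plane diagram in general position with respect to the height is a list of layers,
  read from bottom to top, together with its bottom and top boundaries.
\<close>

type_synonym 'v layer = "obj \<times> 'v piece \<times> obj"

type_synonym 'v diagram = "obj \<times> 'v layer list \<times> obj"

text \<open>
  \<open>turns v\<close> lists layer diagrams with the same boundary as \<open>v\<close>, in which another vertex is rotated
  in the plane, by means of cups and caps, into the position of \<open>v\<close>.
\<close>

class plane_vertex =
  fixes vdom :: "'a \<Rightarrow> orient list"
    and vcod :: "'a \<Rightarrow> orient list"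
    and turns :: "'a \<Rightarrow> (orient list \<times> 'a piece \<times> orient list) list set"

fun pdom :: "'v::plane_vertex piece \<Rightarrow> obj" where
  "pdom (Cap a) = [a, opp a]"
| "pdom (Cup a) = []"
| "pdom (Vertex v) = vdom v"

fun pcod :: "'v::plane_vertex piece \<Rightarrow> obj" where
  "pcod (Cap a) = []"
| "pcod (Cup a) = [a, opp a]"
| "pcod (Vertex v) = vcod v"

fun layered :: "obj \<Rightarrow> 'v::plane_vertex layer list \<Rightarrow> obj \<Rightarrow> bool" where
  "layered x [] y \<longleftrightarrow> x = y"
| "layered x ((u, p, w) # ls) y \<longleftrightarrow> x = u @ pdom p @ w \<and> layered (u @ pcod p @ w) ls y"

definition whisker :: "obj \<Rightarrow> obj \<Rightarrow> 'v layer list \<Rightarrow> 'v layer list" where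
  "whisker s t ls = map (\<lambda>(u, p, w). (s @ u, p, w @ t)) ls"

text \<open>
  Plane isotopies of diagrams are generated by: exchanging the heights of two distant pieces,
  straightening a strand, and rotating a vertex.
\<close>

inductive local_move :: "'v::plane_vertex layer list \<Rightarrow> 'v layer list \<Rightarrow> bool" where
  exchange: "local_move
     [(u, p, v @ pdom q @ w), (u @ pcod p @ v, q, w)]
     [(u @ pdom p @ v, q, w), (u, p, v @ pcod q @ w)]"
| straighten_right: "local_move [(u @ [a], Cup (opp a), w), (u, Cap a, a # w)] []"
| straighten_left: "local_move [(u, Cup a, a # w), (u @ [a], Cap (opp a), w)] []"
| rotate: "ls \<in> turns v \<Longrightarrow> local_move [(u, Vertex v, w)] (whisker u w ls)"

inductive isotopy_step :: "'v::plane_vertex diagram \<Rightarrow> 'v diagram \<Rightarrow> bool" where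
  "local_move m m' \<Longrightarrow> layered x (ls @ m @ ls') y \<Longrightarrow> layered x (ls @ m' @ ls') y \<Longrightarrow>
   isotopy_step (x, ls @ m @ ls', y) (x, ls @ m' @ ls', y)"

type_synonym 'v iclass = "'v diagram set"

definition iclass :: "'v::plane_vertex diagram \<Rightarrow> 'v iclass" where
  "iclass d = {d'. equivclp isotopy_step d d'}"

definition iclasses :: "obj \<Rightarrow> obj \<Rightarrow> 'v::plane_vertex iclass set" where
  "iclasses x y = {iclass (x, ls, y) | ls. layered x ls y}"

fun stack :: "'v diagram \<Rightarrow> 'v diagram \<Rightarrow> 'v diagram" where
  "stack (y, ls', z) (x, ls, y') = (x, ls @ ls', z)"

fun juxtapose :: "'v diagram \<Rightarrow> 'v diagram \<Rightarrow> 'v diagram" where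
  "juxtapose (x, ls, y) (x', ls', y') =
     (x @ x', whisker [] x' ls @ whisker y [] ls', y @ y')"

definition iclass_op ::
  "('v diagram \<Rightarrow> 'v diagram \<Rightarrow> 'v diagram) \<Rightarrow> 'v::plane_vertex iclass \<Rightarrow> 'v iclass \<Rightarrow> 'v iclass" where
  "iclass_op op A B = (\<Union>d\<in>A. \<Union>e\<in>B. iclass (op d e))"

fun caps :: "obj \<Rightarrow> 'v layer list" where
  "caps [] = []"
| "caps (a # x) = whisker [a] [opp a] (caps x) @ [([], Cap a, [])]"

fun cups :: "obj \<Rightarrow> 'v layer list" where
  "cups [] = []"
| "cups (a # x) = ([], Cup a, []) # whisker [a] [opp a] (cups x)"

type_synonym ('v, 'r) lincomb = "'v iclass \<Rightarrow>\<^sub>0 'r"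

definition dia :: "obj \<Rightarrow> 'v::plane_vertex layer list \<Rightarrow> obj \<Rightarrow>
    ('v, 'r::{comm_ring,comm_monoid_mult}) lincomb" where
  "dia x ls y = Poly_Mapping.single (iclass (x, ls, y)) 1"

definition smult :: "'r::{comm_ring,comm_monoid_mult} \<Rightarrow> ('d \<Rightarrow>\<^sub>0 'r) \<Rightarrow> ('d \<Rightarrow>\<^sub>0 'r)" where
  "smult r f = Poly_Mapping.map ((*) r) f"

definition bilinear_ext ::
  "('d \<Rightarrow> 'd \<Rightarrow> 'd) \<Rightarrow> ('d \<Rightarrow>\<^sub>0 'r::{comm_ring,comm_monoid_mult}) \<Rightarrow> ('d \<Rightarrow>\<^sub>0 'r) \<Rightarrow> ('d \<Rightarrow>\<^sub>0 'r)" where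
  "bilinear_ext op f g =
    (\<Sum>A\<in>Poly_Mapping.keys f. \<Sum>B\<in>Poly_Mapping.keys g.
       Poly_Mapping.single (op A B) (Poly_Mapping.lookup f A * Poly_Mapping.lookup g B))"

text \<open>
  Linear combinations of isotopy classes of diagrams.  As \<open>dual_obj (dual_obj x) = x\<close>, the left
  evaluation of \<open>x\<close> is drawn as the right evaluation of \<open>dual_obj x\<close>.
\<close>

definition diagram_cat ::
  "(obj, ('v::plane_vertex, 'r::{comm_ring,comm_monoid_mult}) lincomb, 'r) rigid_cat" where
  "diagram_cat = \<lparr>
    hom = \<lambda>x y. {f. Poly_Mapping.keys f \<subseteq> iclasses x y},
    ident = \<lambda>x. dia x [] x,
    cmp = \<lambda>x y z. bilinear_ext (iclass_op stack),
    zer = \<lambda>x y. 0,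
    add = \<lambda>x y. (+),
    scal = \<lambda>x y. smult,
    unit_ob = [],
    tens_ob = (@),
    tens = \<lambda>x x' y y'. bilinear_ext (iclass_op juxtapose),
    dual = dual_obj,
    ev_r = \<lambda>x. dia (x @ dual_obj x) (caps x) [],
    ev_l = \<lambda>x. dia (dual_obj x @ x) (caps (dual_obj x)) [],
    coev_r = \<lambda>x. dia [] (cups x) (x @ dual_obj x),
    coev_l = \<lambda>x. dia [] (cups (dual_obj x)) (dual_obj x @ x) \<rparr>"

text \<open>
  Extension of a braiding \<open>s a b : a b \<rightarrow> b a\<close> of single strands to sequences, by the hexagon
  identities.
\<close>

fun braid_strand ::
  "(obj, 'm, 'r) rigid_cat \<Rightarrow> (orient \<Rightarrow> orient \<Rightarrow> 'm) \<Rightarrow> orient \<Rightarrow> obj \<Rightarrow> 'm" where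
  "braid_strand C s a [] = ident C [a]"
| "braid_strand C s a (b # y) =
    cmp C (a # b # y) (b # a # y) (b # y @ [a])
      (tens C [b] [b] (a # y) (y @ [a]) (ident C [b]) (braid_strand C s a y))
      (tens C [a, b] [b, a] y y (s a b) (ident C y))"

fun braid_words ::
  "(obj, 'm, 'r) rigid_cat \<Rightarrow> (orient \<Rightarrow> orient \<Rightarrow> 'm) \<Rightarrow> obj \<Rightarrow> obj \<Rightarrow> 'm" where
  "braid_words C s [] y = ident C y"
| "braid_words C s (a # x) y =
    cmp C (a # x @ y) (a # y @ x) (y @ a # x)
      (tens C (a # y) (y @ [a]) x x (braid_strand C s a y) (ident C x))
      (tens C [a] [a] (x @ y) (y @ x) (ident C [a]) (braid_words C s x y))"


section \<open>Units\<close>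

definition unit_inv :: "'r::comm_monoid_mult \<Rightarrow> 'r" where
  "unit_inv x = (THE y. x * y = 1)"

definition unit_powi :: "'r::comm_monoid_mult \<Rightarrow> int \<Rightarrow> 'r" where
  "unit_powi x k = (if k \<ge> 0 then x ^ nat k else unit_inv x ^ nat (- k))"


section \<open>Tangles\<close>

text \<open>
  \<open>Crossing h a b : a b \<rightarrow> b a\<close>: the strand from bottom left to top right, with orientation \<open>a\<close>,
  crosses the strand from bottom right to top left, with orientation \<open>b\<close>; it is the over-strand
  iff \<open>h\<close>.  Thus \<open>Crossing True Up Up\<close> is the crossing \<open>X\<^sub>+\<close> and \<open>Crossing False Up Up\<close> is \<open>X\<^sub>-\<close>.
\<close>

datatype crossing = Crossing bool orient orient

instantiation crossing :: plane_vertex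
begin

fun vdom_crossing :: "crossing \<Rightarrow> obj" where
  "vdom_crossing (Crossing h a b) = [a, b]"

fun vcod_crossing :: "crossing \<Rightarrow> obj" where
  "vcod_crossing (Crossing h a b) = [b, a]"

text \<open>Rotations by a quarter turn, in both directions.\<close>

fun turns_crossing :: "crossing \<Rightarrow> crossing layer list set" where
  "turns_crossing (Crossing h a b) =
    {[([], Cup b, [a, b]), ([b], Vertex (Crossing (\<not> h) (opp b) a), [b]), ([b, a], Cap (opp b), [])],
     [([a, b], Cup (opp a), []), ([a], Vertex (Crossing (\<not> h) b (opp a)), [a]), ([], Cap a, [b, a])]}"

instance ..

end

definition cross :: "obj \<Rightarrow> bool \<Rightarrow> orient \<Rightarrow> orient \<Rightarrow> obj \<Rightarrow> crossing layer" where
  "cross u h a b w = (u, Vertex (Crossing h a b), w)"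

text \<open>
  All oriented Reidemeister moves, up to plane isotopy.  In the third move the three strands have
  orientations \<open>a\<close>, \<open>b\<close>, \<open>c\<close>, and \<open>p\<close>, \<open>q\<close>, \<open>r\<close> tell whether \<open>a\<close> is over \<open>b\<close>, \<open>a\<close> over \<open>c\<close>, \<open>b\<close> over
  \<open>c\<close>; the side condition says that these come from a linear order of the three heights.
\<close>

inductive reidemeister ::
  "obj \<Rightarrow> obj \<Rightarrow> (crossing, 'r::{comm_ring,comm_monoid_mult}) lincomb \<Rightarrow> bool" where
  R1_right: "reidemeister [a] [a]
    (dia [a] [([a], Cup a, []), cross [] h a a [opp a], ([a], Cap a, [])] [a] - dia [a] [] [a])"
| R1_left: "reidemeister [a] [a]
    (dia [a] [([], Cup (opp a), [a]), cross [opp a] h a a [], ([], Cap (opp a), [a])] [a]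
     - dia [a] [] [a])"
| R2: "reidemeister [a, b] [a, b]
    (dia [a, b] [cross [] h a b [], cross [] (\<not> h) b a []] [a, b] - dia [a, b] [] [a, b])"
| R3: "(p = r \<longrightarrow> q = p) \<Longrightarrow> reidemeister [a, b, c] [c, b, a]
    (dia [a, b, c] [cross [] p a b [c], cross [b] q a c [], cross [] r b c [a]] [c, b, a]
     - dia [a, b, c] [cross [a] r b c [], cross [] q a c [b], cross [c] p a b []] [c, b, a])"

definition plane_tangle_diagrams ::
  "(obj, (crossing, 'r::{comm_ring,comm_monoid_mult}) lincomb, 'r) rigid_cat" where
  "plane_tangle_diagrams = diagram_cat"

definition TD ::
  "(obj, (crossing, 'r::{comm_ring,comm_monoid_mult}) lincomb set, 'r) rigid_braided_cat" where
  "TD = quotient_cat plane_tangle_diagrams reidemeister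
     (braid_words plane_tangle_diagrams
        (\<lambda>a b. dia [a, b] [cross [] True a b []] [b, a]))"

inductive skein ::
  "'r \<Rightarrow> 'r \<Rightarrow> obj \<Rightarrow> obj \<Rightarrow> (crossing, 'r::{comm_ring,comm_monoid_mult}) lincomb set \<Rightarrow> bool"
  for \<alpha> z where
  crossing_change: "skein \<alpha> z [Up, Up] [Up, Up]
    (coset plane_tangle_diagrams reidemeister [Up, Up] [Up, Up]
      (smult \<alpha> (dia [Up, Up] [cross [] True Up Up []] [Up, Up])
       - smult (unit_inv \<alpha>) (dia [Up, Up] [cross [] False Up Up []] [Up, Up])
       - smult z (dia [Up, Up] [] [Up, Up])))"
| unknot: "skein \<alpha> z [] []
    (coset plane_tangle_diagrams reidemeister [] []
      (dia [] [([], Cup Up, []), ([], Cap Up, [])] []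
       - smult ((\<alpha> - unit_inv \<alpha>) * unit_inv z) (dia [] [] [])))"

definition HOMFLYPT :: "'r \<Rightarrow> 'r \<Rightarrow>
   (obj, (crossing, 'r::{comm_ring,comm_monoid_mult}) lincomb set set, 'r) rigid_braided_cat" where
  "HOMFLYPT \<alpha> z = quotient_cat TD (skein \<alpha> z) (braiding TD)"

definition to_HOMFLYPT :: "'r \<Rightarrow> 'r \<Rightarrow>
   (obj, (crossing, 'r::{comm_ring,comm_monoid_mult}) lincomb set,
    obj, (crossing, 'r) lincomb set set) cat_map" where
  "to_HOMFLYPT \<alpha> z = quotient_functor TD (skein \<alpha> z)"


section \<open>Trivalent plane graphs\<close>

text \<open>
  Objects are the sequences of \<open>\<up>\<^sup>1\<close> and \<open>\<down>\<^sup>1\<close>, written \<open>Up\<close> and \<open>Down\<close>.  An edge labelled 2 starts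
  at a merging of two edges labelled 1 and ends at a splitting into two such edges; \<open>Fork\<close> is this
  edge with its two end points.  \<open>Fork Up\<close> is \<open>S\<close> and \<open>Fork Down\<close> is its dual, obtained from \<open>S\<close>
  also by a half turn in either direction.
\<close>

datatype fork = Fork orient

instantiation fork :: plane_vertex
begin

fun vdom_fork :: "fork \<Rightarrow> obj" where
  "vdom_fork (Fork a) = [a, a]"

fun vcod_fork :: "fork \<Rightarrow> obj" where
  "vcod_fork (Fork a) = [a, a]"

fun turns_fork :: "fork \<Rightarrow> fork layer list set" where
  "turns_fork (Fork a) =
    {[([], Cup a, [a, a]), ([a], Cup a, [opp a, a, a]),
      ([a, a], Vertex (Fork (opp a)), [a, a]),
      ([a, a, opp a], Cap (opp a), [a]), ([a, a], Cap (opp a), [])],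
     [([a, a], Cup (opp a), []), ([a, a, opp a], Cup (opp a), [a]),
      ([a, a], Vertex (Fork (opp a)), [a, a]),
      ([a], Cap a, [opp a, a, a]), ([], Cap a, [a, a])]}"

instance ..

end

definition fork :: "obj \<Rightarrow> orient \<Rightarrow> obj \<Rightarrow> fork layer" where
  "fork u a w = (u, Vertex (Fork a), w)"

definition TrPD ::
  "(obj, (fork, 'r::{comm_ring,comm_monoid_mult}) lincomb, 'r) rigid_cat" where
  "TrPD = diagram_cat"

definition moy_int :: "'r \<Rightarrow> 'r \<Rightarrow> nat \<Rightarrow> int \<Rightarrow> 'r::{comm_ring,comm_monoid_mult}" where
  "moy_int \<alpha> \<zeta> n k =
    (unit_inv \<alpha> * unit_powi (- \<zeta>) (k - int n) - \<alpha> * unit_powi (- \<zeta>) (int n - k))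
    * unit_inv (\<zeta> - unit_inv \<zeta>)"

text \<open>The relations are obtained for \<open>a = Up\<close>, their duals for \<open>a = Down\<close>.\<close>

inductive moy_rel :: "'r \<Rightarrow> 'r \<Rightarrow> nat \<Rightarrow>
    obj \<Rightarrow> obj \<Rightarrow> (fork, 'r::{comm_ring,comm_monoid_mult}) lincomb \<Rightarrow> bool"
  for \<alpha> \<zeta> n where
  circle: "moy_rel \<alpha> \<zeta> n [] []
    (dia [] [([], Cup a, []), ([], Cap a, [])] []
     - smult (moy_int \<alpha> \<zeta> n (int n)) (dia [] [] []))"
| digon: "moy_rel \<alpha> \<zeta> n [a, a] [a, a]
    (dia [a, a] [fork [] a [], fork [] a []] [a, a]
     - smult (- (\<zeta> + unit_inv \<zeta>)) (dia [a, a] [fork [] a []] [a, a]))"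
| loop: "moy_rel \<alpha> \<zeta> n [a] [a]
    (dia [a] [([], Cup (opp a), [a]), fork [opp a] a [], ([], Cap (opp a), [a])] [a]
     - smult (moy_int \<alpha> \<zeta> n (int n - 1)) (dia [a] [] [a]))"
| square: "moy_rel \<alpha> \<zeta> n [a, opp a] [a, opp a]
    (dia [a, opp a]
       [([a], Cup a, [opp a]), fork [] a [opp a, opp a], fork [a, a] (opp a) [],
        ([a], Cap a, [opp a])] [a, opp a]
     - dia [a, opp a] [([], Cap a, []), ([], Cup a, [])] [a, opp a]
     - smult (moy_int \<alpha> \<zeta> n (int n - 2)) (dia [a, opp a] [] [a, opp a]))"
| braid: "moy_rel \<alpha> \<zeta> n [a, a, a] [a, a, a]
    (dia [a, a, a] [fork [] a [a], fork [a] a [], fork [] a [a]] [a, a, a]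
     + dia [a, a, a] [fork [a] a []] [a, a, a]
     - dia [a, a, a] [fork [a] a [], fork [] a [a], fork [a] a []] [a, a, a]
     - dia [a, a, a] [fork [] a [a]] [a, a, a])"

definition sigma_plus :: "'r \<Rightarrow> 'r \<Rightarrow> (fork, 'r::{comm_ring,comm_monoid_mult}) lincomb" where
  "sigma_plus \<alpha> \<zeta> = smult (unit_inv \<alpha>)
     (smult (unit_inv \<zeta>) (dia [Up, Up] [] [Up, Up]) + dia [Up, Up] [fork [] Up []] [Up, Up])"

definition sigma_minus :: "'r \<Rightarrow> 'r \<Rightarrow> (fork, 'r::{comm_ring,comm_monoid_mult}) lincomb" where
  "sigma_minus \<alpha> \<zeta> = smult \<alpha>
     (smult \<zeta> (dia [Up, Up] [] [Up, Up]) + dia [Up, Up] [fork [] Up []] [Up, Up])"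

text \<open>
  For \<open>f : x y \<rightarrow> y x\<close>, its rotations by a quarter turn \<open>mate_right C x y f : y x\<^sup>* \<rightarrow> x\<^sup>* y\<close> and
  \<open>mate_left C x y f : y\<^sup>* x \<rightarrow> x y\<^sup>*\<close>.
\<close>

definition mate_right ::
  "('o, 'm, 'r) rigid_cat \<Rightarrow> 'o \<Rightarrow> 'o \<Rightarrow> 'm \<Rightarrow> 'm" where
  "mate_right C x y f =
    (let d = dual C x; i = ident C; t = tens_ob C; dx = t d x; xd = t x d; yd = t y d; dy = t d y in
     cmp C yd (t dy xd) dy
       (tens C dy dy xd (unit_ob C) (i dy) (ev_r C x))
       (cmp C yd (t dx yd) (t dy xd)
         (tens C d d (t x yd) (t y xd) (i d) (tens C (t x y) (t y x) d d f (i d)))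
         (tens C (unit_ob C) dx yd yd (coev_l C x) (i yd))))"

definition mate_left ::
  "('o, 'm, 'r) rigid_cat \<Rightarrow> 'o \<Rightarrow> 'o \<Rightarrow> 'm \<Rightarrow> 'm" where
  "mate_left C x y f =
    (let d = dual C y; i = ident C; t = tens_ob C; dx = t d x; xd = t x d; yd = t y d; dy = t d y in
     cmp C dx (t dy xd) xd
       (tens C dy (unit_ob C) xd xd (ev_l C y) (i xd))
       (cmp C dx (t dx yd) (t dy xd)
         (tens C d d (t x yd) (t y xd) (i d) (tens C (t x y) (t y x) d d f (i d)))
         (tens C dx dx (unit_ob C) yd (i dx) (coev_r C y))))"

text \<open>
  The braiding of \<open>\<up>\<^sup>1\<close> with itself is \<open>\<sigma>\<^sup>+\<close>.  In a rigid braided category the braidings with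
  duals are the mates of the inverse braidings: a quarter turn makes the over-strand the
  other diagonal.
\<close>

fun moy_sigma :: "'r \<Rightarrow> 'r \<Rightarrow> orient \<Rightarrow> orient \<Rightarrow> (fork, 'r::{comm_ring,comm_monoid_mult}) lincomb" where
  "moy_sigma \<alpha> \<zeta> Up Up = sigma_plus \<alpha> \<zeta>"
| "moy_sigma \<alpha> \<zeta> Up Down = mate_right TrPD [Up] [Up] (sigma_minus \<alpha> \<zeta>)"
| "moy_sigma \<alpha> \<zeta> Down Up = mate_left TrPD [Up] [Up] (sigma_minus \<alpha> \<zeta>)"
| "moy_sigma \<alpha> \<zeta> Down Down =
     mate_right TrPD [Up] [Down] (mate_right TrPD [Up] [Up] (sigma_plus \<alpha> \<zeta>))"

definition MOY :: "'r \<Rightarrow> 'r \<Rightarrow> nat \<Rightarrow>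
   (obj, (fork, 'r::{comm_ring,comm_monoid_mult}) lincomb set, 'r) rigid_braided_cat" where
  "MOY \<alpha> \<zeta> n = quotient_cat TrPD (moy_rel \<alpha> \<zeta> n) (braid_words TrPD (moy_sigma \<alpha> \<zeta>))"

end

theory Submission
  imports Defs
begin

text \<open>
  Resolve each crossing of a tangle diagram into a linear combination of a smoothing and a fork; for
  antiparallel strands both are rotated by a quarter turn.  These values are compatible with
  rotations already as combinations of plane graphs up to isotopy, so they define a rigid functor
  from plane tangle diagrams to plane graphs before any relation is imposed.  The MOY relations
  kill the Reidemeister moves: R1 follows from the circle and loop relations, R2 for parallel and
  antiparallel strands from the digon and square relations, R3 for three parallel strands from the
  braid relation.  In R3 with arbitrary orientations, one strand may be assumed to be over or under
  both others (up to passing to inverses); sliding past cups and caps by R2, it slides past every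
  rotation of a crossing that it slides past.  Uniqueness holds because cups, caps and positive
  crossings are preserved by assumption, and negative crossings are inverses of positive ones.
\<close>

section \<open>Isotopies of layered diagrams\<close>

text \<open>Plane isotopy is only a generated equivalence relation on lists of layers, so nothing
  can be read off a class except through a representative. Isotopies of explicit diagrams are
  therefore split into rotations of single vertices and chains of exchanges and straightenings,
  which are executed mechanically. The value of a crossing depends on its sign. A quarter turn
  changes the over-strand diagonal and at the same time exchanges parallel and antiparallel strands,
  so the sign survives. This is why one formula serves all orientations and agrees with the mates
  that define the mixed braidings of MOY. The coefficients are tuned to the moves: the powers of
  \<alpha> normalize a resolved curl to 1, the antiparallel R2 amounts to the vanishing of
  \<open>[n] + (\<zeta> + \<zeta>^-1) [n-1] + [n-2]\<close>, and the parallel R3 amounts to an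
  identity between powers of \<zeta> that holds for heights coming from a linear order. The
  derivation of R3 in the other orientations is carried out for an abstract congruence of diagrams,
  so that resolving a crossing never multiplies the number of terms there.\<close>

lemma opp_opp [simp]: "opp (opp a) = a"
  by (cases a) auto

lemma dual_obj_simps [simp]: "dual_obj [] = []" "dual_obj (a # x) = dual_obj x @ [opp a]"
  by (auto simp: dual_obj_def)

lemma dual_obj_dual_obj [simp]: "dual_obj (dual_obj x) = x"
  by (simp add: dual_obj_def rev_map o_def)

lemma whisker_simps [simp]:
  "whisker s t [] = []"
  "whisker s t ((u, p, w) # ls) = (s @ u, p, w @ t) # whisker s t ls"
  "whisker s t (ls @ ls') = whisker s t ls @ whisker s t ls'"
  "whisker s t (whisker s' t' ls) = whisker (s @ s') (t' @ t) ls"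
  "whisker [] [] ls = ls"
  by (auto simp: whisker_def)

lemma layered_append: "layered x (ls @ ls') z \<longleftrightarrow> (\<exists>y. layered x ls y \<and> layered y ls' z)"
  by (induction ls arbitrary: x) auto

lemma layered_appendI:
  "layered x ls y \<Longrightarrow> layered y ls' z \<Longrightarrow> layered x (ls @ ls') z"
  by (auto simp: layered_append)

lemma layered_unique: "layered x ls y \<Longrightarrow> layered x ls y' \<Longrightarrow> y = y'"
  by (induction ls arbitrary: x) auto

lemma layered_whisker: "layered x ls y \<Longrightarrow> layered (s @ x @ t) (whisker s t ls) (s @ y @ t)"
  by (induction ls arbitrary: x) force+

lemma layered_whisker_right: "layered x ls y \<Longrightarrow> layered (x @ t) (whisker [] t ls) (y @ t)"
  using layered_whisker[of x ls y "[]" t] by simp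

lemma layered_whisker_left: "layered x ls y \<Longrightarrow> layered (s @ x) (whisker s [] ls) (s @ y)"
  using layered_whisker[of x ls y s "[]"] by simp

lemma layered_caps: "layered (x @ dual_obj x) (caps x) []"
proof (induction x)
  case (Cons a x)
  then show ?case
    using layered_whisker[OF Cons, of "[a]" "[opp a]"] by (auto intro!: layered_appendI)
qed auto

lemma layered_cups: "layered [] (cups x) (x @ dual_obj x)"
proof (induction x)
  case (Cons a x)
  then show ?case
    using layered_whisker[OF Cons, of "[a]" "[opp a]"] by simp
qed auto

section \<open>Isotopy of layer lists with fixed boundary\<close>

definition isotopic :: "obj \<Rightarrow> 'v::plane_vertex layer list \<Rightarrow> 'v layer list \<Rightarrow> obj \<Rightarrow> bool" where
  "isotopic x ls ls' y \<longleftrightarrow>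
     layered x ls y \<and> layered x ls' y \<and> equivclp isotopy_step (x, ls, y) (x, ls', y)"

lemma isotopic_refl: "layered x ls y \<Longrightarrow> isotopic x ls ls y"
  by (simp add: isotopic_def)

lemma isotopic_sym: "isotopic x ls ls' y \<Longrightarrow> isotopic x ls' ls y"
  by (auto simp: isotopic_def intro: equivclp_sym)

lemma isotopic_trans [trans]: "isotopic x l1 l2 y \<Longrightarrow> isotopic x l2 l3 y \<Longrightarrow> isotopic x l1 l3 y"
  by (auto simp: isotopic_def intro: equivclp_trans)

lemma isotopicD: "isotopic x ls ls' y \<Longrightarrow> layered x ls y" "isotopic x ls ls' y \<Longrightarrow> layered x ls' y"
  by (auto simp: isotopic_def)

lemma isotopy_step_boundary:
  assumes "isotopy_step d e"
  obtains x l l' y where "d = (x, l, y)" "e = (x, l', y)" "layered x l y" "layered x l' y"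
  using assms by cases blast

text \<open>A step never changes the boundary words, so a whole chain of steps can be transported
  one step at a time. The map \<open>h\<close> is left arbitrary to serve for whiskering, for
  insertion into a context and, as the identity, for reading off the shape of the members of a
  class.\<close>

lemma equivclp_isotopy_step_map:
  assumes "equivclp isotopy_step (x, ls, y) d"
    and step: "\<And>l l'. isotopy_step (x, l, y) (x, l', y) \<Longrightarrow>
       equivclp isotopy_step (x', h l, y') (x', h l', y')"
  shows "\<exists>ls'. d = (x, ls', y) \<and> (layered x ls y \<longrightarrow> layered x ls' y) \<and>
    equivclp isotopy_step (x', h ls, y') (x', h ls', y')"
  using assms(1)
proof (induction rule: equivclp_induct)
  case base
  then show ?case by auto
next
  case (step d e)
  from step.IH obtain l where l: "d = (x, l, y)" "layered x ls y \<longrightarrow> layered x l y"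
    "equivclp isotopy_step (x', h ls, y') (x', h l, y')" by blast
  from step.hyps(2) have "isotopy_step d e \<or> isotopy_step e d"
    by (simp add: symclp_def)
  then obtain l' where l': "e = (x, l', y)" "layered x l' y"
    using l(1) by (blast elim: isotopy_step_boundary)
  have "equivclp isotopy_step (x', h l, y') (x', h l', y')"
    using \<open>isotopy_step d e \<or> isotopy_step e d\<close> assms(2) unfolding l(1) l'(1)
    by (blast intro: equivclp_sym)
  with l l' show ?case by (blast intro: equivclp_trans)
qed

lemma isotopic_map:
  assumes "isotopic x ls ls' y"
    and "\<And>l l'. isotopy_step (x, l, y) (x, l', y) \<Longrightarrow> isotopy_step (x', h l, y') (x', h l', y')"
    and "\<And>l. layered x l y \<Longrightarrow> layered x' (h l) y'"
  shows "isotopic x' (h ls) (h ls') y'"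
  using assms equivclp_isotopy_step_map[of x ls y "(x, ls', y)" x' h y']
  by (auto simp: isotopic_def r_into_equivclp)

lemma isotopy_step_append:
  assumes "isotopy_step (x, l, y) (x, l', y)" "layered w pre x" "layered y post z"
  shows "isotopy_step (w, pre @ l @ post, z) (w, pre @ l' @ post, z)"
  using assms(1)
proof cases
  case (1 m m' ls ls')
  have "isotopy_step (w, (pre @ ls) @ m @ (ls' @ post), z) (w, (pre @ ls) @ m' @ (ls' @ post), z)"
    using 1 assms(2,3) by (intro isotopy_step.intros) (auto simp: layered_append)
  with 1 show ?thesis by simp
qed

lemma isotopic_context:
  assumes "isotopic x l l' y" "layered w pre x" "layered y post z"
  shows "isotopic w (pre @ l @ post) (pre @ l' @ post) z"
  by (rule isotopic_map[OF assms(1), where h = "\<lambda>l. pre @ l @ post"])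
    (use assms in \<open>auto intro: isotopy_step_append simp: layered_append\<close>)

lemma isotopic_append:
  assumes "isotopic x l1 l1' y" "isotopic y l2 l2' z"
  shows "isotopic x (l1 @ l2) (l1' @ l2') z"
  using isotopic_context[OF assms(1), of x "[]" l2 z]
    isotopic_context[OF assms(2), of x l1' "[]" z] assms
  by (auto simp: isotopicD intro: isotopic_trans)

lemma local_move_whisker: "local_move m m' \<Longrightarrow> local_move (whisker s t m) (whisker s t m')"
proof (induction rule: local_move.induct)
  case (exchange u p v q w)
  then show ?case using local_move.exchange[of "s @ u" p v q "w @ t"] by simp
next
  case (straighten_right u a w)
  then show ?case using local_move.straighten_right[of "s @ u" a "w @ t"] by simp
next
  case (straighten_left u a w)
  then show ?case using local_move.straighten_left[of "s @ u" a "w @ t"] by simp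
next
  case (rotate ls v u w)
  then show ?case using local_move.rotate[of ls v "s @ u" "w @ t"] by simp
qed

lemma isotopy_step_whisker:
  assumes "isotopy_step (x, l, y) (x, l', y)"
  shows "isotopy_step (s @ x @ t, whisker s t l, s @ y @ t) (s @ x @ t, whisker s t l', s @ y @ t)"
  using assms
proof cases
  case (1 m m' ls ls')
  have "isotopy_step (s @ x @ t, whisker s t ls @ whisker s t m @ whisker s t ls', s @ y @ t)
     (s @ x @ t, whisker s t ls @ whisker s t m' @ whisker s t ls', s @ y @ t)"
    using local_move_whisker[OF 1(3)] layered_whisker[OF 1(4), of s t] layered_whisker[OF 1(5), of s t]
    by (intro isotopy_step.intros) simp_all
  with 1 show ?thesis by simp
qed

lemma isotopic_whisker:
  "isotopic x ls ls' y \<Longrightarrow> isotopic (s @ x @ t) (whisker s t ls) (whisker s t ls') (s @ y @ t)"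
  by (rule isotopic_map) (auto intro: isotopy_step_whisker layered_whisker)

lemma isotopic_local_move:
  assumes "local_move m m'" "layered x m y" "layered x m' y"
  shows "isotopic x m m' y"
  using isotopy_step.intros[of m m' x "[]" "[]" y] assms
  by (auto simp: isotopic_def intro: r_into_equivclp)

lemma isotopic_local_move_context:
  assumes "local_move m m'" "layered x (ls @ m @ ls') y" "layered x (ls @ m' @ ls') y"
  shows "isotopic x (ls @ m @ ls') (ls @ m' @ ls') y"
  using isotopy_step.intros[of m m' x ls ls' y] assms
  by (auto simp: isotopic_def intro: r_into_equivclp)

lemma isotopic_interchange_layer:
  assumes "layered x [l] y" "layered x' ls' y'"
  shows "isotopic (x @ x') (whisker [] x' [l] @ whisker y [] ls')
     (whisker x [] ls' @ whisker [] y' [l]) (y @ y')"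
  using assms(2)
proof (induction ls' arbitrary: x')
  case Nil
  then show ?case using layered_whisker_right[OF assms(1), of x'] by (auto intro: isotopic_refl)
next
  case (Cons l' ls')
  obtain u p w where l: "l = (u, p, w)" by (cases l)
  obtain u' q w' where l': "l' = (u', q, w')" by (cases l')
  from assms l have x: "x = u @ pdom p @ w" "y = u @ pcod p @ w" by auto
  let ?x'' = "u' @ pcod q @ w'"
  from Cons.prems l' have x': "x' = u' @ pdom q @ w'" and ls': "layered ?x'' ls' y'" by auto
  have "isotopic (x @ x') ([(u, p, w @ x'), (y @ u', q, w')] @ whisker y [] ls')
     ([(x @ u', q, w'), (u, p, w @ ?x'')] @ whisker y [] ls') (y @ y')"
    using local_move.exchange[of u p "w @ u'" q w'] layered_whisker_left[OF ls', of y]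
    by (intro isotopic_local_move_context[of _ _ _ "[]", simplified]) (auto simp: x x')
  moreover have "isotopic (x @ x') ([(x @ u', q, w')] @ whisker [] ?x'' [l] @ whisker y [] ls')
      ([(x @ u', q, w')] @ whisker x [] ls' @ whisker [] y' [l]) (y @ y')"
    using isotopic_context[OF Cons.IH[OF ls'], of "x @ x'" "[(x @ u', q, w')]" "[]" "y @ y'"]
    by (simp add: x')
  ultimately show ?case
    by (auto simp: l l' intro: isotopic_trans)
qed

text \<open>The layers of the left diagram rise above the right diagram one at a time, the topmost
  first.\<close>

lemma isotopic_interchange:
  assumes "layered x ls y" "layered x' ls' y'"
  shows "isotopic (x @ x') (whisker [] x' ls @ whisker y [] ls')
     (whisker x [] ls' @ whisker [] y' ls) (y @ y')"
  using assms(1)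
proof (induction ls arbitrary: x)
  case Nil
  then show ?case using layered_whisker_left[OF assms(2)] by (auto intro: isotopic_refl)
next
  case (Cons l ls)
  obtain z where z: "layered x [l] z" "layered z ls y"
    using Cons.prems layered_append[of x "[l]" ls y] by auto
  note assms' = layered_whisker_right[OF z(1)] layered_whisker_right[OF z(2)]
  have "isotopic (x @ x') (whisker [] x' [l] @ (whisker [] x' ls @ whisker y [] ls'))
     (whisker [] x' [l] @ (whisker z [] ls' @ whisker [] y' ls)) (y @ y')"
    by (rule isotopic_append[OF isotopic_refl Cons.IH]) (use z assms' in auto)
  moreover have "isotopic (x @ x') (whisker [] x' [l] @ whisker z [] ls' @ whisker [] y' ls)
     (whisker x [] ls' @ whisker [] y' [l] @ whisker [] y' ls) (y @ y')"
    using isotopic_append[OF isotopic_interchange_layer[OF z(1) assms(2)]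
        isotopic_refl[OF layered_whisker_right[OF z(2)]]] by simp
  ultimately have "isotopic (x @ x') (whisker [] x' [l] @ whisker [] x' ls @ whisker y [] ls')
     (whisker x [] ls' @ whisker [] y' [l] @ whisker [] y' ls) (y @ y')"
    by (rule isotopic_trans)
  then show ?case by (cases l) simp
qed

text \<open>
  In a layered diagram the positions of two consecutive pieces, read off from the lengths alone,
  decide whether they form a zigzag or can be exchanged.  So a list of heights encodes an isotopy.
\<close>

fun push :: "'v::plane_vertex layer \<Rightarrow> 'v layer \<Rightarrow> 'v layer list" where
  "push (u, p, w) (u', q, w') =
    (if (\<exists>b. p = Cup b) \<and> (\<exists>b. q = Cap b) \<and>
        (length u = Suc (length u') \<or> length u' = Suc (length u)) then []
     else if length u + length (pcod p) \<le> length u' then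
       let v = drop (length u + length (pcod p)) u' in [(u @ pdom p @ v, q, w'), (u, p, v @ pcod q @ w')]
     else if length u' + length (pdom q) \<le> length u then
       let v = drop (length u' + length (pdom q)) u in [(u', q, v @ pdom p @ w), (u' @ pcod q @ v, p, w)]
     else [(u, p, w), (u', q, w')])"

fun push_at :: "nat \<Rightarrow> 'v::plane_vertex layer list \<Rightarrow> 'v layer list" where
  "push_at 0 (l # l' # ls) = push l l' @ ls"
| "push_at (Suc i) (l # ls) = l # push_at i ls"
| "push_at i ls = ls"

lemma append_eq_appendD: "a @ b = c @ d \<Longrightarrow> length a \<le> length c \<Longrightarrow> c = a @ drop (length a) c \<and> b = drop (length a) c @ d"
  by (metis append_eq_append_conv_if append_take_drop_id)

text \<open>The two layers share the word between them,
  \<open>u @ pcod p @ w = u' @ pdom q @ w'\<close>. Once the lengths are known, this equation splits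
  letter by letter; for a cup and a cap overlapping in one strand it also forces the orientations of
  a zigzag.\<close>

lemma isotopic_push:
  assumes "layered x [l, l'] y"
  shows "isotopic x [l, l'] (push l l') y"
proof -
  obtain u p w where l: "l = (u, p, w)" by (cases l)
  obtain u' q w' where l': "l' = (u', q, w')" by (cases l')
  from assms l l' have x: "x = u @ pdom p @ w" and y: "y = u' @ pcod q @ w'"
    and eq: "u @ pcod p @ w = u' @ pdom q @ w'" by auto
  consider (right) b c where "p = Cup b" "q = Cap c" "length u = Suc (length u')"
    | (left) b c where "p = Cup b" "q = Cap c" "length u' = Suc (length u)"
    | (xr) "push l l' = (let v = drop (length u + length (pcod p)) u' in
         [(u @ pdom p @ v, q, w'), (u, p, v @ pcod q @ w')])"
        "length u + length (pcod p) \<le> length u'"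
    | (xl) "push l l' = (let v = drop (length u' + length (pdom q)) u in
         [(u', q, v @ pdom p @ w), (u' @ pcod q @ v, p, w)])"
        "length u' + length (pdom q) \<le> length u"
    | (none) "push l l' = [l, l']"
  proof -
    let ?A = "(\<exists>b. p = Cup b) \<and> (\<exists>b. q = Cap b) \<and>
        (length u = Suc (length u') \<or> length u' = Suc (length u))"
    consider ?A
      | "\<not> ?A" "length u + length (pcod p) \<le> length u'"
      | "\<not> ?A" "\<not> length u + length (pcod p) \<le> length u'" "length u' + length (pdom q) \<le> length u"
      | "\<not> ?A" "\<not> length u + length (pcod p) \<le> length u'" "\<not> length u' + length (pdom q) \<le> length u"
      by argo
    then show thesis
      by cases (use that in \<open>simp_all only: l l' push.simps if_True if_False\<close>, blast+)
  qed
  then show ?thesis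
  proof cases
    case right
    define v where "v = drop (length u') u"
    have "u = u' @ v" "[c, opp c] @ w' = v @ [b, opp b] @ w"
      using append_eq_appendD[of u' "[c, opp c] @ w'" u "[b, opp b] @ w"] eq right
      by (simp_all add: v_def)
    moreover from this(1) right obtain d where "v = [d]"
      by (cases v) auto
    ultimately have *: "u = u' @ [c]" "b = opp c" "w' = c # w" by auto
    then show ?thesis
      using local_move.straighten_right[of u' c w] right assms
      by (intro isotopic_local_move) (auto simp: l l' x y)
  next
    case left
    define v where "v = drop (length u) u'"
    have "u' = u @ v" "[b, opp b] @ w = v @ [c, opp c] @ w'"
      using append_eq_appendD[of u "[b, opp b] @ w" u' "[c, opp c] @ w'"] eq left
      by (simp_all add: v_def)
    moreover from this(1) left obtain d where "v = [d]"
      by (cases v) auto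
    ultimately have "u' = u @ [b]" "c = opp b" "w = b # w'" by auto
    then show ?thesis
      using local_move.straighten_left[of u b w'] left assms
      by (intro isotopic_local_move) (auto simp: l l' x y)
  next
    case xr
    define v where "v = drop (length u + length (pcod p)) u'"
    have "u' = u @ pcod p @ v" "w = v @ pdom q @ w'"
      using append_eq_appendD[of "u @ pcod p" w u' "pdom q @ w'"] xr eq by (auto simp: v_def)
    then show ?thesis
      using local_move.exchange[of u p v q w'] xr assms
      by (intro isotopic_local_move) (auto simp: l l' x y v_def[symmetric] Let_def)
  next
    case xl
    define v where "v = drop (length u' + length (pdom q)) u"
    have "u = u' @ pdom q @ v" "w' = v @ pcod p @ w"
      using append_eq_appendD[of "u' @ pdom q" w' u "pcod p @ w"] xl eq by (auto simp: v_def)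
    then show ?thesis
      using local_move.exchange[of u' q v p w] xl assms
      by (intro isotopic_sym[OF isotopic_local_move]) (auto simp: l l' x y v_def[symmetric] Let_def)
  next
    case none
    then show ?thesis using assms isotopic_refl by simp
  qed
qed

lemma isotopic_push_at:
  assumes "layered x ls y"
  shows "isotopic x ls (push_at i ls) y"
  using assms
proof (induction i ls arbitrary: x rule: push_at.induct)
  case (1 l l' ls)
  then obtain z where z: "layered x [l, l'] z" "layered z ls y"
    using layered_append[of x "[l, l']" ls y] by auto
  show ?case
    using isotopic_append[OF isotopic_push[OF z(1)] isotopic_refl[OF z(2)]] by simp
next
  case (2 i l ls)
  then obtain z where z: "layered x [l] z" "layered z ls y"
    using layered_append[of x "[l]" ls y] by auto
  show ?case
    using isotopic_append[OF isotopic_refl[OF z(1)] "2.IH"[OF z(2)]] by simp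
qed (auto intro: isotopic_refl)

definition deform :: "nat list \<Rightarrow> 'v::plane_vertex layer list \<Rightarrow> 'v layer list" where
  "deform ms ls = fold push_at ms ls"

lemma isotopic_deform: "layered x ls y \<Longrightarrow> isotopic x ls (deform ms ls) y"
proof (induction ms arbitrary: ls)
  case (Cons i ms)
  then show ?case
    using isotopic_push_at[OF Cons.prems, of i] by (auto simp: deform_def dest: isotopicD intro: isotopic_trans)
qed (auto simp: deform_def intro: isotopic_refl)

text \<open>Both sides are brought to a common diagram, so that an isotopy is checked by evaluating
  two lists. Rotations of vertices are not among the moves of \<open>push\<close> and have to be
  supplied separately.\<close>

lemma isotopic_by_deform:
  assumes "layered x ls y" "layered x ls' y" "deform ms ls = deform ns ls'"
  shows "isotopic x ls ls' y"
  using isotopic_deform[OF assms(1), of ms] isotopic_deform[OF assms(2), of ns] assms(3)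
  by (auto intro: isotopic_trans isotopic_sym)

section \<open>Linear combinations of diagrams\<close>

lemma lookup_smult [simp]: "Poly_Mapping.lookup (smult r f) k = r * Poly_Mapping.lookup f k"
  unfolding smult_def by (auto simp: Poly_Mapping.map.rep_eq when_def)

lemma smult_simps [simp]:
  "smult r 0 = 0" "smult 0 f = 0" "smult 1 f = f" "smult r (smult s f) = smult (r * s) f"
  "smult r (Poly_Mapping.single k s) = Poly_Mapping.single k (r * s)"
  by (auto intro!: poly_mapping_eqI simp: mult.assoc lookup_single when_def)

lemma smult_distribs:
  "smult r (f + g) = smult r f + smult r g" "smult r (f - g) = smult r f - smult r g"
  "smult (r + s) f = smult r f + smult s f" "smult (- r) f = - smult r f"
  "smult (r - s) f = smult r f - smult s f" "smult r (- f) = - smult r f"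
  by (auto intro!: poly_mapping_eqI simp: algebra_simps lookup_add lookup_minus)

lemma keys_smult: "Poly_Mapping.keys (smult r f) \<subseteq> Poly_Mapping.keys f"
  by (auto simp: in_keys_iff)

text \<open>Enlarging the supports adds only zero terms. Additivity needs this freedom, because
  coefficients may cancel in a sum and its keys may then be fewer than the keys of the summands
  together.\<close>

lemma bilinear_ext_eq_sum:
  assumes "finite S" "Poly_Mapping.keys f \<subseteq> S" "finite T" "Poly_Mapping.keys g \<subseteq> T"
  shows "bilinear_ext op f g = (\<Sum>A\<in>S. \<Sum>B\<in>T.
    Poly_Mapping.single (op A B) (Poly_Mapping.lookup f A * Poly_Mapping.lookup g B))"
proof -
  have "(\<Sum>B\<in>Poly_Mapping.keys g. Poly_Mapping.single (op A B) (r * Poly_Mapping.lookup g B)) =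
        (\<Sum>B\<in>T. Poly_Mapping.single (op A B) (r * Poly_Mapping.lookup g B))" for A r
    using assms by (intro sum.mono_neutral_left) (auto simp: in_keys_iff)
  then show ?thesis
    unfolding bilinear_ext_def using assms
    by simp (intro sum.mono_neutral_left, auto simp: in_keys_iff)
qed

lemma bilinear_ext_zero [simp]: "bilinear_ext op 0 g = 0" "bilinear_ext op f 0 = 0"
  by (simp_all add: bilinear_ext_def)

lemma bilinear_ext_add_left: "bilinear_ext op (f + f') g = bilinear_ext op f g + bilinear_ext op f' g"
proof -
  let ?S = "Poly_Mapping.keys f \<union> Poly_Mapping.keys f'" and ?T = "Poly_Mapping.keys g"
  have "Poly_Mapping.keys (f + f') \<subseteq> ?S" by (rule Poly_Mapping.keys_add)
  then show ?thesis
    by (simp add: bilinear_ext_eq_sum[where S = ?S and T = ?T] lookup_add distrib_right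
        single_add sum.distrib)
qed

lemma bilinear_ext_add_right: "bilinear_ext op f (g + g') = bilinear_ext op f g + bilinear_ext op f g'"
proof -
  let ?T = "Poly_Mapping.keys g \<union> Poly_Mapping.keys g'" and ?S = "Poly_Mapping.keys f"
  have "Poly_Mapping.keys (g + g') \<subseteq> ?T" by (rule Poly_Mapping.keys_add)
  then show ?thesis
    by (simp add: bilinear_ext_eq_sum[where S = ?S and T = ?T] lookup_add distrib_left
        single_add sum.distrib)
qed

lemma smult_sum: "smult r (sum h A) = (\<Sum>a\<in>A. smult r (h a))"
  by (induction A rule: infinite_finite_induct) (auto simp: smult_distribs)

lemma bilinear_ext_smult:
  "bilinear_ext op (smult r f) g = smult r (bilinear_ext op f g)"
  "bilinear_ext op f (smult r g) = smult r (bilinear_ext op f g)"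
proof -
  let ?S = "Poly_Mapping.keys f" and ?T = "Poly_Mapping.keys g"
  show "bilinear_ext op (smult r f) g = smult r (bilinear_ext op f g)"
    using keys_smult[of r f]
    by (simp add: bilinear_ext_eq_sum[where S = ?S and T = ?T] smult_sum mult_ac)
  show "bilinear_ext op f (smult r g) = smult r (bilinear_ext op f g)"
    using keys_smult[of r g]
    by (simp add: bilinear_ext_eq_sum[where S = ?S and T = ?T] smult_sum mult_ac)
qed

lemma bilinear_ext_minus:
  "bilinear_ext op (- f) g = - bilinear_ext op f g" "bilinear_ext op f (- g) = - bilinear_ext op f g"
  using bilinear_ext_smult(1)[of op "- 1" f g] bilinear_ext_smult(2)[of op f "- 1" g]
  by (simp_all add: smult_distribs)

lemma bilinear_ext_diff:
  "bilinear_ext op (f - f') g = bilinear_ext op f g - bilinear_ext op f' g"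
  "bilinear_ext op f (g - g') = bilinear_ext op f g - bilinear_ext op f g'"
  using bilinear_ext_add_left[of op f "- f'" g] bilinear_ext_add_right[of op f g "- g'"]
  by (simp_all add: bilinear_ext_minus)

lemma bilinear_ext_single:
  "bilinear_ext op (Poly_Mapping.single A r) (Poly_Mapping.single B s) = Poly_Mapping.single (op A B) (r * s)"
  using bilinear_ext_eq_sum[of "{A}" "Poly_Mapping.single A r" "{B}" "Poly_Mapping.single B s" op]
  by (simp add: lookup_single)

section \<open>Operations on isotopy classes and on their linear combinations\<close>

lemma iclass_eq_iff: "iclass d = iclass d' \<longleftrightarrow> equivclp isotopy_step d d'"
proof
  assume "iclass d = iclass d'"
  then show "equivclp isotopy_step d d'"
    by (metis CollectD CollectI iclass_def equivclp_refl equivclp_sym)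
qed (auto simp: iclass_def intro: equivclp_trans equivclp_sym)

lemma iclass_eqI: "isotopic x ls ls' y \<Longrightarrow> iclass (x, ls, y) = iclass (x, ls', y)"
  by (simp add: iclass_eq_iff isotopic_def)

lemma mem_iclassE:
  assumes "d \<in> iclass (x, ls, y)" "layered x ls y"
  obtains ls' where "d = (x, ls', y)" "isotopic x ls ls' y"
proof -
  have "equivclp isotopy_step (x, ls, y) d" using assms(1) by (simp add: iclass_def)
  with equivclp_isotopy_step_map[OF this, of x "\<lambda>l. l" y] assms(2) that show thesis
    by (auto simp: isotopic_def)
qed

text \<open>Operations on classes are unions over all representatives; a union of equal sets over a
  nonempty index set collapses to that set.\<close>

lemma iclass_op_eq:
  assumes "layered x ls y" "layered x' ls' y'"
    and "\<And>l l'. isotopic x ls l y \<Longrightarrow> isotopic x' ls' l' y' \<Longrightarrow>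
       iclass (op (x, l, y) (x', l', y')) = A"
  shows "iclass_op op (iclass (x, ls, y)) (iclass (x', ls', y')) = A"
proof -
  have "(x, ls, y) \<in> iclass (x, ls, y)" "(x', ls', y') \<in> iclass (x', ls', y')"
    by (auto simp: iclass_def)
  moreover have "iclass (op d e) = A" if "d \<in> iclass (x, ls, y)" "e \<in> iclass (x', ls', y')" for d e
    using that assms by (auto elim!: mem_iclassE)
  ultimately show ?thesis unfolding iclass_op_def by blast
qed

lemma iclass_op_stack:
  assumes "layered x ls y" "layered y ls' z"
  shows "iclass_op stack (iclass (y, ls', z)) (iclass (x, ls, y)) = iclass (x, ls @ ls', z)"
  by (rule iclass_op_eq[OF assms(2,1)])
    (auto intro!: iclass_eqI intro: isotopic_append isotopic_sym)

lemma iclass_op_juxtapose: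
  assumes "layered x ls y" "layered x' ls' y'"
  shows "iclass_op juxtapose (iclass (x, ls, y)) (iclass (x', ls', y')) =
    iclass (x @ x', whisker [] x' ls @ whisker y [] ls', y @ y')"
proof (rule iclass_op_eq[OF assms])
  fix l l'
  assume "isotopic x ls l y" "isotopic x' ls' l' y'"
  then have "isotopic (x @ x') (whisker [] x' ls @ whisker y [] ls') (whisker [] x' l @ whisker y [] l') (y @ y')"
    using isotopic_whisker[of x ls l y "[]" x'] isotopic_whisker[of x' ls' l' y' y "[]"]
    by (intro isotopic_append) auto
  then show "iclass (juxtapose (x, l, y) (x', l', y')) =
      iclass (x @ x', whisker [] x' ls @ whisker y [] ls', y @ y')"
    by (auto intro!: iclass_eqI intro: isotopic_sym)
qed

abbreviation homs :: "obj \<Rightarrow> obj \<Rightarrow> ('v::plane_vertex, 'r::{comm_ring,comm_monoid_mult}) lincomb set" where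
  "homs \<equiv> hom diagram_cat"

abbreviation lin_comp :: "('v::plane_vertex, 'r::{comm_ring,comm_monoid_mult}) lincomb \<Rightarrow>
    ('v, 'r) lincomb \<Rightarrow> ('v, 'r) lincomb" (infixr "\<diamondop>" 70) where
  "g \<diamondop> f \<equiv> bilinear_ext (iclass_op stack) g f"

abbreviation lin_tens :: "('v::plane_vertex, 'r::{comm_ring,comm_monoid_mult}) lincomb \<Rightarrow>
    ('v, 'r) lincomb \<Rightarrow> ('v, 'r) lincomb" (infixr "\<otimes>" 75) where
  "f \<otimes> g \<equiv> bilinear_ext (iclass_op juxtapose) f g"

abbreviation lin_id :: "obj \<Rightarrow> ('v::plane_vertex, 'r::{comm_ring,comm_monoid_mult}) lincomb" where
  "lin_id x \<equiv> dia x [] x"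

lemma homs_eq: "homs x y = {f. Poly_Mapping.keys f \<subseteq> iclasses x y}"
  by (simp add: diagram_cat_def)

lemma dia_eqI: "isotopic x ls ls' y \<Longrightarrow> dia x ls y = dia x ls' y"
  by (simp add: dia_def iclass_eqI)

lemma dia_in_homs: "layered x ls y \<Longrightarrow> dia x ls y \<in> homs x y"
  by (auto simp: homs_eq dia_def iclasses_def)

lemma dia_comp [simp]:
  "layered x ls y \<Longrightarrow> layered y ls' z \<Longrightarrow> dia y ls' z \<diamondop> dia x ls y = dia x (ls @ ls') z"
  by (simp add: dia_def bilinear_ext_single iclass_op_stack)

lemma dia_tens [simp]:
  "layered x ls y \<Longrightarrow> layered x' ls' y' \<Longrightarrow>
   dia x ls y \<otimes> dia x' ls' y' = dia (x @ x') (whisker [] x' ls @ whisker y [] ls') (y @ y')"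
  by (simp add: dia_def bilinear_ext_single iclass_op_juxtapose)

lemma homs_zero: "0 \<in> homs x y"
  by (simp add: homs_eq)

lemma homs_add: "f \<in> homs x y \<Longrightarrow> g \<in> homs x y \<Longrightarrow> f + g \<in> homs x y"
  using Poly_Mapping.keys_add[of f g] by (auto simp: homs_eq)

lemma homs_smult: "f \<in> homs x y \<Longrightarrow> smult r f \<in> homs x y"
  using keys_smult[of r f] by (auto simp: homs_eq)

lemma homs_minus: "f \<in> homs x y \<Longrightarrow> - f \<in> homs x y"
  by (simp add: homs_eq)

lemma homs_diff: "f \<in> homs x y \<Longrightarrow> g \<in> homs x y \<Longrightarrow> f - g \<in> homs x y"
  using homs_add[OF _ homs_minus, of f x y g] by simp

lemma poly_mapping_sum_singles:
  "f = (\<Sum>A\<in>Poly_Mapping.keys f. Poly_Mapping.single A (Poly_Mapping.lookup f A))"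
  by (rule poly_mapping_eqI) (auto simp: lookup_sum lookup_single when_def in_keys_iff)

text \<open>Reduces multilinear identities to diagrams. Zero is a case of its own because there may
  be no diagram at all between the two words.\<close>

lemma homs_induct [consumes 1, case_names zero dia smult add]:
  assumes "f \<in> homs x y" "P 0"
    and dia: "\<And>ls. layered x ls y \<Longrightarrow> P (dia x ls y)"
    and smult: "\<And>r f. f \<in> homs x y \<Longrightarrow> P f \<Longrightarrow> P (smult r f)"
    and add: "\<And>f g. f \<in> homs x y \<Longrightarrow> g \<in> homs x y \<Longrightarrow> P f \<Longrightarrow> P g \<Longrightarrow> P (f + g)"
  shows "P f"
proof -
  have "P (\<Sum>A\<in>S. Poly_Mapping.single A (h A)) \<and> (\<Sum>A\<in>S. Poly_Mapping.single A (h A)) \<in> homs x y"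
    if "finite S" "S \<subseteq> iclasses x y" for S h
    using that
  proof (induction S rule: finite_induct)
    case empty
    then show ?case using assms(2) homs_zero by simp
  next
    case (insert A S)
    then obtain ls where ls: "A = iclass (x, ls, y)" "layered x ls y"
      by (auto simp: iclasses_def)
    have "P (smult (h A) (dia x ls y))" "smult (h A) (dia x ls y) \<in> homs x y"
      using ls by (auto intro: dia smult homs_smult dia_in_homs)
    moreover have "smult (h A) (dia x ls y) = Poly_Mapping.single A (h A)"
      by (simp add: dia_def ls)
    ultimately show ?case using insert by (auto intro: add homs_add)
  qed
  from this[of "Poly_Mapping.keys f" "Poly_Mapping.lookup f"] assms(1) show ?thesis
    by (simp add: homs_eq flip: poly_mapping_sum_singles)
qed

lemma bilinear_ext_in_homs:
  fixes f g :: "('v::plane_vertex, 'r::{comm_ring,comm_monoid_mult}) lincomb"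
  assumes "f \<in> homs x y" "g \<in> homs x' y'"
    and dia: "\<And>ls ls'. layered x ls y \<Longrightarrow> layered x' ls' y' \<Longrightarrow>
       bilinear_ext op (dia x ls y :: ('v, 'r) lincomb) (dia x' ls' y') \<in> homs x'' y''"
  shows "bilinear_ext op f g \<in> homs x'' y''"
  using assms(1)
proof (induction rule: homs_induct)
  case (dia ls)
  show ?case using assms(2)
    by (induction rule: homs_induct)
      (auto simp: bilinear_ext_add_right bilinear_ext_smult intro: homs_zero homs_add homs_smult assms(3)[OF dia])
qed (auto simp: bilinear_ext_add_left bilinear_ext_smult intro: homs_zero homs_add homs_smult)

lemma homs_comp: "g \<in> homs y z \<Longrightarrow> f \<in> homs x y \<Longrightarrow> g \<diamondop> f \<in> homs x z"
  by (erule (1) bilinear_ext_in_homs) (auto intro: dia_in_homs layered_appendI)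

lemma homs_tens: "f \<in> homs x y \<Longrightarrow> g \<in> homs x' y' \<Longrightarrow> f \<otimes> g \<in> homs (x @ x') (y @ y')"
  by (erule (1) bilinear_ext_in_homs)
    (auto intro!: dia_in_homs layered_appendI intro: layered_whisker_left layered_whisker_right)

lemma homs_id: "lin_id x \<in> homs x x"
  by (simp add: dia_in_homs)

lemmas bilinear_ext_simps = bilinear_ext_add_left bilinear_ext_add_right bilinear_ext_smult
  bilinear_ext_minus bilinear_ext_diff

lemma comp_id_left: "f \<in> homs x y \<Longrightarrow> lin_id y \<diamondop> f = f"
  by (induction rule: homs_induct) (auto simp: bilinear_ext_simps)

lemma comp_id_right: "f \<in> homs x y \<Longrightarrow> f \<diamondop> lin_id x = f"
  by (induction rule: homs_induct) (auto simp: bilinear_ext_simps)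

lemma tens_unit_left: "f \<in> homs x y \<Longrightarrow> lin_id [] \<otimes> f = f"
  by (induction rule: homs_induct) (auto simp: bilinear_ext_simps)

lemma tens_unit_right: "f \<in> homs x y \<Longrightarrow> f \<otimes> lin_id [] = f"
  by (induction rule: homs_induct) (auto simp: bilinear_ext_simps)

lemma comp_assoc:
  assumes "h \<in> homs y z" "g \<in> homs x y" "f \<in> homs w x"
  shows "(h \<diamondop> g) \<diamondop> f = h \<diamondop> g \<diamondop> f"
  using assms(1)
proof (induction rule: homs_induct)
  case (dia l1)
  from assms(2) show ?case
  proof (induction rule: homs_induct)
    case (dia l2)
    from assms(3) show ?case
      by (induction rule: homs_induct)
        (use dia \<open>layered y l1 z\<close> in \<open>auto simp: bilinear_ext_simps layered_appendI\<close>)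
  qed (auto simp: bilinear_ext_simps)
qed (auto simp: bilinear_ext_simps)

lemma tens_assoc:
  assumes "f \<in> homs x x'" "g \<in> homs y y'" "h \<in> homs z z'"
  shows "(f \<otimes> g) \<otimes> h = f \<otimes> g \<otimes> h"
  using assms(1)
proof (induction rule: homs_induct)
  case (dia l1)
  from assms(2) show ?case
  proof (induction rule: homs_induct)
    case (dia l2)
    from assms(3) show ?case
    proof (induction rule: homs_induct)
      case (dia l3)
      have "layered (x @ y) (whisker [] y l1 @ whisker x' [] l2) (x' @ y')"
        "layered (y @ z) (whisker [] z l2 @ whisker y' [] l3) (y' @ z')"
        using dia \<open>layered x l1 x'\<close> \<open>layered y l2 y'\<close>
        by (auto intro!: layered_appendI layered_whisker_left layered_whisker_right)
      with dia \<open>layered x l1 x'\<close> \<open>layered y l2 y'\<close> show ?case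
        by (simp add: bilinear_ext_simps)
    qed (auto simp: bilinear_ext_simps)
  qed (auto simp: bilinear_ext_simps)
qed (auto simp: bilinear_ext_simps)

text \<open>The two stackings differ only in the order of \<open>l1'\<close> and \<open>l2\<close>,
  which lie side by side.\<close>

lemma interchange_dia:
  assumes "layered x l1 y" "layered y l2 z" "layered x' l1' y'" "layered y' l2' z'"
  shows "(dia y l2 z \<otimes> dia y' l2' z') \<diamondop> (dia x l1 y \<otimes> dia x' l1' y')
     = (dia y l2 z \<diamondop> dia x l1 y) \<otimes> (dia y' l2' z' \<diamondop> dia x' l1' y')"
proof -
  have "isotopic (x @ x') (whisker [] x' l1 @ (whisker y [] l1' @ whisker [] y' l2) @ whisker z [] l2')
     (whisker [] x' l1 @ (whisker [] x' l2 @ whisker z [] l1') @ whisker z [] l2') (z @ z')"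
    by (rule isotopic_context[OF isotopic_sym[OF isotopic_interchange]])
      (use assms layered_whisker_left layered_whisker_right in auto)
  moreover have "layered (x @ x') (whisker [] x' l1 @ whisker y [] l1') (y @ y')"
    "layered (y @ y') (whisker [] y' l2 @ whisker z [] l2') (z @ z')"
    using assms by (auto intro!: layered_appendI layered_whisker_left layered_whisker_right)
  ultimately show ?thesis
    using assms layered_appendI[OF assms(1,2)] layered_appendI[OF assms(3,4)] by (simp add: dia_eqI)
qed

lemma interchange:
  assumes "g \<in> homs y z" "g' \<in> homs y' z'" "f \<in> homs x y" "f' \<in> homs x' y'"
  shows "(g \<otimes> g') \<diamondop> (f \<otimes> f') = (g \<diamondop> f) \<otimes> (g' \<diamondop> f')"
  using assms(1)
proof (induction rule: homs_induct)
  case (dia l1)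
  note l1 = dia
  from assms(2) show ?case
  proof (induction rule: homs_induct)
    case (dia l2)
    note l2 = dia
    from assms(3) show ?case
    proof (induction rule: homs_induct)
      case (dia l3)
      note l3 = dia
      from assms(4) show ?case
      proof (induction rule: homs_induct)
        case (dia l4)
        show ?case by (rule interchange_dia[OF l3 l1 dia l2])
      qed (simp_all add: bilinear_ext_simps smult_distribs)
    qed (simp_all add: bilinear_ext_simps smult_distribs)
  qed (simp_all add: bilinear_ext_simps smult_distribs)
qed (simp_all add: bilinear_ext_simps smult_distribs)

section \<open>Quotients of linear categories\<close>

text \<open>Only the axioms that are needed to form quotients by tensor ideals are listed.\<close>

locale linear_tensor_cat =
  fixes C :: "('o, 'm, 'r::{comm_ring,comm_monoid_mult}, 'e) rigid_cat_scheme"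
  assumes zer_hom: "zer C x y \<in> hom C x y"
    and add_hom: "f \<in> hom C x y \<Longrightarrow> g \<in> hom C x y \<Longrightarrow> add C x y f g \<in> hom C x y"
    and scal_hom: "f \<in> hom C x y \<Longrightarrow> scal C x y r f \<in> hom C x y"
    and ident_hom: "ident C x \<in> hom C x x"
    and cmp_hom: "g \<in> hom C y z \<Longrightarrow> f \<in> hom C x y \<Longrightarrow> cmp C x y z g f \<in> hom C x z"
    and tens_hom: "f \<in> hom C x x' \<Longrightarrow> g \<in> hom C y y' \<Longrightarrow>
      tens C x x' y y' f g \<in> hom C (tens_ob C x y) (tens_ob C x' y')"
    and ev_r_hom: "ev_r C x \<in> hom C (tens_ob C x (dual C x)) (unit_ob C)"
    and ev_l_hom: "ev_l C x \<in> hom C (tens_ob C (dual C x) x) (unit_ob C)"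
    and coev_r_hom: "coev_r C x \<in> hom C (unit_ob C) (tens_ob C x (dual C x))"
    and coev_l_hom: "coev_l C x \<in> hom C (unit_ob C) (tens_ob C (dual C x) x)"
    and add_assoc: "f \<in> hom C x y \<Longrightarrow> g \<in> hom C x y \<Longrightarrow> h \<in> hom C x y \<Longrightarrow>
      add C x y (add C x y f g) h = add C x y f (add C x y g h)"
    and add_commute: "f \<in> hom C x y \<Longrightarrow> g \<in> hom C x y \<Longrightarrow> add C x y f g = add C x y g f"
    and add_zer: "f \<in> hom C x y \<Longrightarrow> add C x y f (zer C x y) = f"
    and scal_add: "f \<in> hom C x y \<Longrightarrow> g \<in> hom C x y \<Longrightarrow>
      scal C x y r (add C x y f g) = add C x y (scal C x y r f) (scal C x y r g)"
    and scal_plus: "f \<in> hom C x y \<Longrightarrow> scal C x y (r + s) f = add C x y (scal C x y r f) (scal C x y s f)"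
    and scal_scal: "f \<in> hom C x y \<Longrightarrow> scal C x y r (scal C x y s f) = scal C x y (r * s) f"
    and scal_one: "f \<in> hom C x y \<Longrightarrow> scal C x y 1 f = f"
    and scal_0: "f \<in> hom C x y \<Longrightarrow> scal C x y 0 f = zer C x y"
    and cmp_ident_left: "f \<in> hom C x y \<Longrightarrow> cmp C x y y (ident C y) f = f"
    and cmp_ident_right: "f \<in> hom C x y \<Longrightarrow> cmp C x x y f (ident C x) = f"
    and cmp_assoc: "h \<in> hom C y z \<Longrightarrow> g \<in> hom C x y \<Longrightarrow> f \<in> hom C w x \<Longrightarrow>
      cmp C w x z (cmp C x y z h g) f = cmp C w y z h (cmp C w x y g f)"
    and cmp_add_left: "g \<in> hom C y z \<Longrightarrow> g' \<in> hom C y z \<Longrightarrow> f \<in> hom C x y \<Longrightarrow>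
      cmp C x y z (add C y z g g') f = add C x z (cmp C x y z g f) (cmp C x y z g' f)"
    and cmp_add_right: "g \<in> hom C y z \<Longrightarrow> f \<in> hom C x y \<Longrightarrow> f' \<in> hom C x y \<Longrightarrow>
      cmp C x y z g (add C x y f f') = add C x z (cmp C x y z g f) (cmp C x y z g f')"
    and cmp_scal_left: "g \<in> hom C y z \<Longrightarrow> f \<in> hom C x y \<Longrightarrow>
      cmp C x y z (scal C y z r g) f = scal C x z r (cmp C x y z g f)"
    and cmp_scal_right: "g \<in> hom C y z \<Longrightarrow> f \<in> hom C x y \<Longrightarrow>
      cmp C x y z g (scal C x y r f) = scal C x z r (cmp C x y z g f)"
    and tens_add_left: "f \<in> hom C x x' \<Longrightarrow> f' \<in> hom C x x' \<Longrightarrow> g \<in> hom C y y' \<Longrightarrow>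
      tens C x x' y y' (add C x x' f f') g =
      add C (tens_ob C x y) (tens_ob C x' y') (tens C x x' y y' f g) (tens C x x' y y' f' g)"
    and tens_add_right: "f \<in> hom C x x' \<Longrightarrow> g \<in> hom C y y' \<Longrightarrow> g' \<in> hom C y y' \<Longrightarrow>
      tens C x x' y y' f (add C y y' g g') =
      add C (tens_ob C x y) (tens_ob C x' y') (tens C x x' y y' f g) (tens C x x' y y' f g')"
    and tens_scal_left: "f \<in> hom C x x' \<Longrightarrow> g \<in> hom C y y' \<Longrightarrow>
      tens C x x' y y' (scal C x x' r f) g =
      scal C (tens_ob C x y) (tens_ob C x' y') r (tens C x x' y y' f g)"
    and tens_scal_right: "f \<in> hom C x x' \<Longrightarrow> g \<in> hom C y y' \<Longrightarrow>
      tens C x x' y y' f (scal C y y' r g) =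
      scal C (tens_ob C x y) (tens_ob C x' y') r (tens C x x' y y' f g)"
begin

lemmas hom_intros = zer_hom add_hom scal_hom ident_hom cmp_hom tens_hom
  ev_r_hom ev_l_hom coev_r_hom coev_l_hom

abbreviation diff :: "'o \<Rightarrow> 'o \<Rightarrow> 'm \<Rightarrow> 'm \<Rightarrow> 'm" where
  "diff x y f g \<equiv> add C x y f (scal C x y (- 1) g)"

text \<open>Additive inverses are not listed among the axioms: the multiple by \<open>- 1\<close>
  takes their place, because \<open>1 + (- 1) = 0\<close> and the zero multiple is
  \<open>zer\<close>.\<close>

lemma diff_self: "f \<in> hom C x y \<Longrightarrow> diff x y f f = zer C x y"
  using scal_plus[of f x y 1 "- 1"] by (simp add: scal_one scal_0)

lemma zer_add: "f \<in> hom C x y \<Longrightarrow> add C x y (zer C x y) f = f"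
  using add_commute add_zer zer_hom by metis

lemma add_left_commute: "f \<in> hom C x y \<Longrightarrow> g \<in> hom C x y \<Longrightarrow> h \<in> hom C x y \<Longrightarrow>
    add C x y f (add C x y g h) = add C x y g (add C x y f h)"
  using add_commute[of f x y g] by (simp flip: add_assoc)

lemma diff_triangle:
  assumes "f \<in> hom C x y" "g \<in> hom C x y" "h \<in> hom C x y"
  shows "add C x y (diff x y f g) (diff x y g h) = diff x y f h"
proof -
  have "add C x y (scal C x y (- 1) g) (add C x y g (scal C x y (- 1) h)) = scal C x y (- 1) h"
    using assms
    by (simp add: hom_intros zer_add diff_self add_commute[of "scal C x y (- 1) g" x y g] flip: add_assoc)
  then show ?thesis
    using assms by (simp add: add_assoc hom_intros)
qed

lemma diff_zer_imp_eq:
  assumes "f \<in> hom C x y" "g \<in> hom C x y" "diff x y f g = zer C x y"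
  shows "f = g"
  using diff_triangle[of f x y g "zer C x y"] assms
  by (metis add_zer diff_self hom_intros(1) scal_0 scal_scal zer_add scal_hom mult_zero_right)

lemma neg_diff:
  assumes "f \<in> hom C x y" "g \<in> hom C x y"
  shows "scal C x y (- 1) (diff x y f g) = diff x y g f"
  using assms by (simp add: scal_add scal_scal scal_one scal_hom add_commute)

lemma scal_zer: "scal C x y r (zer C x y) = zer C x y"
  using scal_scal[OF zer_hom, of x y r 0] by (simp add: scal_0 zer_hom)

lemma cmp_zer_left: "f \<in> hom C x y \<Longrightarrow> cmp C x y z (zer C y z) f = zer C x z"
  using cmp_scal_left[OF zer_hom, of f x y z 0] by (simp add: scal_0 zer_hom cmp_hom)

lemma cmp_zer_right: "g \<in> hom C y z \<Longrightarrow> cmp C x y z g (zer C x y) = zer C x z"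
  using cmp_scal_right[OF _ zer_hom, of g y z x 0] by (simp add: scal_0 zer_hom cmp_hom)

lemma tens_zer_left:
  "g \<in> hom C y y' \<Longrightarrow> tens C x x' y y' (zer C x x') g = zer C (tens_ob C x y) (tens_ob C x' y')"
  using tens_scal_left[OF zer_hom, of g y y' x x' 0] by (simp add: scal_0 zer_hom tens_hom)

lemma tens_zer_right:
  "f \<in> hom C x x' \<Longrightarrow> tens C x x' y y' f (zer C y y') = zer C (tens_ob C x y) (tens_ob C x' y')"
  using tens_scal_right[OF _ zer_hom, of f x x' y y' 0] by (simp add: scal_0 zer_hom tens_hom)

text \<open>Serves to compare two functors on a negative crossing: one functor supplies the left
  inverse and the other the right inverse of the same braiding.\<close>

lemma inverse_unique:
  assumes "f \<in> hom C x y" "g \<in> hom C y x" "h \<in> hom C y x"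
    and "cmp C x y x g f = ident C x" "cmp C y x y f h = ident C y"
  shows "g = h"
  using cmp_assoc[of g y x f x h y] assms by (simp add: cmp_ident_left cmp_ident_right)

end

section \<open>Congruence modulo a tensor ideal\<close>

locale quotient_of_linear = linear_tensor_cat C
  for C :: "('o, 'm, 'r::{comm_ring,comm_monoid_mult}, 'e) rigid_cat_scheme" +
  fixes G :: "'o \<Rightarrow> 'o \<Rightarrow> 'm \<Rightarrow> bool"
begin

abbreviation cong_mod :: "'o \<Rightarrow> 'o \<Rightarrow> 'm \<Rightarrow> 'm \<Rightarrow> bool" where
  "cong_mod x y f g \<equiv> (f, g) \<in> congruent_mod C G x y"

lemma cong_mod_iff: "cong_mod x y f g \<longleftrightarrow>
    f \<in> hom C x y \<and> g \<in> hom C x y \<and> tensor_ideal C G x y (diff x y f g)"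
  by (simp add: congruent_mod_def)

lemma cong_mod_refl: "f \<in> hom C x y \<Longrightarrow> cong_mod x y f f"
  by (simp add: cong_mod_iff diff_self tensor_ideal.zer)

lemma cong_mod_sym: "cong_mod x y f g \<Longrightarrow> cong_mod x y g f"
  unfolding cong_mod_iff using neg_diff tensor_ideal.scal[of C G x y "diff x y f g" "- 1"] by auto

lemma cong_mod_trans: "cong_mod x y f g \<Longrightarrow> cong_mod x y g h \<Longrightarrow> cong_mod x y f h"
  unfolding cong_mod_iff using diff_triangle tensor_ideal.add[of C G x y "diff x y f g" "diff x y g h"] by auto

lemma equiv_cong_mod: "equiv (hom C x y) (congruent_mod C G x y)"
  by (rule equivI)
    (auto intro!: refl_onI symI transI intro: cong_mod_refl cong_mod_sym cong_mod_trans simp: cong_mod_iff)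

lemma cong_mod_add:
  assumes "cong_mod x y f f'" "cong_mod x y g g'"
  shows "cong_mod x y (add C x y f g) (add C x y f' g')"
proof -
  note [simp] = hom_intros
  have *: "f \<in> hom C x y" "f' \<in> hom C x y" "g \<in> hom C x y" "g' \<in> hom C x y"
    using assms by (auto simp: cong_mod_iff)
  have "add C x y g (add C x y (scal C x y (- 1) f') (scal C x y (- 1) g')) =
      add C x y (scal C x y (- 1) f') (add C x y g (scal C x y (- 1) g'))"
    using * add_assoc add_commute[of g x y "scal C x y (- 1) f'"] by (simp flip: add_assoc)
  then have "diff x y (add C x y f g) (add C x y f' g') = add C x y (diff x y f f') (diff x y g g')"
    using * by (simp add: scal_add add_assoc)
  with assms * show ?thesis by (auto simp: cong_mod_iff intro: tensor_ideal.add)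
qed

lemma cong_mod_scal:
  assumes "cong_mod x y f f'"
  shows "cong_mod x y (scal C x y r f) (scal C x y r f')"
proof -
  have "diff x y (scal C x y r f) (scal C x y r f') = scal C x y r (diff x y f f')"
    using assms by (simp add: scal_add scal_scal hom_intros cong_mod_iff)
  with assms show ?thesis by (auto simp: cong_mod_iff hom_intros intro: tensor_ideal.scal)
qed

text \<open>One factor is replaced at a time. Each of the two differences is then a composite of a
  member of the ideal with an arbitrary morphism.\<close>

lemma cong_mod_cmp:
  assumes "cong_mod y z g g'" "cong_mod x y f f'"
  shows "cong_mod x z (cmp C x y z g f) (cmp C x y z g' f')"
proof (rule cong_mod_trans)
  note * = assms[unfolded cong_mod_iff]
  have "diff x z (cmp C x y z g f) (cmp C x y z g' f) = cmp C x y z (diff y z g g') f"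
    using * by (simp add: cmp_add_left cmp_scal_left hom_intros)
  then show "cong_mod x z (cmp C x y z g f) (cmp C x y z g' f)"
    using * by (auto simp: cong_mod_iff hom_intros intro: tensor_ideal.cmp_right)
  have "diff x z (cmp C x y z g' f) (cmp C x y z g' f') = cmp C x y z g' (diff x y f f')"
    using * by (simp add: cmp_add_right cmp_scal_right hom_intros)
  then show "cong_mod x z (cmp C x y z g' f) (cmp C x y z g' f')"
    using * by (auto simp: cong_mod_iff hom_intros intro: tensor_ideal.cmp_left)
qed

lemma cong_mod_tens:
  assumes "cong_mod x x' f f'" "cong_mod y y' g g'"
  shows "cong_mod (tens_ob C x y) (tens_ob C x' y') (tens C x x' y y' f g) (tens C x x' y y' f' g')"
proof (rule cong_mod_trans)
  note * = assms[unfolded cong_mod_iff]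
  have "diff (tens_ob C x y) (tens_ob C x' y') (tens C x x' y y' f g) (tens C x x' y y' f' g)
     = tens C x x' y y' (diff x x' f f') g"
    using * by (simp add: tens_add_left tens_scal_left hom_intros)
  then show "cong_mod (tens_ob C x y) (tens_ob C x' y') (tens C x x' y y' f g) (tens C x x' y y' f' g)"
    using * by (auto simp: cong_mod_iff hom_intros intro: tensor_ideal.tens_right)
  have "diff (tens_ob C x y) (tens_ob C x' y') (tens C x x' y y' f' g) (tens C x x' y y' f' g')
     = tens C x x' y y' f' (diff y y' g g')"
    using * by (simp add: tens_add_right tens_scal_right hom_intros)
  then show "cong_mod (tens_ob C x y) (tens_ob C x' y') (tens C x x' y y' f' g) (tens C x x' y y' f' g')"
    using * by (auto simp: cong_mod_iff hom_intros intro: tensor_ideal.tens_left)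
qed

lemma coset_eq_iff:
  "f \<in> hom C x y \<Longrightarrow> g \<in> hom C x y \<Longrightarrow> coset C G x y f = coset C G x y g \<longleftrightarrow> cong_mod x y f g"
  unfolding coset_def by (rule eq_equiv_class_iff[OF equiv_cong_mod])

lemma coset_self: "f \<in> hom C x y \<Longrightarrow> f \<in> coset C G x y f"
  by (simp add: coset_def cong_mod_refl)

lemma mem_cosetD: "g \<in> coset C G x y f \<Longrightarrow> cong_mod x y f g"
  by (simp add: coset_def)

lemma coset_UN:
  assumes "f \<in> hom C x y" "\<And>f'. cong_mod x y f f' \<Longrightarrow> h f' = h f"
  shows "(\<Union>f'\<in>coset C G x y f. h f') = h f"
  using coset_self[OF assms(1)] assms(2)[OF mem_cosetD] by blast

text \<open>The operations of \<open>quotient_cat\<close> are unions over all representatives;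
  congruent results have equal cosets, so the union is a single coset.\<close>

lemma coset_UN2:
  assumes "f \<in> hom C x y" "g \<in> hom C x' y'" "h f g \<in> hom C x'' y''"
    and "\<And>f' g'. cong_mod x y f f' \<Longrightarrow> cong_mod x' y' g g' \<Longrightarrow> cong_mod x'' y'' (h f g) (h f' g')"
  shows "(\<Union>f'\<in>coset C G x y f. \<Union>g'\<in>coset C G x' y' g. coset C G x'' y'' (h f' g')) = coset C G x'' y'' (h f g)"
proof -
  have "coset C G x'' y'' (h f' g') = coset C G x'' y'' (h f g)"
    if "cong_mod x y f f'" "cong_mod x' y' g g'" for f' g'
    using cong_mod_sym[OF assms(4)[OF that]] coset_eq_iff[of "h f' g'" x'' y'' "h f g"]
    by (simp add: cong_mod_iff)
  then show ?thesis
    using coset_self[OF assms(1)] coset_self[OF assms(2)] mem_cosetD by blast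
qed

lemma quotient_hom: "hom (quotient_cat C G br) x y = coset C G x y ` hom C x y"
  by (auto simp: quotient_cat_def quotient_def coset_def)

lemma coset_in_hom: "f \<in> hom C x y \<Longrightarrow> coset C G x y f \<in> hom (quotient_cat C G br) x y"
  by (simp add: quotient_hom)

lemma quotient_ops [simp]:
  "unit_ob (quotient_cat C G br) = unit_ob C" "tens_ob (quotient_cat C G br) = tens_ob C"
  "dual (quotient_cat C G br) = dual C" "ident (quotient_cat C G br) x = coset C G x x (ident C x)"
  "zer (quotient_cat C G br) x y = coset C G x y (zer C x y)"
  "ev_r (quotient_cat C G br) x = coset C G (tens_ob C x (dual C x)) (unit_ob C) (ev_r C x)"
  "ev_l (quotient_cat C G br) x = coset C G (tens_ob C (dual C x) x) (unit_ob C) (ev_l C x)"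
  "coev_r (quotient_cat C G br) x = coset C G (unit_ob C) (tens_ob C x (dual C x)) (coev_r C x)"
  "coev_l (quotient_cat C G br) x = coset C G (unit_ob C) (tens_ob C (dual C x) x) (coev_l C x)"
  "braiding (quotient_cat C G br) x y = coset C G (tens_ob C x y) (tens_ob C y x) (br x y)"
  by (simp_all add: quotient_cat_def)

lemma quotient_cmp [simp]:
  "g \<in> hom C y z \<Longrightarrow> f \<in> hom C x y \<Longrightarrow>
   cmp (quotient_cat C G br) x y z (coset C G y z g) (coset C G x y f) = coset C G x z (cmp C x y z g f)"
  by (simp add: quotient_cat_def) (rule coset_UN2, auto intro: cmp_hom cong_mod_cmp)

lemma quotient_add [simp]:
  "f \<in> hom C x y \<Longrightarrow> g \<in> hom C x y \<Longrightarrow>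
   add (quotient_cat C G br) x y (coset C G x y f) (coset C G x y g) = coset C G x y (add C x y f g)"
  by (simp add: quotient_cat_def) (rule coset_UN2, auto intro: add_hom cong_mod_add)

lemma quotient_tens [simp]:
  "f \<in> hom C x x' \<Longrightarrow> g \<in> hom C y y' \<Longrightarrow>
   tens (quotient_cat C G br) x x' y y' (coset C G x x' f) (coset C G y y' g) =
   coset C G (tens_ob C x y) (tens_ob C x' y') (tens C x x' y y' f g)"
  by (simp add: quotient_cat_def) (rule coset_UN2, auto intro: tens_hom cong_mod_tens)

lemma quotient_scal [simp]:
  "f \<in> hom C x y \<Longrightarrow> scal (quotient_cat C G br) x y r (coset C G x y f) = coset C G x y (scal C x y r f)"
  by (simp add: quotient_cat_def)
    (rule coset_UN, simp_all add: coset_eq_iff cong_mod_scal cong_mod_sym scal_hom cong_mod_iff[THEN iffD1])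

lemma linear_tensor_cat_quotient: "linear_tensor_cat (quotient_cat C G br)"
  by unfold_locales
    (auto simp: quotient_hom hom_intros add_commute add_left_commute add_assoc add_zer scal_add scal_plus scal_scal scal_one scal_0
      cmp_ident_left cmp_ident_right cmp_assoc cmp_add_left cmp_add_right cmp_scal_left cmp_scal_right
      tens_add_left tens_add_right tens_scal_left tens_scal_right)

end

text \<open>Diagram categories carry no braiding before they are divided by relations, so functors
  out of them are treated without the condition on braidings.\<close>

definition rigid_functor ::
  "('o, 'm, 'r, 'e) rigid_cat_scheme \<Rightarrow> ('p, 'n, 'r, 'd) rigid_cat_scheme
    \<Rightarrow> ('o, 'm, 'p, 'n) cat_map \<Rightarrow> bool" where
  "rigid_functor C D F \<longleftrightarrow>
    linear_functor C D F \<and>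
    ob_map F (unit_ob C) = unit_ob D \<and>
    (\<forall>x y. ob_map F (tens_ob C x y) = tens_ob D (ob_map F x) (ob_map F y)) \<and>
    (\<forall>x x' y y'. \<forall>f\<in>hom C x x'. \<forall>g\<in>hom C y y'.
       mor_map F (tens_ob C x y) (tens_ob C x' y') (tens C x x' y y' f g) =
       tens D (ob_map F x) (ob_map F x') (ob_map F y) (ob_map F y')
         (mor_map F x x' f) (mor_map F y y' g)) \<and>
    (\<forall>x. ob_map F (dual C x) = dual D (ob_map F x)) \<and>
    (\<forall>x. mor_map F (tens_ob C x (dual C x)) (unit_ob C) (ev_r C x) = ev_r D (ob_map F x)) \<and>
    (\<forall>x. mor_map F (tens_ob C (dual C x) x) (unit_ob C) (ev_l C x) = ev_l D (ob_map F x)) \<and>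
    (\<forall>x. mor_map F (unit_ob C) (tens_ob C x (dual C x)) (coev_r C x) = coev_r D (ob_map F x)) \<and>
    (\<forall>x. mor_map F (unit_ob C) (tens_ob C (dual C x) x) (coev_l C x) = coev_l D (ob_map F x))"

lemma rigid_braided_functor_iff:
  "rigid_braided_functor C D F \<longleftrightarrow> rigid_functor C D F \<and>
    (\<forall>x y. mor_map F (tens_ob C x y) (tens_ob C y x) (braiding C x y) =
       braiding D (ob_map F x) (ob_map F y))"
  unfolding rigid_braided_functor_def rigid_functor_def by (simp only: conj_assoc)

context
  fixes C :: "('o, 'm, 'r, 'e) rigid_cat_scheme" and D :: "('p, 'n, 'r, 'd) rigid_cat_scheme" and F
  assumes F: "rigid_functor C D F"
begin

lemma rigid_functor_simps:
  "ob_map F (unit_ob C) = unit_ob D"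
  "ob_map F (tens_ob C x y) = tens_ob D (ob_map F x) (ob_map F y)"
  "ob_map F (dual C x) = dual D (ob_map F x)"
  "mor_map F x x (ident C x) = ident D (ob_map F x)"
  "f \<in> hom C x y \<Longrightarrow> g \<in> hom C y z \<Longrightarrow> mor_map F x z (cmp C x y z g f) =
     cmp D (ob_map F x) (ob_map F y) (ob_map F z) (mor_map F y z g) (mor_map F x y f)"
  "f \<in> hom C x y \<Longrightarrow> f' \<in> hom C x y \<Longrightarrow> mor_map F x y (add C x y f f') =
     add D (ob_map F x) (ob_map F y) (mor_map F x y f) (mor_map F x y f')"
  "f \<in> hom C x y \<Longrightarrow> mor_map F x y (scal C x y r f) =
     scal D (ob_map F x) (ob_map F y) r (mor_map F x y f)"
  "f \<in> hom C x x' \<Longrightarrow> h \<in> hom C y y' \<Longrightarrow>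
     mor_map F (tens_ob C x y) (tens_ob C x' y') (tens C x x' y y' f h) =
     tens D (ob_map F x) (ob_map F x') (ob_map F y) (ob_map F y') (mor_map F x x' f) (mor_map F y y' h)"
  "mor_map F (tens_ob C x (dual C x)) (unit_ob C) (ev_r C x) = ev_r D (ob_map F x)"
  "mor_map F (tens_ob C (dual C x) x) (unit_ob C) (ev_l C x) = ev_l D (ob_map F x)"
  "mor_map F (unit_ob C) (tens_ob C x (dual C x)) (coev_r C x) = coev_r D (ob_map F x)"
  "mor_map F (unit_ob C) (tens_ob C (dual C x) x) (coev_l C x) = coev_l D (ob_map F x)"
  using F unfolding rigid_functor_def linear_functor_def by simp_all

lemma rigid_functor_hom: "f \<in> hom C x y \<Longrightarrow> mor_map F x y f \<in> hom D (ob_map F x) (ob_map F y)"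
  using F unfolding rigid_functor_def linear_functor_def by (meson PiE_mem)

lemma rigid_functor_undefined: "f \<notin> hom C x y \<Longrightarrow> mor_map F x y f = undefined"
  using F unfolding rigid_functor_def linear_functor_def by (meson PiE_arb)

end

text \<open>The representative is arbitrary; independence of the choice is available only for
  functors that kill the generators \<open>G\<close>.\<close>

definition quotient_lift ::
  "('o, 'm, 'r::{comm_ring,comm_monoid_mult}, 'e) rigid_cat_scheme \<Rightarrow> ('o \<Rightarrow> 'o \<Rightarrow> 'm \<Rightarrow> bool)
    \<Rightarrow> ('o, 'm, 'p, 'n) cat_map \<Rightarrow> ('o, 'm set, 'p, 'n) cat_map" where
  "quotient_lift C G F = \<lparr>
    ob_map = ob_map F,
    mor_map = (\<lambda>x y. \<lambda>A\<in>coset C G x y ` hom C x y. mor_map F x y (SOME f. f \<in> A)) \<rparr>"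

context quotient_of_linear
begin

lemma rigid_functor_quotient_functor: "rigid_functor C (quotient_cat C G br) (quotient_functor C G)"
  by (auto simp: rigid_functor_def linear_functor_def quotient_functor_def quotient_hom hom_intros)

context
  fixes D :: "('p, 'n, 'r, 'd) rigid_cat_scheme" and F
  assumes D: "linear_tensor_cat D" and F: "rigid_functor C D F"
    and killed: "\<And>x y f. G x y f \<Longrightarrow> f \<in> hom C x y \<and> mor_map F x y f = zer D (ob_map F x) (ob_map F y)"
begin

interpretation D: linear_tensor_cat D by (rule D)

text \<open>The morphisms sent to zero by a rigid linear functor are closed under all rules that
  generate a tensor ideal.\<close>

lemma functor_kills_ideal:
  "tensor_ideal C G x y f \<Longrightarrow> f \<in> hom C x y \<and> mor_map F x y f = zer D (ob_map F x) (ob_map F y)"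
proof (induction rule: tensor_ideal.induct)
  case (zer x y)
  \<comment> \<open>Preservation of zero is derived from preservation of scalar multiples, by
    writing zero as the zero multiple of itself.\<close>
  have "mor_map F x y (scal C x y 0 (zer C x y)) = zer D (ob_map F x) (ob_map F y)"
    using rigid_functor_hom[OF F zer_hom, of x y]
    by (simp add: rigid_functor_simps[OF F] zer_hom D.scal_0)
  then show ?case by (simp add: scal_0 zer_hom)
qed (auto simp: killed hom_intros rigid_functor_simps[OF F] D.add_zer D.zer_hom D.scal_zer
    D.cmp_zer_left D.cmp_zer_right D.tens_zer_left D.tens_zer_right rigid_functor_hom[OF F])

lemma functor_cong_mod:
  assumes "cong_mod x y f g"
  shows "mor_map F x y f = mor_map F x y g"
proof (rule D.diff_zer_imp_eq)
  have *: "f \<in> hom C x y" "g \<in> hom C x y" "tensor_ideal C G x y (diff x y f g)"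
    using assms by (simp_all add: cong_mod_iff)
  then show "mor_map F x y f \<in> hom D (ob_map F x) (ob_map F y)"
    "mor_map F x y g \<in> hom D (ob_map F x) (ob_map F y)"
    by (simp_all add: rigid_functor_hom[OF F])
  show "add D (ob_map F x) (ob_map F y) (mor_map F x y f)
     (scal D (ob_map F x) (ob_map F y) (- 1) (mor_map F x y g)) = zer D (ob_map F x) (ob_map F y)"
    using functor_kills_ideal[OF *(3)] * by (simp add: rigid_functor_simps[OF F] scal_hom)
qed

lemma quotient_lift_coset:
  assumes "f \<in> hom C x y"
  shows "mor_map (quotient_lift C G F) x y (coset C G x y f) = mor_map F x y f"
proof -
  have "(SOME g. g \<in> coset C G x y f) \<in> coset C G x y f"
    using coset_self[OF assms] by (rule someI)
  from functor_cong_mod[OF mem_cosetD[OF this]] assms show ?thesis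
    by (simp add: quotient_lift_def)
qed

lemma rigid_functor_quotient_lift: "rigid_functor (quotient_cat C G br) D (quotient_lift C G F)"
proof -
  have [simp]: "ob_map (quotient_lift C G F) = ob_map F" by (simp add: quotient_lift_def)
  have "mor_map (quotient_lift C G F) x y \<in> coset C G x y ` hom C x y \<rightarrow>\<^sub>E hom D (ob_map F x) (ob_map F y)" for x y
    by (rule PiE_I)
      (auto simp: quotient_lift_coset rigid_functor_hom[OF F], auto simp: quotient_lift_def)
  then show ?thesis
    unfolding rigid_functor_def linear_functor_def
    by (auto simp: quotient_hom quotient_lift_coset hom_intros rigid_functor_simps[OF F])
qed

text \<open>Outside the hom-sets both sides are undefined by extensionality, so they agree as maps
  and not only on morphisms.\<close>

lemma functor_comp_quotient_lift: "functor_comp C (quotient_lift C G F) (quotient_functor C G) = F"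
proof (rule cat_map.equality)
  show "mor_map (functor_comp C (quotient_lift C G F) (quotient_functor C G)) = mor_map F"
    by (intro ext) (auto simp: functor_comp_def quotient_functor_def quotient_lift_coset restrict_def
        rigid_functor_undefined[OF F])
qed (simp_all add: functor_comp_def quotient_functor_def quotient_lift_def)

end

end

lemma rigid_functor_comp:
  assumes "linear_tensor_cat C" "rigid_functor C D F" "rigid_functor D E H"
  shows "rigid_functor C E (functor_comp C H F)"
proof -
  interpret linear_tensor_cat C by (rule assms)
  have "mor_map (functor_comp C H F) x y \<in> hom C x y \<rightarrow>\<^sub>E hom E (ob_map H (ob_map F x)) (ob_map H (ob_map F y))" for x y
    using rigid_functor_hom[OF assms(2)] rigid_functor_hom[OF assms(3)]
    by (auto simp: functor_comp_def)
  then show ?thesis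
    unfolding rigid_functor_def linear_functor_def
    by (auto simp: functor_comp_def hom_intros rigid_functor_simps[OF assms(2)] rigid_functor_simps[OF assms(3)]
       rigid_functor_hom[OF assms(2)] ident_hom)
qed

section \<open>The category of diagrams\<close>

lemma diagram_cat_simps [simp]:
  "ident diagram_cat x = dia x [] x" "cmp diagram_cat x y z = bilinear_ext (iclass_op stack)"
  "zer diagram_cat x y = 0" "add diagram_cat x y = (+)" "scal diagram_cat x y = smult"
  "unit_ob diagram_cat = []" "tens_ob diagram_cat = (@)"
  "tens diagram_cat x x' y y' = bilinear_ext (iclass_op juxtapose)" "dual diagram_cat = dual_obj"
  "ev_r diagram_cat x = dia (x @ dual_obj x) (caps x) []"
  "ev_l diagram_cat x = dia (dual_obj x @ x) (caps (dual_obj x)) []"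
  "coev_r diagram_cat x = dia [] (cups x) (x @ dual_obj x)"
  "coev_l diagram_cat x = dia [] (cups (dual_obj x)) (dual_obj x @ x)"
  by (simp_all add: diagram_cat_def)

lemma linear_tensor_cat_diagram_cat:
  "linear_tensor_cat (diagram_cat :: (obj, ('v::plane_vertex, 'r::{comm_ring,comm_monoid_mult}) lincomb, 'r) rigid_cat)"
  by unfold_locales
    (auto simp: homs_zero homs_add homs_smult homs_comp homs_tens homs_id
      dia_in_homs layered_caps layered_cups
      layered_caps[of "dual_obj _", simplified] layered_cups[of "dual_obj _", simplified] smult_distribs bilinear_ext_simps comp_assoc
      comp_id_left comp_id_right add_ac)

section \<open>Functors between categories of diagrams\<close>

fun piece_interp :: "('v \<Rightarrow> ('w::plane_vertex, 'r::{comm_ring,comm_monoid_mult}) lincomb) \<Rightarrow>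
    'v::plane_vertex piece \<Rightarrow> ('w, 'r) lincomb" where
  "piece_interp val (Cap a) = dia [a, opp a] [([], Cap a, [])] []"
| "piece_interp val (Cup a) = dia [] [([], Cup a, [])] [a, opp a]"
| "piece_interp val (Vertex v) = val v"

text \<open>Each layer determines its own boundary, so the word that is passed along is used only
  for the identity of an empty diagram.\<close>

fun interp :: "('v \<Rightarrow> ('w::plane_vertex, 'r::{comm_ring,comm_monoid_mult}) lincomb) \<Rightarrow>
    obj \<Rightarrow> 'v::plane_vertex layer list \<Rightarrow> ('w, 'r) lincomb" where
  "interp val x [] = lin_id x"
| "interp val x ((u, p, w) # ls) =
     interp val (u @ pcod p @ w) ls \<diamondop> (lin_id u \<otimes> piece_interp val p \<otimes> lin_id w)"

lemma tens_whisker_assoc: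
  assumes "f \<in> homs x y"
  shows "lin_id (s @ u) \<otimes> f \<otimes> lin_id (w @ t) = lin_id s \<otimes> (lin_id u \<otimes> f \<otimes> lin_id w) \<otimes> lin_id t"
proof -
  have "lin_id (s @ u) \<otimes> f \<otimes> lin_id (w @ t) = (lin_id s \<otimes> lin_id u) \<otimes> f \<otimes> (lin_id w \<otimes> lin_id t)"
    by simp
  also have "\<dots> = lin_id s \<otimes> lin_id u \<otimes> (f \<otimes> lin_id w) \<otimes> lin_id t"
    by (subst tens_assoc[OF homs_id homs_id homs_tens[OF assms homs_tens[OF homs_id homs_id]]],
        subst tens_assoc[OF assms homs_id homs_id]) (rule refl)
  also have "\<dots> = lin_id s \<otimes> (lin_id u \<otimes> f \<otimes> lin_id w) \<otimes> lin_id t"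
    by (subst tens_assoc[OF homs_id homs_tens[OF assms homs_id] homs_id]) (rule refl)
  finally show ?thesis .
qed

lemma comp_whisker:
  assumes "g \<in> homs y z" "f \<in> homs x y"
  shows "(lin_id s \<otimes> g \<otimes> lin_id t) \<diamondop> (lin_id s \<otimes> f \<otimes> lin_id t) = lin_id s \<otimes> (g \<diamondop> f) \<otimes> lin_id t"
  using assms
  by (simp add: interchange[OF homs_id homs_tens[OF _ homs_id] homs_id homs_tens[OF _ homs_id]]
      interchange[OF _ homs_id _ homs_id])

text \<open>Both orders of stacking are compared with the plain juxtaposition, in which the relative
  height of \<open>P\<close> and \<open>Q\<close> no longer shows.\<close>

lemma exchange_comp:
  assumes P: "P \<in> homs a a'" and Q: "Q \<in> homs b b'"
  shows "(lin_id (u @ a' @ v) \<otimes> Q \<otimes> lin_id w) \<diamondop> (lin_id u \<otimes> P \<otimes> lin_id (v @ b @ w))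
      = lin_id u \<otimes> P \<otimes> lin_id v \<otimes> Q \<otimes> lin_id w" (is ?lower)
    and "(lin_id u \<otimes> P \<otimes> lin_id (v @ b' @ w)) \<diamondop> (lin_id (u @ a @ v) \<otimes> Q \<otimes> lin_id w)
      = lin_id u \<otimes> P \<otimes> lin_id v \<otimes> Q \<otimes> lin_id w" (is ?upper)
proof -
  let ?R = "lin_id v \<otimes> Q \<otimes> lin_id w"
  note Qw = homs_tens[OF Q homs_id[of w]]
  note R = homs_tens[OF homs_id[of v] Qw]
  have split: "lin_id (u @ x @ v) \<otimes> Q \<otimes> lin_id w = lin_id u \<otimes> lin_id x \<otimes> ?R" for x
  proof -
    have "lin_id (u @ x @ v) \<otimes> Q \<otimes> lin_id w = (lin_id u \<otimes> lin_id x \<otimes> lin_id v) \<otimes> Q \<otimes> lin_id w"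
      by simp
    also have "\<dots> = lin_id u \<otimes> lin_id x \<otimes> ?R"
      unfolding tens_assoc[OF homs_id homs_tens[OF homs_id homs_id] Qw] tens_assoc[OF homs_id homs_id Qw]
      by (rule refl)
    finally show ?thesis .
  qed
  have "(lin_id u \<otimes> lin_id a' \<otimes> ?R) \<diamondop> (lin_id u \<otimes> P \<otimes> lin_id (v @ b @ w)) =
      (lin_id u \<diamondop> lin_id u) \<otimes> (lin_id a' \<diamondop> P) \<otimes> (?R \<diamondop> lin_id (v @ b @ w))"
    unfolding interchange[OF homs_id homs_tens[OF homs_id R] homs_id homs_tens[OF P homs_id]]
      interchange[OF homs_id R P homs_id] by (rule refl)
  then show ?lower
    unfolding split comp_id_left[OF P] comp_id_right[OF R] comp_id_left[OF homs_id] .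
  have "(lin_id u \<otimes> P \<otimes> lin_id (v @ b' @ w)) \<diamondop> (lin_id u \<otimes> lin_id a \<otimes> ?R) =
      (lin_id u \<diamondop> lin_id u) \<otimes> (P \<diamondop> lin_id a) \<otimes> (lin_id (v @ b' @ w) \<diamondop> ?R)"
    unfolding interchange[OF homs_id homs_tens[OF P homs_id] homs_id homs_tens[OF homs_id R]]
      interchange[OF P homs_id homs_id R] by (rule refl)
  then show ?upper
    unfolding split comp_id_right[OF P] comp_id_left[OF R] comp_id_left[OF homs_id] .
qed

text \<open>Rotation is the only isotopy that depends on what the vertices are: exchanges hold by
  the interchange law, and straightenings hold because cups and caps are sent to themselves. So
  besides correct boundaries, invariance under the listed turns is all that isotopy invariance
  requires.\<close>

locale vertex_interp =
  fixes val :: "'v::plane_vertex \<Rightarrow> ('w::plane_vertex, 'r::{comm_ring,comm_monoid_mult}) lincomb"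
  assumes val_hom: "val v \<in> homs (vdom v) (vcod v)"
    and layered_turns: "ls \<in> turns v \<Longrightarrow> layered (vdom v) ls (vcod v)"
    and val_turns: "ls \<in> turns v \<Longrightarrow> interp val (vdom v) ls = val v"
begin

lemma piece_interp_hom: "piece_interp val p \<in> homs (pdom p) (pcod p)"
  by (cases p) (auto intro: dia_in_homs val_hom)

lemma layer_interp_hom:
  "lin_id u \<otimes> piece_interp val p \<otimes> lin_id w \<in> homs (u @ pdom p @ w) (u @ pcod p @ w)"
  by (intro homs_tens homs_id piece_interp_hom)

lemma interp_hom: "layered x ls y \<Longrightarrow> interp val x ls \<in> homs x y"
proof (induction ls arbitrary: x)
  case (Cons l ls)
  obtain u p w where l: "l = (u, p, w)" by (cases l)
  with Cons show ?case
    using homs_comp[OF Cons.IH layer_interp_hom, of u p w] by simp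
qed (simp add: homs_id)

lemma interp_append:
  "layered x ls y \<Longrightarrow> layered y ls' z \<Longrightarrow> interp val x (ls @ ls') = interp val y ls' \<diamondop> interp val x ls"
proof (induction ls arbitrary: x)
  case Nil
  then show ?case by (auto simp: comp_id_right[OF interp_hom])
next
  case (Cons l ls)
  obtain u p w where l: "l = (u, p, w)" by (cases l)
  then show ?case
    using Cons.prems
    by (simp add: Cons.IH[of "u @ pcod p @ w"] comp_assoc[OF interp_hom interp_hom layer_interp_hom])
qed

lemma interp_whisker:
  "layered x ls y \<Longrightarrow> interp val (s @ x @ t) (whisker s t ls) = lin_id s \<otimes> interp val x ls \<otimes> lin_id t"
proof (induction ls arbitrary: x)
  case Nil
  then show ?case by simp
next
  case (Cons l ls)
  obtain u p w where l: "l = (u, p, w)" by (cases l)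
  then have "layered (u @ pcod p @ w) ls y" "x = u @ pdom p @ w"
    using Cons.prems by auto
  then show ?case
    using Cons.IH[of "u @ pcod p @ w"] comp_whisker[OF interp_hom layer_interp_hom, of u p w ls y s t]
    by (simp add: l tens_whisker_assoc[OF piece_interp_hom])
qed

lemma interp_local_move:
  assumes "local_move m m'" "layered x m y" "layered x m' y'"
  shows "y = y' \<and> interp val x m = interp val x m'"
  using assms
proof cases
  case (exchange u p v q w)
  then show ?thesis
    using assms(2,3) exchange_comp[OF piece_interp_hom[of p] piece_interp_hom[of q]]
      layer_interp_hom[of "u @ pcod p @ v" q w] layer_interp_hom[of u p "v @ pcod q @ w"]
    by (auto simp: comp_id_left)
next
  case (straighten_right u a w)
  have "isotopic (u @ [a] @ w) [(u @ [a], Cup (opp a), w), (u, Cap a, a # w)] [] (u @ [a] @ w)"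
    by (rule isotopic_local_move[OF local_move.straighten_right]) auto
  then show ?thesis
    using straighten_right assms(2,3) by (auto dest: dia_eqI)
next
  case (straighten_left u a w)
  have "isotopic (u @ [a] @ w) [(u, Cup a, a # w), (u @ [a], Cap (opp a), w)] [] (u @ [a] @ w)"
    by (rule isotopic_local_move[OF local_move.straighten_left]) auto
  then show ?thesis
    using straighten_left assms(2,3) by (auto dest: dia_eqI)
next
  case (rotate ls v u w)
  then have x: "x = u @ vdom v @ w" "y = u @ vcod v @ w"
    using assms(2) by auto
  with rotate assms(3) layered_whisker[OF layered_turns, of ls v u w] have "y = y'"
    by (auto dest: layered_unique)
  moreover have "interp val x m' = lin_id u \<otimes> val v \<otimes> lin_id w"
    using interp_whisker[OF layered_turns, of ls v u w] rotate by (simp add: x val_turns)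
  moreover have "interp val x m = lin_id u \<otimes> val v \<otimes> lin_id w"
    using rotate layer_interp_hom[of u "Vertex v" w] by (simp add: comp_id_left)
  ultimately show ?thesis by simp
qed

lemma interp_isotopy_step:
  assumes "isotopy_step (x, l, y) (x, l', y)"
  shows "interp val x l = interp val x l'"
  using assms
proof cases
  case (1 m m' ls ls')
  obtain x1 y1 where 2: "layered x ls x1" "layered x1 m y1" "layered y1 ls' y"
    using 1 by (auto simp: layered_append)
  obtain x2 y2 where 3: "layered x ls x2" "layered x2 m' y2" "layered y2 ls' y"
    using 1 by (auto simp: layered_append)
  have [simp]: "x2 = x1" using 2 3 by (auto dest: layered_unique)
  have *: "y1 = y2" "interp val x1 m = interp val x1 m'"
    using interp_local_move[OF 1(3) 2(2)] 3(2) by auto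
  have "interp val x (ls @ n @ ls') = (interp val y1 ls' \<diamondop> interp val x1 n) \<diamondop> interp val x ls"
    if "layered x1 n y1" for n
    using interp_append[OF 2(1) layered_appendI[OF that 2(3)]] interp_append[OF that 2(3)] by simp
  from this[of m] this[of m'] 2 3 * 1 show ?thesis by simp
qed

lemma interp_isotopic:
  assumes "isotopic x ls ls' y"
  shows "interp val x ls = interp val x ls'"
proof -
  \<comment> \<open>The equivalence closure ranges over whole diagrams, so the bottom word is
    carried through the induction as an invariant.\<close>
  have "interp val x (fst (snd d)) = interp val x (fst (snd e)) \<and> fst e = fst d"
    if "equivclp isotopy_step d e" "fst d = x" for d e
    using that
  proof (induction rule: equivclp_induct)
    case (step d' e)
    have *: "interp val (fst d') (fst (snd d')) = interp val (fst d') (fst (snd e)) \<and> fst e = fst d'"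
      if "isotopy_step d' e" for d' e
      using that by (rule isotopy_step_boundary) (use interp_isotopy_step that in auto)
    from step have "isotopy_step d' e \<or> isotopy_step e d'" by (simp add: symclp_def)
    then show ?case
      using step.IH step.prems *[of d' e] *[of e d'] by auto
  qed auto
  from this[of "(x, ls, y)" "(x, ls', y)"] assms show ?thesis by (auto simp: isotopic_def)
qed

lemma interp_juxtapose:
  assumes "layered x ls y" "layered x' ls' y'"
  shows "interp val (x @ x') (whisker [] x' ls @ whisker y [] ls') = interp val x ls \<otimes> interp val x' ls'"
proof -
  have "interp val (x @ x') (whisker [] x' ls) = interp val x ls \<otimes> lin_id x'"
    using interp_whisker[OF assms(1), of "[]" x']
    by (simp add: tens_unit_left[OF homs_tens[OF interp_hom[OF assms(1)] homs_id]])
  moreover have "interp val (y @ x') (whisker y [] ls') = lin_id y \<otimes> interp val x' ls'"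
    using interp_whisker[OF assms(2), of y "[]"]
    by (simp add: tens_unit_right[OF interp_hom[OF assms(2)]])
  ultimately show ?thesis
    using assms
    by (simp add: interp_append[OF layered_whisker_right layered_whisker_left]
        interchange[OF homs_id interp_hom interp_hom homs_id]
        comp_id_left[OF interp_hom] comp_id_right[OF interp_hom])
qed

lemma interp_caps: "interp val (x @ dual_obj x) (caps x) = dia (x @ dual_obj x) (caps x) []"
proof (induction x)
  case (Cons a x)
  have "interp val (a # x @ dual_obj x @ [opp a]) (whisker [a] [opp a] (caps x))
     = dia (a # x @ dual_obj x @ [opp a]) (whisker [a] [opp a] (caps x)) [a, opp a]"
    using interp_whisker[OF layered_caps, of "[a]" x "[opp a]"]
    by (simp add: Cons layered_caps layered_whisker_right[OF layered_caps, simplified])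
  then show ?case
    by (simp add: interp_append[where y = "[a, opp a]"] layered_whisker[OF layered_caps, of "[a]" x "[opp a]", simplified])
qed simp

lemma interp_cups: "interp val [] (cups x) = dia [] (cups x) (x @ dual_obj x)"
proof (induction x)
  case (Cons a x)
  have "interp val [a, opp a] (whisker [a] [opp a] (cups x))
     = dia [a, opp a] (whisker [a] [opp a] (cups x)) (a # x @ dual_obj x @ [opp a])"
    using interp_whisker[OF layered_cups, of "[a]" "[opp a]" x]
    by (simp add: Cons layered_cups layered_whisker_right[OF layered_cups, simplified])
  then show ?case
    by (simp add: layered_whisker[OF layered_cups, of "[a]" "[opp a]" x, simplified])
qed simp

section \<open>Linear extension to a rigid functor\<close>

definition interp_iclass :: "obj \<Rightarrow> obj \<Rightarrow> 'v iclass \<Rightarrow> ('w, 'r) lincomb" where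
  "interp_iclass x y A = interp val x (SOME ls. layered x ls y \<and> A = iclass (x, ls, y))"

definition interp_lin :: "obj \<Rightarrow> obj \<Rightarrow> ('v, 'r) lincomb \<Rightarrow> ('w, 'r) lincomb" where
  "interp_lin x y f =
     (\<Sum>A\<in>Poly_Mapping.keys f. smult (Poly_Mapping.lookup f A) (interp_iclass x y A))"

definition interp_functor :: "(obj, ('v, 'r) lincomb, obj, ('w, 'r) lincomb) cat_map" where
  "interp_functor = \<lparr> ob_map = (\<lambda>x. x), mor_map = (\<lambda>x y. \<lambda>f\<in>homs x y. interp_lin x y f) \<rparr>"

lemma interp_iclass: "layered x ls y \<Longrightarrow> interp_iclass x y (iclass (x, ls, y)) = interp val x ls"
proof -
  assume l: "layered x ls y"
  let ?P = "\<lambda>l. layered x l y \<and> iclass (x, ls, y) = iclass (x, l, y)"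
  have "?P (SOME l. ?P l)" by (rule someI[of ?P ls]) (simp add: l)
  then have "isotopic x ls (SOME l. ?P l) y" using l by (simp add: isotopic_def iclass_eq_iff)
  then show ?thesis unfolding interp_iclass_def by (rule interp_isotopic[symmetric])
qed

lemma interp_lin_eq_sum:
  assumes "finite S" "Poly_Mapping.keys f \<subseteq> S"
  shows "interp_lin x y f = (\<Sum>A\<in>S. smult (Poly_Mapping.lookup f A) (interp_iclass x y A))"
  unfolding interp_lin_def using assms by (intro sum.mono_neutral_left) (auto simp: in_keys_iff)

lemma interp_lin_zero [simp]: "interp_lin x y 0 = 0"
  by (simp add: interp_lin_def)

lemma interp_lin_add: "interp_lin x y (f + g) = interp_lin x y f + interp_lin x y g"
  using Poly_Mapping.keys_add[of f g]
  by (simp add: interp_lin_eq_sum[where S = "Poly_Mapping.keys f \<union> Poly_Mapping.keys g"]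
      lookup_add smult_distribs sum.distrib)

lemma interp_lin_smult: "interp_lin x y (smult r f) = smult r (interp_lin x y f)"
  using keys_smult[of r f]
  by (simp add: interp_lin_eq_sum[where S = "Poly_Mapping.keys f"] smult_sum)

lemma interp_lin_diff: "interp_lin x y (f - g) = interp_lin x y f - interp_lin x y g"
  using interp_lin_add[of x y f "smult (- 1) g"] interp_lin_smult[of x y "- 1" g]
  by (simp add: smult_distribs)

lemma interp_lin_dia: "layered x ls y \<Longrightarrow> interp_lin x y (dia x ls y) = interp val x ls"
  using interp_lin_eq_sum[of "{iclass (x, ls, y)}" "dia x ls y" x y]
  by (simp add: dia_def lookup_single interp_iclass)

lemma interp_lin_hom: "f \<in> homs x y \<Longrightarrow> interp_lin x y f \<in> homs x y"
  by (induction rule: homs_induct)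
    (auto simp: interp_lin_dia interp_lin_smult interp_lin_add intro: homs_zero homs_add homs_smult interp_hom)

lemma interp_lin_comp:
  assumes "g \<in> homs y z" "f \<in> homs x y"
  shows "interp_lin x z (g \<diamondop> f) = interp_lin y z g \<diamondop> interp_lin x y f"
  using assms(1)
proof (induction rule: homs_induct)
  case (dia ls)
  from assms(2) show ?case
    by (induction rule: homs_induct)
      (use dia in \<open>simp_all add: bilinear_ext_simps interp_lin_add interp_lin_smult interp_lin_dia
         layered_appendI interp_append\<close>)
qed (simp_all add: bilinear_ext_simps interp_lin_add interp_lin_smult)

lemma interp_lin_tens:
  assumes "f \<in> homs x y" "g \<in> homs x' y'"
  shows "interp_lin (x @ x') (y @ y') (f \<otimes> g) = interp_lin x y f \<otimes> interp_lin x' y' g"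
  using assms(1)
proof (induction rule: homs_induct)
  case (dia ls)
  from assms(2) show ?case
    by (induction rule: homs_induct)
      (use dia in \<open>simp_all add: bilinear_ext_simps interp_lin_add interp_lin_smult interp_lin_dia
         layered_appendI[OF layered_whisker_right layered_whisker_left] interp_juxtapose\<close>)
qed (simp_all add: bilinear_ext_simps interp_lin_add interp_lin_smult)

lemma rigid_functor_interp: "rigid_functor diagram_cat diagram_cat interp_functor"
  unfolding rigid_functor_def linear_functor_def interp_functor_def
  by (auto simp: homs_id homs_comp homs_tens homs_add homs_smult dia_in_homs interp_lin_hom interp_lin_dia
      interp_lin_add interp_lin_smult interp_lin_comp interp_lin_tens
      layered_caps layered_cups layered_caps[of "dual_obj _", simplified]
      layered_cups[of "dual_obj _", simplified] interp_caps interp_cups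
      interp_caps[of "dual_obj _", simplified])

end

section \<open>Isotopies of resolved crossings\<close>

lemmas deform_simps = deform_def Let_def numeral_eq_Suc fork_def cross_def

lemma opp_neq [simp]: "opp a \<noteq> a" "a \<noteq> opp a"
  by (cases a; simp)+

lemma opp_eq_iff [simp]: "opp a = opp b \<longleftrightarrow> a = b"
  by (cases a; cases b; simp)

lemma orient_cases: obtains "b = a" | "b = opp a"
  by (cases a; cases b; simp)

lemma isotopic_rotate:
  assumes "ls \<in> turns v" "layered x (pre @ [(u, Vertex v, w)] @ post) y"
    and "layered x (pre @ whisker u w ls @ post) y"
  shows "isotopic x (pre @ [(u, Vertex v, w)] @ post) (pre @ whisker u w ls @ post) y"
  by (rule isotopic_local_move_context[OF local_move.rotate[OF assms(1)] assms(2,3)])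

text \<open>
  The two resolutions of a crossing \<open>a b \<rightarrow> b a\<close> into a smoothing and a fork.  For \<open>b = opp a\<close> they
  are rotated by a quarter turn.
\<close>

definition smoothing :: "orient \<Rightarrow> orient \<Rightarrow> fork layer list" where
  "smoothing a b = (if a = b then [] else [([], Cap a, []), ([], Cup b, [])])"

definition forking :: "orient \<Rightarrow> orient \<Rightarrow> fork layer list" where
  "forking a b = (if a = b then [fork [] a []]
     else [([], Cup b, [a, b]), fork [b] a [b], ([b, a], Cap a, [])])"

lemma layered_smoothing: "layered [a, b] (smoothing a b) [b, a]"
  by (rule orient_cases[of b a]) (auto simp: smoothing_def)

lemma layered_forking: "layered [a, b] (forking a b) [b, a]"
  by (rule orient_cases[of b a]) (auto simp: forking_def fork_def)

lemma smoothing_turn1: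
  "isotopic [a, b] (([], Cup b, [a, b]) # whisker [b] [b] (smoothing (opp b) a) @ [([b, a], Cap (opp b), [])])
     (smoothing a b) [b, a]"
proof (cases rule: orient_cases[of b a])
  case 1
  then show ?thesis
    by (intro isotopic_by_deform[where ms = "[0, 0]" and ns = "[]"])
      (simp_all add: smoothing_def deform_simps)
next
  case 2
  then show ?thesis
    by (intro isotopic_by_deform[where ms = "[0]" and ns = "[]"])
      (simp_all add: smoothing_def deform_simps)
qed

lemma smoothing_turn2:
  "isotopic [a, b] (([a, b], Cup (opp a), []) # whisker [a] [a] (smoothing b (opp a)) @ [([], Cap a, [b, a])])
     (smoothing a b) [b, a]"
proof (cases rule: orient_cases[of b a])
  case 1
  then show ?thesis
    by (intro isotopic_by_deform[where ms = "[0, 0]" and ns = "[]"])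
      (simp_all add: smoothing_def deform_simps)
next
  case 2
  then show ?thesis
    by (intro isotopic_by_deform[where ms = "[0]" and ns = "[]"])
      (simp_all add: smoothing_def deform_simps)
qed

text \<open>On antiparallel strands \<open>forking\<close> is defined as exactly this quarter turn.
  On parallel strands two quarter turns combine to a half turn of the dual fork, which is one of the
  listed rotations read backwards.\<close>

lemma forking_turn1:
  "isotopic [a, b] (([], Cup b, [a, b]) # whisker [b] [b] (forking (opp b) a) @ [([b, a], Cap (opp b), [])])
     (forking a b) [b, a]"
proof (cases rule: orient_cases[of b a])
  case 1
  let ?rot = "[([], Cup a, [a, a]), ([a], Cup a, [opp a, a, a]), fork [a, a] (opp a) [a, a],
      ([a, a, opp a], Cap (opp a), [a]), ([a, a], Cap (opp a), [])]"
  have "isotopic [a, a] ([] @ [fork [] a []] @ []) ([] @ whisker [] [] ?rot @ []) [a, a]"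
    unfolding fork_def by (rule isotopic_rotate) (simp_all add: fork_def)
  from isotopic_sym[OF this] 1 show ?thesis
    by (simp add: forking_def fork_def)
next
  case 2
  then show ?thesis
    by (intro isotopic_by_deform[where ms = "[]" and ns = "[]"])
      (simp_all add: forking_def deform_simps)
qed

text \<open>This turn is opposite to the one that defines \<open>forking\<close>. On parallel
  strands the two turns cancel; on antiparallel strands the fork must first be replaced by a half
  turn of its dual.\<close>

lemma forking_turn2:
  "isotopic [a, b] (([a, b], Cup (opp a), []) # whisker [a] [a] (forking b (opp a)) @ [([], Cap a, [b, a])])
     (forking a b) [b, a]"
proof (cases rule: orient_cases[of b a])
  case 1
  \<comment> \<open>The left cap sinks past the right cap and the fork until it forms a zigzag with
    its cup; then the right cup rises past the fork to form a zigzag with its cap.\<close>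
  then show ?thesis
    by (intro isotopic_by_deform[where ms = "[3, 2, 1, 0, 1]" and ns = "[]"])
      (simp_all add: forking_def deform_simps)
next
  case 2
  let ?b = "opp a"
  let ?rot = "[([], Cup ?b, [?b, ?b]), ([?b], Cup ?b, [a, ?b, ?b]), fork [?b, ?b] a [?b, ?b],
      ([?b, ?b, a], Cap a, [?b]), ([?b, ?b], Cap a, [])]"
  have "isotopic [a, ?b] ([([a, ?b], Cup ?b, [])] @ [fork [a] ?b [a]] @ [([], Cap a, [?b, a])])
     ([([a, ?b], Cup ?b, [])] @ whisker [a] [a] ?rot @ [([], Cap a, [?b, a])]) [?b, a]"
    unfolding fork_def by (rule isotopic_rotate) (simp_all add: fork_def)
  \<comment> \<open>The outer cap on the left sinks to its cup and the outer cup on the right rises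
    to its cap. The inner cup, fork and cap that remain form \<open>forking\<close>.\<close>
  also have "isotopic [a, ?b] ([([a, ?b], Cup ?b, [])] @ whisker [a] [a] ?rot @ [([], Cap a, [?b, a])])
     (forking a ?b) [?b, a]"
    by (rule isotopic_by_deform[where ms = "[5, 4, 3, 2, 1, 0, 1, 2, 3]" and ns = "[]"])
      (simp_all add: forking_def deform_simps)
  finally show ?thesis
    using 2 by (simp add: forking_def fork_def)
qed

text \<open>The loop relation closes a fork on the left. A half turn makes the closure on the right
  into a left closure of the dual fork, sitting on the middle strand of a zigzag.\<close>

lemma right_loop_isotopic:
  "isotopic [a] [([a], Cup a, []), fork [] a [opp a], ([a], Cap a, [])]
     [([], Cup a, [a]), ([a], Cup a, [opp a, a]), fork [a, a] (opp a) [a], ([a], Cap a, [opp a, a]),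
      ([a], Cap (opp a), [])] [a]"
proof -
  let ?rot = "[([], Cup a, [a, a]), ([a], Cup a, [opp a, a, a]), fork [a, a] (opp a) [a, a],
      ([a, a, opp a], Cap (opp a), [a]), ([a, a], Cap (opp a), [])]"
  have "isotopic [a] ([([a], Cup a, [])] @ [fork [] a [opp a]] @ [([a], Cap a, [])])
      ([([a], Cup a, [])] @ whisker [] [opp a] ?rot @ [([a], Cap a, [])]) [a]"
    unfolding fork_def by (rule isotopic_rotate) (simp_all add: fork_def)
  also have "isotopic [a] ([([a], Cup a, [])] @ whisker [] [opp a] ?rot @ [([a], Cap a, [])])
      [([], Cup a, [a]), ([a], Cup a, [opp a, a]), fork [a, a] (opp a) [a], ([a], Cap a, [opp a, a]),
       ([a], Cap (opp a), [])] [a]"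
    by (rule isotopic_by_deform[where ms = "[0, 1, 2, 3, 4, 3]" and ns = "[]"])
      (simp_all add: deform_simps)
  finally show ?thesis by simp
qed

text \<open>Between the outermost cup and cap, the other four layers are the left side of the square
  relation for \<open>opp a\<close>.\<close>

lemma forking_forking_isotopic:
  "isotopic [a, opp a] (forking a (opp a) @ forking (opp a) a)
     [([], Cup a, [a, opp a]), ([a, opp a], Cup (opp a), [a, opp a]), fork [a] (opp a) [a, a, opp a],
      fork [a, opp a, opp a] a [opp a], ([a, opp a], Cap (opp a), [a, opp a]), ([a, opp a], Cap a, [])]
     [a, opp a]"
  by (rule isotopic_by_deform[where ms = "[2, 1, 0, 3, 2, 4]" and ns = "[]"])
    (simp_all add: forking_def deform_simps)

lemma smoothing_forking_isotopic:
  "isotopic [a, opp a] (smoothing a (opp a) @ forking (opp a) a)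
     [([], Cap a, []), ([], Cup a, []), ([a, opp a], Cup (opp a), []), fork [a] (opp a) [a],
      ([a, opp a], Cap (opp a), [])] [a, opp a]"
  by (rule isotopic_by_deform[where ms = "[1]" and ns = "[]"])
    (simp_all add: smoothing_def forking_def deform_simps)

lemma forking_smoothing_isotopic:
  "isotopic [a, opp a] (forking a (opp a) @ smoothing (opp a) a)
     [([], Cup (opp a), [a, opp a]), fork [opp a] a [opp a], ([], Cap (opp a), [a, opp a]),
      ([], Cap a, []), ([], Cup a, [])] [a, opp a]"
  by (rule isotopic_by_deform[where ms = "[2]" and ns = "[]"])
    (simp_all add: smoothing_def forking_def deform_simps)

section \<open>The third Reidemeister move\<close>

text \<open>Isolates what the topological part of R3 uses, replacement of subdiagrams up to isotopy.
  The instance of interest is congruence of resolved diagrams modulo the MOY relations.\<close>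

locale diagram_congruence =
  fixes E :: "obj \<Rightarrow> 'v::plane_vertex layer list \<Rightarrow> 'v layer list \<Rightarrow> obj \<Rightarrow> bool"
  assumes isotopic_imp: "isotopic x ls ls' y \<Longrightarrow> E x ls ls' y"
    and sym: "E x ls ls' y \<Longrightarrow> E x ls' ls y"
    and trans [trans]: "E x l1 l2 y \<Longrightarrow> E x l2 l3 y \<Longrightarrow> E x l1 l3 y"
    and context_closed: "E x m m' y \<Longrightarrow> layered x' pre (s @ x @ t) \<Longrightarrow> layered (s @ y @ t) post y' \<Longrightarrow>
      E x' (pre @ whisker s t m @ post) (pre @ whisker s t m' @ post) y'"
begin

lemma refl: "layered x ls y \<Longrightarrow> E x ls ls y"
  by (intro isotopic_imp isotopic_refl)

lemma by_deform:
  "layered x ls y \<Longrightarrow> layered x ls' y \<Longrightarrow> deform ms ls = deform ns ls' \<Longrightarrow> E x ls ls' y"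
  by (intro isotopic_imp isotopic_by_deform)

text \<open>Uniqueness of inverses: \<open>A'\<close> is congruent to \<open>A' @ B @ B'\<close>,
  then to \<open>A' @ A @ B'\<close>, then to \<open>B'\<close>.\<close>

lemma inverse_cong:
  assumes "E x A B y" "E x (A @ A') [] x" "E y (A' @ A) [] y" "E x (B @ B') [] x"
    and layered: "layered x A y" "layered x B y" "layered y A' x" "layered y B' x"
  shows "E y A' B' x"
proof -
  have "E y (A' @ (B @ B')) (A' @ []) x"
    using context_closed[OF assms(4), of y A' "[]" "[]" "[]" x] layered by simp
  moreover have "E y (A' @ A @ B') (A' @ B @ B') x"
    using context_closed[OF assms(1), of y A' "[]" "[]" B' x] layered by simp
  moreover have "E y ((A' @ A) @ B') B' x"
    using context_closed[OF assms(3), of y "[]" "[]" "[]" B' x] layered by simp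
  ultimately show ?thesis
    using sym trans by (metis append.assoc append_Nil2)
qed

end

locale crossing_congruence = diagram_congruence E
  for E :: "obj \<Rightarrow> crossing layer list \<Rightarrow> crossing layer list \<Rightarrow> obj \<Rightarrow> bool" +
  assumes R2: "E [a, b] [cross [] h a b [], cross [] (\<not> h) b a []] [] [a, b]"
    and R3_parallel: "(p = r \<longrightarrow> q = p) \<Longrightarrow>
      E [a, a, a] [cross [] p a a [a], cross [a] q a a [], cross [] r a a [a]]
        [cross [a] r a a [], cross [] q a a [a], cross [a] p a a []] [a, a, a]"
begin

lemma R2': "E [a, b] [cross [] (\<not> h) a b [], cross [] h b a []] [] [a, b]"
  using R2[of a b "\<not> h"] by simp

text \<open>Rotating the first crossing lets its new cap cancel the given cup in a zigzag. What is
  left on the second leg is a pair of mutually inverse crossings.\<close>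

lemma slide_cup:
  "E [a] [([a], Cup b, []), cross [] p a b [opp b], cross [b] p a (opp b) []] [([], Cup b, [a])] [b, opp b, a]"
proof -
  let ?rot = "[([], Cup b, [a, b]), cross [b] (\<not> p) (opp b) a [b], ([b, a], Cap (opp b), [])]"
  have "E [a] ([([a], Cup b, [])] @ [cross [] p a b [opp b]] @ [cross [b] p a (opp b) []])
      ([([a], Cup b, [])] @ whisker [] [opp b] ?rot @ [cross [b] p a (opp b) []]) [b, opp b, a]"
    unfolding cross_def by (rule isotopic_imp, rule isotopic_rotate) simp_all
  also have "E [a] ([([a], Cup b, [])] @ whisker [] [opp b] ?rot @ [cross [b] p a (opp b) []])
      [([], Cup b, [a]), cross [b] (\<not> p) (opp b) a [], cross [b] p a (opp b) []] [b, opp b, a]"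
    by (rule by_deform[where ms = "[0, 1, 2]" and ns = "[]"]) (simp_all add: deform_simps)
  also have "E [a] [([], Cup b, [a]), cross [b] (\<not> p) (opp b) a [], cross [b] p a (opp b) []]
      [([], Cup b, [a])] [b, opp b, a]"
    using context_closed[OF R2'[of "opp b" a p], of "[a]" "[([], Cup b, [a])]" "[b]" "[]" "[]"]
    by (simp add: cross_def)
  finally show ?thesis by simp
qed

lemma slide_cap:
  "E [a, b, opp b] [cross [] p a b [opp b], cross [b] p a (opp b) [], ([], Cap b, [a])] [([a], Cap b, [])] [a]"
proof -
  let ?rot = "[([], Cup (opp b), [a, opp b]), cross [opp b] (\<not> p) b a [opp b], ([opp b, a], Cap b, [])]"
  have "E [a, b, opp b] ([cross [] p a b [opp b]] @ [cross [b] p a (opp b) []] @ [([], Cap b, [a])])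
      ([cross [] p a b [opp b]] @ whisker [b] [] ?rot @ [([], Cap b, [a])]) [a]"
    unfolding cross_def by (rule isotopic_imp, rule isotopic_rotate) simp_all
  also have "E [a, b, opp b] ([cross [] p a b [opp b]] @ whisker [b] [] ?rot @ [([], Cap b, [a])])
      [cross [] p a b [opp b], cross [] (\<not> p) b a [opp b], ([a], Cap b, [])] [a]"
    by (rule by_deform[where ms = "[3, 2, 1]" and ns = "[]"]) (simp_all add: deform_simps)
  also have "E [a, b, opp b] [cross [] p a b [opp b], cross [] (\<not> p) b a [opp b], ([a], Cap b, [])]
      [([a], Cap b, [])] [a]"
    using context_closed[OF R2[of a b p], of "[a, b, opp b]" "[]" "[]" "[opp b]" "[([a], Cap b, [])]"]
    by (simp add: cross_def)
  finally show ?thesis by simp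
qed

abbreviation slides :: "orient \<Rightarrow> orient \<Rightarrow> orient \<Rightarrow> bool \<Rightarrow> bool \<Rightarrow> bool \<Rightarrow> bool" where
  "slides a b c p q r \<equiv>
     E [a, b, c] [cross [] p a b [c], cross [b] q a c [], cross [] r b c [a]]
       [cross [a] r b c [], cross [] q a c [b], cross [c] p a b []] [c, b, a]"

text \<open>
  The quarter turn of the crossing of \<open>b\<close> and \<open>c\<close> is made of this crossing, a cup and a cap, and
  the strand \<open>a\<close>, being over or under both, slides past each of them.
\<close>

lemma slides_turn:
  assumes "slides a b c p p r"
  shows "slides a c (opp b) p p (\<not> r)"
proof -
  let ?b = "opp b"
  let ?rot = "[([], Cup ?b, [c, ?b]), cross [?b] r b c [?b], ([?b, c], Cap b, [])]"
  have "E [a, c, ?b] ([cross [] p a c [?b], cross [c] p a ?b []] @ [cross [] (\<not> r) c ?b [a]] @ [])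
      ([cross [] p a c [?b], cross [c] p a ?b []] @ whisker [] [a] ?rot @ []) [?b, c, a]"
    unfolding cross_def by (rule isotopic_imp, rule isotopic_rotate) simp_all
  also have "E [a, c, ?b] ([cross [] p a c [?b], cross [c] p a ?b []] @ whisker [] [a] ?rot @ [])
     [([], Cup ?b, [a, c, ?b]), cross [?b, b] p a c [?b], cross [?b] r b c [a, ?b],
      cross [?b, c, b] p a ?b [], ([?b, c], Cap b, [a])] [?b, c, a]"
    by (rule by_deform[where ms = "[1, 0, 2]" and ns = "[]"]) (simp_all add: deform_simps)
  \<comment> \<open>Read backwards, \<open>slide_cup\<close> lets \<open>a\<close> pass the cup at
    the price of two new crossings. The assumed slide then brings the crossing of \<open>a\<close>
    and \<open>b\<close> to the top, where \<open>slide_cap\<close> removes it together with the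
    remaining crossing of \<open>a\<close> and \<open>opp b\<close>.\<close>
  also have "E [a, c, ?b]
     [([], Cup ?b, [a, c, ?b]), cross [?b, b] p a c [?b], cross [?b] r b c [a, ?b],
      cross [?b, c, b] p a ?b [], ([?b, c], Cap b, [a])]
     [([a], Cup ?b, [c, ?b]), cross [] p a ?b [b, c, ?b], cross [?b] p a b [c, ?b],
      cross [?b, b] p a c [?b], cross [?b] r b c [a, ?b],
      cross [?b, c, b] p a ?b [], ([?b, c], Cap b, [a])] [?b, c, a]"
    using context_closed[OF sym[OF slide_cup[of a ?b p]], of "[a, c, ?b]" "[]" "[]" "[c, ?b]"
       "[cross [?b, b] p a c [?b], cross [?b] r b c [a, ?b], cross [?b, c, b] p a ?b [], ([?b, c], Cap b, [a])]"]
    by (simp add: cross_def)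
  also have "E [a, c, ?b]
     [([a], Cup ?b, [c, ?b]), cross [] p a ?b [b, c, ?b], cross [?b] p a b [c, ?b],
      cross [?b, b] p a c [?b], cross [?b] r b c [a, ?b],
      cross [?b, c, b] p a ?b [], ([?b, c], Cap b, [a])]
     [([a], Cup ?b, [c, ?b]), cross [] p a ?b [b, c, ?b], cross [?b, a] r b c [?b],
      cross [?b] p a c [b, ?b], cross [?b, c] p a b [?b],
      cross [?b, c, b] p a ?b [], ([?b, c], Cap b, [a])] [?b, c, a]"
    using context_closed[OF assms, of "[a, c, ?b]" "[([a], Cup ?b, [c, ?b]), cross [] p a ?b [b, c, ?b]]"
       "[?b]" "[?b]" "[cross [?b, c, b] p a ?b [], ([?b, c], Cap b, [a])]"]
    by (simp add: cross_def)
  also have "E [a, c, ?b]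
     [([a], Cup ?b, [c, ?b]), cross [] p a ?b [b, c, ?b], cross [?b, a] r b c [?b],
      cross [?b] p a c [b, ?b], cross [?b, c] p a b [?b],
      cross [?b, c, b] p a ?b [], ([?b, c], Cap b, [a])]
     [([a], Cup ?b, [c, ?b]), cross [] p a ?b [b, c, ?b], cross [?b, a] r b c [?b],
      cross [?b] p a c [b, ?b], ([?b, c, a], Cap b, [])] [?b, c, a]"
    using context_closed[OF slide_cap[of a b p], of "[a, c, ?b]"
       "[([a], Cup ?b, [c, ?b]), cross [] p a ?b [b, c, ?b], cross [?b, a] r b c [?b], cross [?b] p a c [b, ?b]]"
       "[?b, c]" "[]" "[]"]
    by (simp add: cross_def)
  also have "E [a, c, ?b]
     [([a], Cup ?b, [c, ?b]), cross [] p a ?b [b, c, ?b], cross [?b, a] r b c [?b],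
      cross [?b] p a c [b, ?b], ([?b, c, a], Cap b, [])]
     ([] @ whisker [a] [] ?rot @ [cross [] p a ?b [c], cross [?b] p a c []]) [?b, c, a]"
    by (rule by_deform[where ms = "[1, 3, 2]" and ns = "[]"]) (simp_all add: deform_simps)
  also have "E [a, c, ?b]
     ([] @ whisker [a] [] ?rot @ [cross [] p a ?b [c], cross [?b] p a c []])
     ([] @ [cross [a] (\<not> r) c ?b []] @ [cross [] p a ?b [c], cross [?b] p a c []]) [?b, c, a]"
    unfolding cross_def by (rule sym, rule isotopic_imp, rule isotopic_rotate) simp_all
  finally show ?thesis by simp
qed

lemma slides_over_or_under: "slides a b c p p r"
proof -
  \<comment> \<open>The rule \<open>(b, c)\<close> to \<open>(c, opp b)\<close> has period four and,
    started at two strands parallel to \<open>a\<close>, reaches all orientations of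
    \<open>b\<close> and \<open>c\<close>. It negates \<open>r\<close> each time, which is harmless
    since \<open>r\<close> is arbitrary.\<close>
  have 1: "slides a a a p p r" for a r by (rule R3_parallel) simp
  have 2: "slides a a (opp a) p p r" for a r using slides_turn[OF 1, of a "\<not> r"] by simp
  have 3: "slides a (opp a) (opp a) p p r" for a r using slides_turn[OF 2, of a "\<not> r"] by simp
  have 4: "slides a (opp a) a p p r" for a r using slides_turn[OF 3, of a "\<not> r"] by simp
  show ?thesis
    by (rule orient_cases[of b a]; rule orient_cases[of c a]; hypsubst; rule 1 2 3 4)
qed

lemma cancel_left:
  "E [a, b, c] [cross [] p a b [c], cross [b] q a c [], cross [] r b c [a],
      cross [] (\<not> r) c b [a], cross [b] (\<not> q) c a [], cross [] (\<not> p) b a [c]] [] [a, b, c]"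
proof -
  have "E [a, b, c] [cross [] p a b [c], cross [b] q a c [], cross [] r b c [a],
      cross [] (\<not> r) c b [a], cross [b] (\<not> q) c a [], cross [] (\<not> p) b a [c]]
     [cross [] p a b [c], cross [b] q a c [], cross [b] (\<not> q) c a [], cross [] (\<not> p) b a [c]] [a, b, c]"
    using context_closed[OF R2[of b c r], of "[a, b, c]" "[cross [] p a b [c], cross [b] q a c []]" "[]" "[a]"
        "[cross [b] (\<not> q) c a [], cross [] (\<not> p) b a [c]]"] by (simp add: cross_def)
  also have "E [a, b, c]
     [cross [] p a b [c], cross [b] q a c [], cross [b] (\<not> q) c a [], cross [] (\<not> p) b a [c]]
     [cross [] p a b [c], cross [] (\<not> p) b a [c]] [a, b, c]"
    using context_closed[OF R2[of a c q], of "[a, b, c]" "[cross [] p a b [c]]" "[b]" "[]"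
        "[cross [] (\<not> p) b a [c]]"] by (simp add: cross_def)
  also have "E [a, b, c] [cross [] p a b [c], cross [] (\<not> p) b a [c]] [] [a, b, c]"
    using context_closed[OF R2[of a b p], of "[a, b, c]" "[]" "[]" "[c]" "[]"] by (simp add: cross_def)
  finally show ?thesis .
qed

lemma cancel_right:
  "E [a, b, c] [cross [a] r b c [], cross [] q a c [b], cross [c] p a b [],
      cross [c] (\<not> p) b a [], cross [] (\<not> q) c a [b], cross [a] (\<not> r) c b []] [] [a, b, c]"
proof -
  have "E [a, b, c] [cross [a] r b c [], cross [] q a c [b], cross [c] p a b [],
      cross [c] (\<not> p) b a [], cross [] (\<not> q) c a [b], cross [a] (\<not> r) c b []]
     [cross [a] r b c [], cross [] q a c [b], cross [] (\<not> q) c a [b], cross [a] (\<not> r) c b []] [a, b, c]"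
    using context_closed[OF R2[of a b p], of "[a, b, c]" "[cross [a] r b c [], cross [] q a c [b]]" "[c]" "[]"
        "[cross [] (\<not> q) c a [b], cross [a] (\<not> r) c b []]"] by (simp add: cross_def)
  also have "E [a, b, c]
     [cross [a] r b c [], cross [] q a c [b], cross [] (\<not> q) c a [b], cross [a] (\<not> r) c b []]
     [cross [a] r b c [], cross [a] (\<not> r) c b []] [a, b, c]"
    using context_closed[OF R2[of a c q], of "[a, b, c]" "[cross [a] r b c []]" "[]" "[b]"
        "[cross [a] (\<not> r) c b []]"] by (simp add: cross_def)
  also have "E [a, b, c] [cross [a] r b c [], cross [a] (\<not> r) c b []] [] [a, b, c]"
    using context_closed[OF R2[of b c r], of "[a, b, c]" "[]" "[a]" "[]" "[]"] by (simp add: cross_def)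
  finally show ?thesis .
qed

text \<open>By \<open>cancel_left\<close> and \<open>cancel_right\<close>, the two sides of the move
  for \<open>c\<close>, \<open>b\<close>, \<open>a\<close> with negated data are the inverses of the
  two sides for \<open>a\<close>, \<open>b\<close>, \<open>c\<close>.\<close>

lemma slides_inverse:
  assumes "slides c b a (\<not> r) (\<not> q) (\<not> p)"
  shows "slides a b c p q r"
  by (rule inverse_cong[OF assms])
    (use cancel_left[of c b a "\<not> r" "\<not> q" "\<not> p"] cancel_left[of a b c p q r]
      cancel_right[of c b a "\<not> p" "\<not> q" "\<not> r"] in \<open>simp_all add: cross_def\<close>)

lemma R3:
  assumes "p = r \<longrightarrow> q = p"
  shows "slides a b c p q r"
\<comment> \<open>Only one strand has the middle height, so \<open>a\<close> or \<open>c\<close> is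
  extremal: \<open>a\<close> if \<open>q = p\<close>, and otherwise \<open>c\<close>, because then
  \<open>q = r\<close>.\<close>
proof (cases "q = p")
  case True
  then show ?thesis using slides_over_or_under[of a b c p r] by simp
next
  case False
  then have "q = r" using assms by auto
  then show ?thesis using slides_over_or_under[of c b a "\<not> r" "\<not> p"] by (simp add: slides_inverse)
qed

end

section \<open>Reidemeister moves of resolved crossings\<close>

lemma unit_inv_unique:
  fixes x y :: "'r::{comm_ring,comm_monoid_mult}"
  assumes "x * y = 1"
  shows "unit_inv x = y"
  unfolding unit_inv_def
proof (rule the_equality, rule assms)
  fix z assume "x * z = 1"
  then have "y * (x * z) = y" by simp
  then show "z = y" using assms by (metis mult.assoc mult.commute mult_1)
qed

lemma unit_inv_right:
  fixes x :: "'r::{comm_ring,comm_monoid_mult}"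
  assumes "x dvd 1"
  shows "x * unit_inv x = 1"
proof -
  obtain y where "x * y = 1" using assms by (metis dvdE)
  then show ?thesis by (simp add: unit_inv_unique)
qed

definition crossing_gain :: "'r \<Rightarrow> bool \<Rightarrow> 'r::{comm_ring,comm_monoid_mult}" where
  "crossing_gain \<alpha> h = (if h then unit_inv \<alpha> else \<alpha>)"

definition crossing_shift :: "'r \<Rightarrow> bool \<Rightarrow> 'r::{comm_ring,comm_monoid_mult}" where
  "crossing_shift \<zeta> h = (if h then unit_inv \<zeta> else \<zeta>)"

text \<open>The condition \<open>h = (a = b)\<close> says that the crossing is positive. A quarter
  turn negates both \<open>h\<close> and \<open>a = b\<close>, so it preserves this condition and
  hence the coefficients.\<close>

fun crossing_val :: "'r \<Rightarrow> 'r \<Rightarrow> crossing \<Rightarrow> (fork, 'r::{comm_ring,comm_monoid_mult}) lincomb" where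
  "crossing_val \<alpha> \<zeta> (Crossing h a b) =
     smult (crossing_gain \<alpha> (h = (a = b)))
       (smult (crossing_shift \<zeta> (h = (a = b))) (dia [a, b] (smoothing a b) [b, a])
        + dia [a, b] (forking a b) [b, a])"

lemma interp_crossing_turn1:
  "interp (crossing_val \<alpha> \<zeta>) [a, b]
     [([], Cup b, [a, b]), ([b], Vertex (Crossing (\<not> h) (opp b) a), [b]), ([b, a], Cap (opp b), [])]
   = crossing_val \<alpha> \<zeta> (Crossing h a b)"
proof -
  have eq: "((\<not> h) = (opp b = a)) = (h = (a = b))" by (cases a; cases b; simp)
  show ?thesis
    using layered_smoothing[of "opp b" a] layered_forking[of "opp b" a]
      layered_whisker[OF layered_smoothing, of "[]" "opp b" a "[b]"]
      layered_whisker[OF layered_smoothing, of "[b]" "opp b" a "[b]"]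
      layered_whisker[OF layered_forking, of "[]" "opp b" a "[b]"]
      layered_whisker[OF layered_forking, of "[b]" "opp b" a "[b]"]
    by (simp add: bilinear_ext_simps smult_distribs eq layered_appendI dia_eqI[OF smoothing_turn1] dia_eqI[OF forking_turn1])
qed

lemma interp_crossing_turn2:
  "interp (crossing_val \<alpha> \<zeta>) [a, b]
     [([a, b], Cup (opp a), []), ([a], Vertex (Crossing (\<not> h) b (opp a)), [a]), ([], Cap a, [b, a])]
   = crossing_val \<alpha> \<zeta> (Crossing h a b)"
proof -
  have eq: "((\<not> h) = (b = opp a)) = (h = (a = b))" by (cases a; cases b; simp)
  show ?thesis
    using layered_smoothing[of b "opp a"] layered_forking[of b "opp a"]
      layered_whisker[OF layered_smoothing, of "[]" b "opp a" "[a]"]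
      layered_whisker[OF layered_smoothing, of "[a]" b "opp a" "[a]"]
      layered_whisker[OF layered_forking, of "[]" b "opp a" "[a]"]
      layered_whisker[OF layered_forking, of "[a]" b "opp a" "[a]"]
    by (simp add: bilinear_ext_simps smult_distribs eq layered_appendI dia_eqI[OF smoothing_turn2] dia_eqI[OF forking_turn2])
qed

lemma vertex_interp_crossing_val: "vertex_interp (crossing_val \<alpha> \<zeta>)"
proof
  fix v :: crossing and ls
  obtain h a b where v: "v = Crossing h a b" by (cases v)
  show "crossing_val \<alpha> \<zeta> v \<in> homs (vdom v) (vcod v)"
    by (auto simp: v intro!: homs_smult homs_add dia_in_homs layered_smoothing layered_forking)
  assume "ls \<in> turns v"
  then show "layered (vdom v) ls (vcod v)" "interp (crossing_val \<alpha> \<zeta>) (vdom v) ls = crossing_val \<alpha> \<zeta> v"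
    by (auto simp: v simp del: interp.simps crossing_val.simps
        intro: interp_crossing_turn1 interp_crossing_turn2)
qed

text \<open>The third assumption concerns the denominator of the MOY integers, which equals
  \<open>- z\<close> in the theorem.\<close>

locale moy_parameters =
  fixes \<alpha> \<zeta> :: "'r::{comm_ring,comm_monoid_mult}" and n :: nat
  assumes \<alpha>_unit: "\<alpha> dvd 1" and \<zeta>_unit: "\<zeta> dvd 1" and \<zeta>_diff_unit: "(\<zeta> - unit_inv \<zeta>) dvd 1"
begin

sublocale V: vertex_interp "crossing_val \<alpha> \<zeta>"
  by (rule vertex_interp_crossing_val)

sublocale T: quotient_of_linear
  "diagram_cat :: (obj, (fork, 'r) lincomb, 'r) rigid_cat" "moy_rel \<alpha> \<zeta> n"
  by (simp add: quotient_of_linear_def linear_tensor_cat_diagram_cat)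

abbreviation gain :: "bool \<Rightarrow> 'r" where "gain \<equiv> crossing_gain \<alpha>"
abbreviation shift :: "bool \<Rightarrow> 'r" where "shift \<equiv> crossing_shift \<zeta>"
abbreviation bracket :: "int \<Rightarrow> 'r" where "bracket \<equiv> moy_int \<alpha> \<zeta> n"
abbreviation crossings_interp :: "obj \<Rightarrow> crossing layer list \<Rightarrow> (fork, 'r) lincomb" where
  "crossings_interp \<equiv> interp (crossing_val \<alpha> \<zeta>)"

lemma gain_mult: "gain h * gain (\<not> h) = 1" "gain (\<not> h) * gain h = 1"
  using unit_inv_right[OF \<alpha>_unit] by (auto simp: crossing_gain_def mult.commute)

lemma shift_mult: "shift h * shift (\<not> h) = 1" "shift (\<not> h) * shift h = 1"
  using unit_inv_right[OF \<zeta>_unit] by (auto simp: crossing_shift_def mult.commute)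

lemma shift_add: "shift h + shift (\<not> h) = \<zeta> + unit_inv \<zeta>"
  by (simp add: crossing_shift_def add.commute)

lemma bracket_eqs:
  shows bracket_0: "bracket (int n) = (unit_inv \<alpha> - \<alpha>) * unit_inv (\<zeta> - unit_inv \<zeta>)"
    and bracket_1: "bracket (int n - 1) =
      (\<alpha> * \<zeta> - unit_inv \<alpha> * unit_inv \<zeta>) * unit_inv (\<zeta> - unit_inv \<zeta>)"
    and bracket_2: "bracket (int n - 2) =
      (unit_inv \<alpha> * (unit_inv \<zeta> * unit_inv \<zeta>) - \<alpha> * (\<zeta> * \<zeta>)) * unit_inv (\<zeta> - unit_inv \<zeta>)"
proof -
  have "unit_inv (- \<zeta>) = - unit_inv \<zeta>"
    by (rule unit_inv_unique) (simp add: unit_inv_right[OF \<zeta>_unit])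
  then show "bracket (int n) = (unit_inv \<alpha> - \<alpha>) * unit_inv (\<zeta> - unit_inv \<zeta>)"
    "bracket (int n - 1) = (\<alpha> * \<zeta> - unit_inv \<alpha> * unit_inv \<zeta>) * unit_inv (\<zeta> - unit_inv \<zeta>)"
    "bracket (int n - 2) =
      (unit_inv \<alpha> * (unit_inv \<zeta> * unit_inv \<zeta>) - \<alpha> * (\<zeta> * \<zeta>)) * unit_inv (\<zeta> - unit_inv \<zeta>)"
    by (simp_all add: moy_int_def unit_powi_def numeral_2_eq_2)
qed

text \<open>The coefficient of the strand that remains of a curl: its smoothing contains a circle
  and its fork closes to a loop. The bracketed sum is the inverse of \<open>gain h\<close>, which
  explains the power of \<alpha> in the value of a crossing.\<close>

lemma bracket_curl: "gain h * (shift h * bracket (int n) + bracket (int n - 1)) = 1"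
proof -
  let ?d = "unit_inv (\<zeta> - unit_inv \<zeta>)"
  have "shift h * bracket (int n) + bracket (int n - 1) = gain (\<not> h) * ((\<zeta> - unit_inv \<zeta>) * ?d)"
    by (cases h) (simp_all add: bracket_eqs crossing_shift_def crossing_gain_def algebra_simps)
  then show ?thesis
    using unit_inv_right[OF \<zeta>_diff_unit] gain_mult by simp
qed

text \<open>The coefficient of the cap-cup diagram in the antiparallel R2: the four resolutions
  contribute a circle, two loops and a square.\<close>

lemma bracket_bigon: "bracket (int n) + (\<zeta> + unit_inv \<zeta>) * bracket (int n - 1) + bracket (int n - 2) = 0"
proof -
  have "bracket (int n) + (\<zeta> + unit_inv \<zeta>) * bracket (int n - 1) + bracket (int n - 2)
    = (unit_inv \<alpha> - \<alpha>) * unit_inv (\<zeta> - unit_inv \<zeta>)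
      - \<zeta> * unit_inv \<zeta> * ((unit_inv \<alpha> - \<alpha>) * unit_inv (\<zeta> - unit_inv \<zeta>))"
    by (simp add: bracket_eqs algebra_simps)
  then show ?thesis by (simp add: unit_inv_right[OF \<zeta>_unit])
qed

text \<open>Compares the coefficients of a single fork on the two sides of R3. The hypothesis
  excludes cyclic heights: for \<open>p = r\<close> and \<open>q\<close> different from them the
  identity fails in general.\<close>

lemma shift_triangle:
  assumes "p = r \<longrightarrow> q = p"
  shows "shift q * shift r + shift p * shift q - shift q * (\<zeta> + unit_inv \<zeta>) + 1 = shift p * shift r"
  using assms unit_inv_right[OF \<zeta>_unit]
  by (cases p; cases q; cases r) (simp_all add: crossing_shift_def algebra_simps)

section \<open>Congruence modulo the MOY relations\<close>

definition cong_moy :: "obj \<Rightarrow> obj \<Rightarrow> (fork, 'r) lincomb \<Rightarrow> (fork, 'r) lincomb \<Rightarrow> bool" where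
  "cong_moy x y f g \<longleftrightarrow> T.cong_mod x y f g"

lemma cong_moy_iff: "cong_moy x y f g \<longleftrightarrow>
    f \<in> homs x y \<and> g \<in> homs x y \<and> tensor_ideal diagram_cat (moy_rel \<alpha> \<zeta> n) x y (f - g)"
  by (simp add: cong_moy_def T.cong_mod_iff smult_distribs)

lemma cong_moyI:
  "moy_rel \<alpha> \<zeta> n x y (f - g) \<Longrightarrow> f \<in> homs x y \<Longrightarrow> g \<in> homs x y \<Longrightarrow> cong_moy x y f g"
  by (simp add: cong_moy_iff tensor_ideal.gen)

lemmas cong_refl = T.cong_mod_refl[folded cong_moy_def]
lemmas cong_sym = T.cong_mod_sym[folded cong_moy_def]
lemmas cong_trans [trans] = T.cong_mod_trans[folded cong_moy_def]
lemmas cong_add = T.cong_mod_add[folded cong_moy_def, simplified]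
lemmas cong_smult = T.cong_mod_scal[folded cong_moy_def, simplified]
lemmas cong_comp = T.cong_mod_cmp[folded cong_moy_def, simplified]
lemmas cong_tens = T.cong_mod_tens[folded cong_moy_def, simplified]

lemma cong_whisker:
  "cong_moy x y f g \<Longrightarrow>
   cong_moy (s @ x @ t) (s @ y @ t) (lin_id s \<otimes> f \<otimes> lin_id t) (lin_id s \<otimes> g \<otimes> lin_id t)"
  by (intro cong_tens cong_refl homs_id)

lemma cong_sandwich:
  assumes "cong_moy x y f g" "h \<in> homs (s @ y @ t) y'" "k \<in> homs x' (s @ x @ t)"
  shows "cong_moy x' y' (h \<diamondop> (lin_id s \<otimes> f \<otimes> lin_id t) \<diamondop> k) (h \<diamondop> (lin_id s \<otimes> g \<otimes> lin_id t) \<diamondop> k)"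
  by (rule cong_comp[OF cong_refl[OF assms(2)] cong_comp[OF cong_whisker[OF assms(1)] cong_refl[OF assms(3)]]])

lemma cong_context:
  assumes "cong_moy x y f g" "layered x' pre (s @ x @ t)" "layered (s @ y @ t) post y'"
  shows "cong_moy x' y' (dia (s @ y @ t) post y' \<diamondop> (lin_id s \<otimes> f \<otimes> lin_id t) \<diamondop> dia x' pre (s @ x @ t))
    (dia (s @ y @ t) post y' \<diamondop> (lin_id s \<otimes> g \<otimes> lin_id t) \<diamondop> dia x' pre (s @ x @ t))"
  by (rule cong_sandwich[OF assms(1) dia_in_homs[OF assms(3)] dia_in_homs[OF assms(2)]])

lemma context_dia:
  assumes "layered x m y" "layered x' pre (s @ x @ t)" "layered (s @ y @ t) post y'"
  shows "dia (s @ y @ t) post y' \<diamondop> (lin_id s \<otimes> dia x m y \<otimes> lin_id t) \<diamondop> dia x' pre (s @ x @ t)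
    = dia x' (pre @ whisker s t m @ post) y'"
  using assms layered_whisker[of x m y s t] layered_whisker_right[of x m y t]
    layered_appendI[of x' pre "s @ x @ t" "whisker s t m"]
  by simp

lemma cong_context_dia:
  assumes "cong_moy x y (dia x m y) (smult c (dia x m' y))" "layered x m y" "layered x m' y"
    and "layered x' pre (s @ x @ t)" "layered (s @ y @ t) post y'"
  shows "cong_moy x' y' (dia x' (pre @ whisker s t m @ post) y') (smult c (dia x' (pre @ whisker s t m' @ post) y'))"
  using cong_context[OF assms(1,4,5)]
  by (simp only: bilinear_ext_smult context_dia[OF assms(2,4,5)] context_dia[OF assms(3,4,5)])

lemma circle_cong:
  "cong_moy [] [] (dia [] [([], Cup a, []), ([], Cap a, [])] []) (smult (bracket (int n)) (lin_id []))"
  by (rule cong_moyI[OF moy_rel.circle]) (auto intro!: homs_smult dia_in_homs)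

lemma digon_cong:
  "cong_moy [a, a] [a, a] (dia [a, a] [fork [] a [], fork [] a []] [a, a])
     (smult (- (\<zeta> + unit_inv \<zeta>)) (dia [a, a] [fork [] a []] [a, a]))"
  by (rule cong_moyI[OF moy_rel.digon]) (auto intro!: homs_smult dia_in_homs simp: fork_def)

lemma loop_cong:
  "cong_moy [a] [a] (dia [a] [([], Cup (opp a), [a]), fork [opp a] a [], ([], Cap (opp a), [a])] [a])
     (smult (bracket (int n - 1)) (lin_id [a]))"
  by (rule cong_moyI[OF moy_rel.loop]) (auto intro!: homs_smult dia_in_homs simp: fork_def)

lemma square_cong:
  "cong_moy [a, opp a] [a, opp a]
    (dia [a, opp a]
       [([a], Cup a, [opp a]), fork [] a [opp a, opp a], fork [a, a] (opp a) [],
        ([a], Cap a, [opp a])] [a, opp a])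
    (dia [a, opp a] [([], Cap a, []), ([], Cup a, [])] [a, opp a]
     + smult (bracket (int n - 2)) (lin_id [a, opp a]))"
  by (rule cong_moyI)
    (use moy_rel.square[of \<alpha> \<zeta> n a] in
      \<open>auto intro!: homs_smult homs_add dia_in_homs simp: fork_def diff_diff_eq\<close>)

lemma braid_cong:
  "cong_moy [a, a, a] [a, a, a]
    (dia [a, a, a] [fork [] a [a], fork [a] a [], fork [] a [a]] [a, a, a])
    (dia [a, a, a] [fork [a] a [], fork [] a [a], fork [a] a []] [a, a, a]
     + dia [a, a, a] [fork [] a [a]] [a, a, a] - dia [a, a, a] [fork [a] a []] [a, a, a])"
  by (rule cong_moyI)
    (use moy_rel.braid[of \<alpha> \<zeta> n a] in
      \<open>auto intro!: homs_diff homs_add dia_in_homs simp: fork_def algebra_simps\<close>)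

lemma right_loop_cong:
  "cong_moy [a] [a] (dia [a] [([a], Cup a, []), fork [] a [opp a], ([a], Cap a, [])] [a])
     (smult (bracket (int n - 1)) (lin_id [a]))"
proof -
  have "cong_moy [a] [a]
     (dia [a] [([], Cup a, [a]), ([a], Cup a, [opp a, a]), fork [a, a] (opp a) [a],
        ([a], Cap a, [opp a, a]), ([a], Cap (opp a), [])] [a])
     (smult (bracket (int n - 1)) (dia [a] [([], Cup a, [a]), ([a], Cap (opp a), [])] [a]))"
    using cong_context_dia[OF loop_cong[of "opp a"], of "[a]" "[([], Cup a, [a])]" "[a]" "[a]"
        "[([a], Cap (opp a), [])]"] by (simp add: fork_def)
  moreover have zigzag: "isotopic [a] [([], Cup a, [a]), ([a], Cap (opp a), [])] ([] :: fork layer list) [a]"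
    by (rule isotopic_by_deform[where ms = "[0]" and ns = "[]"]) (simp_all add: deform_simps)
  ultimately show ?thesis
    by (simp add: dia_eqI[OF right_loop_isotopic] dia_eqI[OF zigzag])
qed

end

lemma smult_collect: "smult g (smult s (smult c f) + smult d f) = smult (g * (s * c + d)) f"
  by (simp add: smult_distribs distrib_left mult.assoc)

lemma two_resolutions:
  "smult g' (smult s' A' + B') \<diamondop> smult g (smult s A + B) =
   smult (g * g') ((smult (s * s') (A' \<diamondop> A) + smult s (B' \<diamondop> A)) + (smult s' (A' \<diamondop> B) + B' \<diamondop> B))"
  by (simp add: bilinear_ext_simps smult_distribs mult_ac add_ac)

lemma three_resolutions:
  "smult g'' (smult s'' A'' + B'') \<diamondop> smult g' (smult s' A' + B') \<diamondop> smult g (smult s A + B) =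
   smult (g * g' * g'')
     ((smult (s * s' * s'') (A'' \<diamondop> A' \<diamondop> A) + (smult s'' (A'' \<diamondop> B' \<diamondop> B) + smult s (B'' \<diamondop> B' \<diamondop> A))) +
      (smult (s * s') (B'' \<diamondop> A' \<diamondop> A) + smult (s' * s'') (A'' \<diamondop> A' \<diamondop> B) + (smult (s * s'') (A'' \<diamondop> B' \<diamondop> A) +
      (smult s' (B'' \<diamondop> A' \<diamondop> B) + B'' \<diamondop> B' \<diamondop> B))))"
  by (simp add: bilinear_ext_simps smult_distribs mult_ac add_ac)

text \<open>In R3 on parallel strands, \<open>f1\<close> and \<open>f2\<close> are the two single
  forks, \<open>e\<close> is the triple fork kept by the braid relation, and \<open>- d\<close> is
  the factor in the digon relation.\<close>

lemma swap_resolutions: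
  assumes "b - q * d + 1 = c"
  shows "smult b f1 + (smult c f2 + (smult q (smult (- d) f1) + (e + f1 - f2))) =
    smult b f2 + (smult c f1 + (smult q (smult (- d) f2) + e))"
  unfolding assms[symmetric] by (simp add: smult_distribs algebra_simps)

section \<open>Resolved Reidemeister moves\<close>

context moy_parameters
begin

lemma interp_cross:
  "crossings_interp (u @ [a, b] @ w) [cross u h a b w] =
    smult (gain (h = (a = b)))
      (smult (shift (h = (a = b))) (dia (u @ [a, b] @ w) (whisker u w (smoothing a b)) (u @ [b, a] @ w))
       + dia (u @ [a, b] @ w) (whisker u w (forking a b)) (u @ [b, a] @ w))"
  using layered_whisker_right[OF layered_smoothing, of a b w] layered_whisker_right[OF layered_forking, of a b w]
    layered_whisker[OF layered_smoothing, of u a b w] layered_whisker[OF layered_forking, of u a b w]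
  by (simp add: cross_def layered_smoothing layered_forking bilinear_ext_simps smult_distribs)

lemma R1_left_cong:
  "cong_moy [a] [a]
     (crossings_interp [a] [([], Cup (opp a), [a]), cross [opp a] h a a [], ([], Cap (opp a), [a])])
     (lin_id [a])"
proof -
  let ?circle = "dia [a] [([], Cup (opp a), [a]), ([], Cap (opp a), [a])] [a]"
  let ?loop = "dia [a] [([], Cup (opp a), [a]), fork [opp a] a [], ([], Cap (opp a), [a])] [a]"
  have interp: "crossings_interp [a] [([], Cup (opp a), [a]), cross [opp a] h a a [], ([], Cap (opp a), [a])]
     = smult (gain h) (smult (shift h) ?circle + ?loop)"
    by (simp add: cross_def smoothing_def forking_def fork_def bilinear_ext_simps smult_distribs)
  have "cong_moy [a] [a] (smult (gain h) (smult (shift h) ?circle + ?loop))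
      (smult (gain h) (smult (shift h) (smult (bracket (int n)) (lin_id [a])) + smult (bracket (int n - 1)) (lin_id [a])))"
    using cong_context_dia[OF circle_cong[of "opp a"], of "[a]" "[]" "[]" "[a]" "[]"]
    by (intro cong_smult cong_add loop_cong) simp
  then show ?thesis
    unfolding interp smult_collect bracket_curl smult_simps(3) .
qed

lemma R1_right_cong:
  "cong_moy [a] [a] (crossings_interp [a] [([a], Cup a, []), cross [] h a a [opp a], ([a], Cap a, [])])
     (lin_id [a])"
proof -
  let ?circle = "dia [a] [([a], Cup a, []), ([a], Cap a, [])] [a]"
  let ?loop = "dia [a] [([a], Cup a, []), fork [] a [opp a], ([a], Cap a, [])] [a]"
  have interp: "crossings_interp [a] [([a], Cup a, []), cross [] h a a [opp a], ([a], Cap a, [])]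
     = smult (gain h) (smult (shift h) ?circle + ?loop)"
    by (simp add: cross_def smoothing_def forking_def fork_def bilinear_ext_simps smult_distribs)
  have "cong_moy [a] [a] (smult (gain h) (smult (shift h) ?circle + ?loop))
      (smult (gain h) (smult (shift h) (smult (bracket (int n)) (lin_id [a])) + smult (bracket (int n - 1)) (lin_id [a])))"
    using cong_context_dia[OF circle_cong[of a], of "[a]" "[]" "[a]" "[]" "[]"]
    by (intro cong_smult cong_add right_loop_cong) simp
  then show ?thesis
    unfolding interp smult_collect bracket_curl smult_simps(3) .
qed

text \<open>The product of the two resolutions expands to
  \<open>id + (\<zeta> + \<zeta>^-1) S + S S\<close>, and the digon relation cancels the last two
  terms.\<close>

lemma R2_parallel_cong:
  "cong_moy [a, a] [a, a] (crossings_interp [a, a] [cross [] h a a [], cross [] (\<not> h) a a []]) (lin_id [a, a])"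
proof -
  let ?I = "lin_id [a, a] :: (fork, 'r) lincomb" and ?S = "dia [a, a] [fork [] a []] [a, a] :: (fork, 'r) lincomb"
  let ?SS = "dia [a, a] [fork [] a [], fork [] a []] [a, a] :: (fork, 'r) lincomb"
  have interp: "crossings_interp [a, a] [cross [] h a a [], cross [] (\<not> h) a a []] =
      ?I + (smult (\<zeta> + unit_inv \<zeta>) ?S + ?SS)"
  proof -
    have "crossings_interp [a, a] [cross [] h a a [], cross [] (\<not> h) a a []] =
        crossings_interp [a, a] [cross [] (\<not> h) a a []] \<diamondop> crossings_interp [a, a] [cross [] h a a []]"
      using V.interp_append[of "[a, a]" "[cross [] h a a []]" "[a, a]" "[cross [] (\<not> h) a a []]" "[a, a]"]
      by (simp add: cross_def del: interp.simps)
    also have "\<dots> = smult (gain h * gain (\<not> h))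
        ((smult (shift h * shift (\<not> h)) ?I + smult (shift h) ?S) + (smult (shift (\<not> h)) ?S + ?SS))"
      using interp_cross[of "[]" a a "[]" h] interp_cross[of "[]" a a "[]" "\<not> h"]
      by (simp add: two_resolutions smoothing_def forking_def fork_def del: interp.simps)
    also have "\<dots> = ?I + (smult (shift h + shift (\<not> h)) ?S + ?SS)"
      unfolding gain_mult shift_mult by (simp add: smult_distribs add.assoc)
    also have "\<dots> = ?I + (smult (\<zeta> + unit_inv \<zeta>) ?S + ?SS)"
      by (simp only: shift_add)
    finally show ?thesis .
  qed
  have "cong_moy [a, a] [a, a] (?I + (smult (\<zeta> + unit_inv \<zeta>) ?S + ?SS)) (?I + (smult (\<zeta> + unit_inv \<zeta>) ?S + smult (- (\<zeta> + unit_inv \<zeta>)) ?S))"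
    by (intro cong_add cong_smult cong_refl digon_cong) (auto intro!: dia_in_homs simp: fork_def)
  moreover have "?I + (smult (\<zeta> + unit_inv \<zeta>) ?S + smult (- (\<zeta> + unit_inv \<zeta>)) ?S) = ?I"
    by (simp add: smult_distribs)
  ultimately show ?thesis by (simp only: interp)
qed

lemma R2_antiparallel_cong:
  "cong_moy [a, opp a] [a, opp a]
     (crossings_interp [a, opp a] [cross [] h a (opp a) [], cross [] (\<not> h) (opp a) a []]) (lin_id [a, opp a])"
proof -
  let ?b = "opp a"
  let ?x = "[a, ?b]"
  let ?U = "dia ?x [([], Cap a, []), ([], Cup a, [])] ?x :: (fork, 'r) lincomb"
  let ?I = "lin_id ?x :: (fork, 'r) lincomb"
  have "cong_moy ?x ?x (dia ?x (smoothing a ?b @ smoothing ?b a) ?x) (smult (bracket (int n)) ?U)"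
    using cong_context_dia[OF circle_cong[of ?b], of ?x "[([], Cap a, [])]" "[]" "[]" "[([], Cup a, [])]"]
    by (simp add: smoothing_def)
  moreover have "cong_moy ?x ?x (dia ?x (smoothing a ?b @ forking ?b a) ?x) (smult (bracket (int n - 1)) ?U)"
    using cong_context_dia[OF right_loop_cong[of ?b], of ?x "[([], Cap a, []), ([], Cup a, [])]" "[a]" "[]" "[]"]
    by (simp add: dia_eqI[OF smoothing_forking_isotopic] fork_def)
  moreover have "cong_moy ?x ?x (dia ?x (forking a ?b @ smoothing ?b a) ?x) (smult (bracket (int n - 1)) ?U)"
    using cong_context_dia[OF loop_cong[of a], of ?x "[]" "[]" "[?b]" "[([], Cap a, []), ([], Cup a, [])]"]
    by (simp add: dia_eqI[OF forking_smoothing_isotopic] fork_def)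
  moreover have "cong_moy ?x ?x (dia ?x (forking a ?b @ forking ?b a) ?x)
      (?I + smult (bracket (int n - 2)) ?U)"
  proof -
    \<comment> \<open>Under the surrounding cup and cap the two terms of the square relation trade
      places: its cap-cup term becomes the identity and its identity term becomes the cap-cup
      diagram.\<close>
    have 1: "isotopic ?x [([], Cup a, ?x), ([a], Cap ?b, [?b]), ([a], Cup ?b, [?b]), (?x, Cap a, [])]
        ([] :: fork layer list) ?x"
      by (rule isotopic_by_deform[where ms = "[0, 0]" and ns = "[]"]) (simp_all add: deform_simps)
    have 2: "isotopic ?x [([], Cup a, ?x), (?x, Cap a, [])]
        ([([], Cap a, []), ([], Cup a, [])] :: fork layer list) ?x"
      by (rule isotopic_by_deform[where ms = "[0]" and ns = "[]"]) (simp_all add: deform_simps)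
    show ?thesis
      using cong_context[OF square_cong[of ?b], of ?x "[([], Cup a, ?x)]" "[a]" "[?b]" "[(?x, Cap a, [])]" ?x]
      by (simp add: dia_eqI[OF forking_forking_isotopic] dia_eqI[OF 1] dia_eqI[OF 2] bilinear_ext_simps fork_def)
  qed
  moreover have "crossings_interp ?x [cross [] h a ?b [], cross [] (\<not> h) ?b a []] =
      smult (gain (\<not> h) * gain h)
        ((smult (shift (\<not> h) * shift h) (dia ?x (smoothing a ?b @ smoothing ?b a) ?x) +
          smult (shift (\<not> h)) (dia ?x (smoothing a ?b @ forking ?b a) ?x)) +
         (smult (shift h) (dia ?x (forking a ?b @ smoothing ?b a) ?x) +
          dia ?x (forking a ?b @ forking ?b a) ?x))"
  proof -
    have "crossings_interp ?x [cross [] h a ?b [], cross [] (\<not> h) ?b a []] =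
        crossings_interp [?b, a] [cross [] (\<not> h) ?b a []] \<diamondop> crossings_interp ?x [cross [] h a ?b []]"
      using V.interp_append[of ?x "[cross [] h a ?b []]" "[?b, a]" "[cross [] (\<not> h) ?b a []]" ?x]
      by (simp add: cross_def del: interp.simps)
    then show ?thesis
      using interp_cross[of "[]" a ?b "[]" h] interp_cross[of "[]" ?b a "[]" "\<not> h"]
      by (simp add: two_resolutions layered_smoothing layered_forking del: interp.simps)
  qed
  ultimately have "cong_moy ?x ?x (crossings_interp ?x [cross [] h a ?b [], cross [] (\<not> h) ?b a []])
      (smult (gain (\<not> h) * gain h)
        ((smult (shift (\<not> h) * shift h) (smult (bracket (int n)) ?U) +
          smult (shift (\<not> h)) (smult (bracket (int n - 1)) ?U)) +
         (smult (shift h) (smult (bracket (int n - 1)) ?U) + (?I + smult (bracket (int n - 2)) ?U))))"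
    by (simp only:) (intro cong_add cong_smult)
  moreover have "smult (gain (\<not> h) * gain h)
        ((smult (shift (\<not> h) * shift h) (smult (bracket (int n)) ?U) +
          smult (shift (\<not> h)) (smult (bracket (int n - 1)) ?U)) +
         (smult (shift h) (smult (bracket (int n - 1)) ?U) + (?I + smult (bracket (int n - 2)) ?U)))
    = ?I + smult (bracket (int n) + (shift h + shift (\<not> h)) * bracket (int n - 1) + bracket (int n - 2)) ?U"
    unfolding gain_mult shift_mult by (simp add: smult_distribs distrib_right add_ac)
  ultimately show ?thesis
    by (simp only: shift_add bracket_bigon smult_simps add_0_right)
qed

lemma R3_parallel_cong:
  assumes "p = r \<longrightarrow> q = p"
  shows "cong_moy [a, a, a] [a, a, a]
     (crossings_interp [a, a, a] [cross [] p a a [a], cross [a] q a a [], cross [] r a a [a]])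
     (crossings_interp [a, a, a] [cross [a] r a a [], cross [] q a a [a], cross [a] p a a []])"
proof -
  let ?x = "[a, a, a]" and ?f1 = "fork [] a [a]" and ?f2 = "fork [a] a []"
  define D :: "fork layer list \<Rightarrow> (fork, 'r) lincomb" where "D ls = dia ?x ls ?x" for ls
  let ?c = "- (\<zeta> + unit_inv \<zeta>)"
  \<comment> \<open>The terms without forks and those with one fork in each position have equal
    coefficients on both sides. Only the single, double and triple forks need to be
    compared.\<close>
  let ?common = "smult (shift p * shift q * shift r) (D []) + (smult (shift r) (D [?f1, ?f2]) + smult (shift p) (D [?f2, ?f1]))"
  have homs: "layered ?x ls ?x \<Longrightarrow> D ls \<in> homs ?x ?x" for ls
    by (simp add: D_def dia_in_homs)
  have digon1: "cong_moy ?x ?x (D [?f1, ?f1]) (smult ?c (D [?f1]))"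
    using cong_context_dia[OF digon_cong[of a], of ?x "[]" "[]" "[a]" "[]"] by (simp add: D_def fork_def)
  have digon2: "cong_moy ?x ?x (D [?f2, ?f2]) (smult ?c (D [?f2]))"
    using cong_context_dia[OF digon_cong[of a], of ?x "[]" "[a]" "[]" "[]"] by (simp add: D_def fork_def)
  have braid: "cong_moy ?x ?x (D [?f1, ?f2, ?f1]) (D [?f2, ?f1, ?f2] + D [?f1] - D [?f2])"
    using braid_cong[of a] by (simp add: D_def)
  have left: "crossings_interp ?x [cross [] p a a [a], cross [a] q a a [], cross [] r a a [a]] =
     smult (gain p * gain q * gain r)
       (?common + (smult (shift q * shift r + shift p * shift q) (D [?f1]) + (smult (shift p * shift r) (D [?f2]) +
         (smult (shift q) (D [?f1, ?f1]) + D [?f1, ?f2, ?f1]))))"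
  proof -
    have "crossings_interp ?x [cross [] p a a [a], cross [a] q a a [], cross [] r a a [a]] =
        crossings_interp ?x [cross [] r a a [a]] \<diamondop> crossings_interp ?x [cross [a] q a a []] \<diamondop>
        crossings_interp ?x [cross [] p a a [a]]"
      using V.interp_append[of ?x "[cross [] p a a [a]]" ?x "[cross [a] q a a [], cross [] r a a [a]]" ?x]
        V.interp_append[of ?x "[cross [a] q a a []]" ?x "[cross [] r a a [a]]" ?x]
        comp_assoc[OF V.interp_hom V.interp_hom V.interp_hom, of ?x "[cross [] r a a [a]]" ?x ?x "[cross [a] q a a []]" ?x "[cross [] p a a [a]]"]
      by (simp add: cross_def del: interp.simps)
    then show ?thesis
      using interp_cross[of "[]" a a "[a]" p] interp_cross[of "[a]" a a "[]" q] interp_cross[of "[]" a a "[a]" r]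
      by (simp add: three_resolutions D_def smoothing_def forking_def fork_def smult_distribs(3) add_ac mult_ac del: interp.simps)
  qed
  have right: "crossings_interp ?x [cross [a] r a a [], cross [] q a a [a], cross [a] p a a []] =
     smult (gain p * gain q * gain r)
       (?common + (smult (shift q * shift r + shift p * shift q) (D [?f2]) + (smult (shift p * shift r) (D [?f1]) +
         (smult (shift q) (D [?f2, ?f2]) + D [?f2, ?f1, ?f2]))))"
  proof -
    have "crossings_interp ?x [cross [a] r a a [], cross [] q a a [a], cross [a] p a a []] =
        crossings_interp ?x [cross [a] p a a []] \<diamondop> crossings_interp ?x [cross [] q a a [a]] \<diamondop>
        crossings_interp ?x [cross [a] r a a []]"
      using V.interp_append[of ?x "[cross [a] r a a []]" ?x "[cross [] q a a [a], cross [a] p a a []]" ?x]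
        V.interp_append[of ?x "[cross [] q a a [a]]" ?x "[cross [a] p a a []]" ?x]
        comp_assoc[OF V.interp_hom V.interp_hom V.interp_hom, of ?x "[cross [a] p a a []]" ?x ?x "[cross [] q a a [a]]" ?x "[cross [a] r a a []]"]
      by (simp add: cross_def del: interp.simps)
    then show ?thesis
      using interp_cross[of "[a]" a a "[]" r] interp_cross[of "[]" a a "[a]" q] interp_cross[of "[a]" a a "[]" p]
      by (simp add: three_resolutions D_def smoothing_def forking_def fork_def smult_distribs(3) add_ac mult_ac del: interp.simps)
  qed
  have first: "cong_moy ?x ?x (crossings_interp ?x [cross [] p a a [a], cross [a] q a a [], cross [] r a a [a]])
    (smult (gain p * gain q * gain r)
       (?common + (smult (shift q * shift r + shift p * shift q) (D [?f1]) + (smult (shift p * shift r) (D [?f2]) +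
         (smult (shift q) (smult ?c (D [?f1])) + (D [?f2, ?f1, ?f2] + D [?f1] - D [?f2]))))))"
    unfolding left
    by (intro cong_add cong_smult digon1 braid cong_refl homs_add homs_smult homs) (simp_all add: fork_def)
  \<comment> \<open>The braid relation exchanges the triple forks at the cost of the difference of
    the two single forks, which \<open>shift_triangle\<close> absorbs.\<close>
  have swap: "smult (gain p * gain q * gain r)
       (?common + (smult (shift q * shift r + shift p * shift q) (D [?f1]) + (smult (shift p * shift r) (D [?f2]) +
         (smult (shift q) (smult ?c (D [?f1])) + (D [?f2, ?f1, ?f2] + D [?f1] - D [?f2])))))
     = smult (gain p * gain q * gain r)
       (?common + (smult (shift q * shift r + shift p * shift q) (D [?f2]) + (smult (shift p * shift r) (D [?f1]) +
         (smult (shift q) (smult ?c (D [?f2])) + D [?f2, ?f1, ?f2]))))"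
  proof -
    have "(shift q * shift r + shift p * shift q) - shift q * (\<zeta> + unit_inv \<zeta>) + 1 = shift p * shift r"
      by (rule shift_triangle[OF assms])
    show ?thesis by (subst swap_resolutions[OF \<open>_ = shift p * shift r\<close>]) (rule HOL.refl)
  qed
  have second: "cong_moy ?x ?x
      (smult (gain p * gain q * gain r)
       (?common + (smult (shift q * shift r + shift p * shift q) (D [?f2]) + (smult (shift p * shift r) (D [?f1]) +
         (smult (shift q) (smult ?c (D [?f2])) + D [?f2, ?f1, ?f2])))))
      (crossings_interp ?x [cross [a] r a a [], cross [] q a a [a], cross [a] p a a []])"
    unfolding right
    by (intro cong_add cong_smult cong_sym[OF digon2] cong_refl homs_add homs_smult homs)
      (simp_all add: fork_def)
  show ?thesis using first second unfolding swap by (rule cong_trans)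
qed

text \<open>Correct boundaries are part of the relation because the evaluation respects stacking and
  whiskering only for diagrams that fit together.\<close>

definition crossings_equiv :: "obj \<Rightarrow> crossing layer list \<Rightarrow> crossing layer list \<Rightarrow> obj \<Rightarrow> bool" where
  "crossings_equiv x ls ls' y \<longleftrightarrow> layered x ls y \<and> layered x ls' y \<and>
     cong_moy x y (crossings_interp x ls) (crossings_interp x ls')"

lemma interp_context:
  assumes "layered x m y" "layered x' pre (s @ x @ t)" "layered (s @ y @ t) post y'"
  shows "crossings_interp x' (pre @ whisker s t m @ post) =
    crossings_interp (s @ y @ t) post \<diamondop> (lin_id s \<otimes> crossings_interp x m \<otimes> lin_id t) \<diamondop> crossings_interp x' pre"
  using V.interp_append[OF assms(2) layered_appendI[OF layered_whisker[OF assms(1)] assms(3)]]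
    V.interp_append[OF layered_whisker[OF assms(1)] assms(3)]
    comp_assoc[OF V.interp_hom[OF assms(3)] V.interp_hom[OF layered_whisker[OF assms(1)]] V.interp_hom[OF assms(2)]]
  by (simp add: V.interp_whisker[OF assms(1)])

text \<open>R2 and the parallel R3 enter here as the computed cases; the sliding argument then
  yields R3 for all orientations without resolving further crossings.\<close>

sublocale crossing_congruence crossings_equiv
proof
  fix x y :: obj and ls ls' :: "crossing layer list"
  assume "isotopic x ls ls' y"
  then show "crossings_equiv x ls ls' y"
    by (auto simp: crossings_equiv_def V.interp_isotopic dest: isotopicD intro: cong_refl V.interp_hom)
next
  fix x y :: obj and ls ls' :: "crossing layer list"
  assume "crossings_equiv x ls ls' y"
  then show "crossings_equiv x ls' ls y"
    by (auto simp: crossings_equiv_def intro: cong_sym)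
next
  fix x y :: obj and l1 l2 l3 :: "crossing layer list"
  assume "crossings_equiv x l1 l2 y" "crossings_equiv x l2 l3 y"
  then show "crossings_equiv x l1 l3 y"
    by (auto simp: crossings_equiv_def intro: cong_trans)
next
  fix x y x' y' s t :: obj and m m' pre post :: "crossing layer list"
  assume *: "crossings_equiv x m m' y" "layered x' pre (s @ x @ t)" "layered (s @ y @ t) post y'"
  then have "cong_moy x' y'
      (crossings_interp (s @ y @ t) post \<diamondop> (lin_id s \<otimes> crossings_interp x m \<otimes> lin_id t) \<diamondop> crossings_interp x' pre)
      (crossings_interp (s @ y @ t) post \<diamondop> (lin_id s \<otimes> crossings_interp x m' \<otimes> lin_id t) \<diamondop> crossings_interp x' pre)"
    by (intro cong_sandwich[OF _ V.interp_hom V.interp_hom, of x y]) (simp_all add: crossings_equiv_def)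
  then show "crossings_equiv x' (pre @ whisker s t m @ post) (pre @ whisker s t m' @ post) y'"
    using * by (auto simp: crossings_equiv_def interp_context layered_append intro: layered_whisker)
next
  fix a b h
  show "crossings_equiv [a, b] [cross [] h a b [], cross [] (\<not> h) b a []] [] [a, b]"
    by (cases rule: orient_cases[of b a])
      (use R2_parallel_cong[of a h] R2_antiparallel_cong[of a h] in
        \<open>simp_all add: crossings_equiv_def cross_def del: interp.simps(2)\<close>)
next
  fix p q r :: bool and a
  assume "p = r \<longrightarrow> q = p"
  then show "crossings_equiv [a, a, a] [cross [] p a a [a], cross [a] q a a [], cross [] r a a [a]]
        [cross [a] r a a [], cross [] q a a [a], cross [a] p a a []] [a, a, a]"
    using R3_parallel_cong[of p r q a] by (simp add: crossings_equiv_def cross_def del: interp.simps(2))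
qed

lemma crossings_equiv_ideal:
  assumes "crossings_equiv x ls ls' y"
  shows "dia x ls y - dia x ls' y \<in> homs x y \<and>
    tensor_ideal diagram_cat (moy_rel \<alpha> \<zeta> n) x y (V.interp_lin x y (dia x ls y - dia x ls' y))"
  using assms
  by (auto simp: crossings_equiv_def V.interp_lin_diff V.interp_lin_dia cong_moy_iff
      intro!: homs_diff dia_in_homs)

lemma reidemeister_ideal:
  assumes "reidemeister x y f"
  shows "f \<in> homs x y \<and> tensor_ideal diagram_cat (moy_rel \<alpha> \<zeta> n) x y (V.interp_lin x y f)"
proof -
  note R2_equiv = R2 and R3_equiv = R3
  from assms show ?thesis
  proof cases
    case (R1_right a h)
    have "crossings_equiv [a] [([a], Cup a, []), cross [] h a a [opp a], ([a], Cap a, [])] [] [a]"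
      using R1_right_cong[of a h] by (simp add: crossings_equiv_def cross_def del: interp.simps(2))
    then show ?thesis
      unfolding R1_right by (rule crossings_equiv_ideal)
  next
    case (R1_left a h)
    have "crossings_equiv [a] [([], Cup (opp a), [a]), cross [opp a] h a a [], ([], Cap (opp a), [a])] [] [a]"
      using R1_left_cong[of a h] by (simp add: crossings_equiv_def cross_def del: interp.simps(2))
    then show ?thesis
      unfolding R1_left by (rule crossings_equiv_ideal)
  next
    case (R2 a b h)
    show ?thesis
      unfolding R2 by (rule crossings_equiv_ideal[OF R2_equiv])
  next
    case (R3 p r q a b c)
    show ?thesis
      unfolding R3(1-3) by (rule crossings_equiv_ideal[OF R3_equiv[OF R3(4)]])
  qed
qed

end

section \<open>Braidings and uniqueness\<close>

text \<open>The mate is drawn with the cup and cap of a quarter turn, so it is computed by the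
  isotopies that gave invariance under rotation.\<close>

lemma mate_right_crossing:
  "mate_right diagram_cat [opp b] [a] (crossing_val \<alpha> \<zeta> (Crossing (\<not> h) (opp b) a))
   = crossing_val \<alpha> \<zeta> (Crossing h a b)"
proof -
  have eq: "((\<not> h) = (opp b = a)) = (h = (a = b))" by (cases a; cases b; simp)
  show ?thesis
    using layered_smoothing[of "opp b" a] layered_forking[of "opp b" a]
      layered_whisker[OF layered_smoothing, of "[]" "opp b" a "[b]"]
      layered_whisker[OF layered_smoothing, of "[b]" "opp b" a "[b]"]
      layered_whisker[OF layered_forking, of "[]" "opp b" a "[b]"]
      layered_whisker[OF layered_forking, of "[b]" "opp b" a "[b]"]
    by (simp add: mate_right_def Let_def bilinear_ext_simps smult_distribs eq layered_appendI
        dia_eqI[OF smoothing_turn1] dia_eqI[OF forking_turn1])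
qed

lemma mate_left_crossing:
  "mate_left diagram_cat [b] [opp a] (crossing_val \<alpha> \<zeta> (Crossing (\<not> h) b (opp a)))
   = crossing_val \<alpha> \<zeta> (Crossing h a b)"
proof -
  have eq: "((\<not> h) = (b = opp a)) = (h = (a = b))" by (cases a; cases b; simp)
  show ?thesis
    using layered_smoothing[of b "opp a"] layered_forking[of b "opp a"]
      layered_whisker[OF layered_smoothing, of "[]" b "opp a" "[a]"]
      layered_whisker[OF layered_smoothing, of "[a]" b "opp a" "[a]"]
      layered_whisker[OF layered_forking, of "[]" b "opp a" "[a]"]
      layered_whisker[OF layered_forking, of "[a]" b "opp a" "[a]"]
    by (simp add: mate_left_def Let_def bilinear_ext_simps smult_distribs eq layered_appendI
        dia_eqI[OF smoothing_turn2] dia_eqI[OF forking_turn2])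
qed

text \<open>One quarter turn negates \<open>h\<close>, so the mixed orientations start from
  \<open>sigma_minus\<close>; two quarter turns restore it, so two downward strands start from
  \<open>sigma_plus\<close>.\<close>

lemma moy_sigma_eq: "moy_sigma \<alpha> \<zeta> a b = crossing_val \<alpha> \<zeta> (Crossing True a b)"
proof -
  have plus: "sigma_plus \<alpha> \<zeta> = crossing_val \<alpha> \<zeta> (Crossing True Up Up)"
    by (simp add: sigma_plus_def crossing_gain_def crossing_shift_def smoothing_def forking_def)
  have minus: "sigma_minus \<alpha> \<zeta> = crossing_val \<alpha> \<zeta> (Crossing False Up Up)"
    by (simp add: sigma_minus_def crossing_gain_def crossing_shift_def smoothing_def forking_def)
  show ?thesis
    using mate_right_crossing[of Down Up \<alpha> \<zeta> True] mate_right_crossing[of Down Up \<alpha> \<zeta> False]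
      mate_right_crossing[of Down Down \<alpha> \<zeta> True] mate_left_crossing[of Up Down \<alpha> \<zeta> True]
    by (cases a; cases b) (simp_all add: plus minus TrPD_def del: crossing_val.simps)
qed

context
  fixes s :: "orient \<Rightarrow> orient \<Rightarrow> ('v::plane_vertex, 'r::{comm_ring,comm_monoid_mult}) lincomb"
  assumes s_hom: "\<And>a b. s a b \<in> homs [a, b] [b, a]"
begin

lemma braid_strand_hom: "braid_strand diagram_cat s a y \<in> homs (a # y) (y @ [a])"
proof (induction y)
  case (Cons b y)
  have "lin_id [b] \<otimes> braid_strand diagram_cat s a y \<in> homs (b # a # y) (b # y @ [a])"
    using homs_tens[OF homs_id[of "[b]"] Cons.IH] by simp
  moreover have "s a b \<otimes> lin_id y \<in> homs (a # b # y) (b # a # y)"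
    using homs_tens[OF s_hom homs_id[of y]] by simp
  ultimately show ?case by (simp add: homs_comp)
qed (simp add: dia_in_homs)

lemma braid_words_hom: "braid_words diagram_cat s x y \<in> homs (x @ y) (y @ x)"
proof (induction x)
  case (Cons a x)
  have "braid_strand diagram_cat s a y \<otimes> lin_id x \<in> homs (a # y @ x) (y @ a # x)"
    using homs_tens[OF braid_strand_hom homs_id[of x]] by simp
  moreover have "lin_id [a] \<otimes> braid_words diagram_cat s x y \<in> homs (a # x @ y) (a # y @ x)"
    using homs_tens[OF homs_id[of "[a]"] Cons.IH] by simp
  ultimately show ?case by (simp add: homs_comp)
qed (simp add: dia_in_homs)

end

context vertex_interp
begin

context
  fixes s :: "orient \<Rightarrow> orient \<Rightarrow> ('v, 'r) lincomb"
  assumes s_hom: "\<And>a b. s a b \<in> homs [a, b] [b, a]"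
begin

text \<open>The recursion uses only composites, products and identities, all preserved by
  evaluation, so only the braiding of single strands is changed.\<close>

lemma interp_braid_strand:
  "interp_lin (a # y) (y @ [a]) (braid_strand diagram_cat s a y) =
   braid_strand diagram_cat (\<lambda>a b. interp_lin [a, b] [b, a] (s a b)) a y"
proof (induction y)
  case (Cons b y)
  note strand = braid_strand_hom[OF s_hom]
  show ?case
    using interp_lin_comp[OF homs_tens[OF homs_id[of "[b]"] strand[of a y], simplified]
        homs_tens[OF s_hom[of a b] homs_id[of y], simplified]]
      interp_lin_tens[OF homs_id[of "[b]"] strand[of a y]] interp_lin_tens[OF s_hom[of a b] homs_id[of y]]
    by (simp add: Cons.IH interp_lin_dia)
qed (simp add: interp_lin_dia)

lemma interp_braid_words:
  "interp_lin (x @ y) (y @ x) (braid_words diagram_cat s x y) =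
   braid_words diagram_cat (\<lambda>a b. interp_lin [a, b] [b, a] (s a b)) x y"
proof (induction x)
  case (Cons a x)
  note strand = braid_strand_hom[OF s_hom] and words = braid_words_hom[OF s_hom]
  show ?case
    using interp_lin_comp[OF homs_tens[OF strand[of a y] homs_id[of x], simplified]
        homs_tens[OF homs_id[of "[a]"] words[of x y], simplified]]
      interp_lin_tens[OF homs_id[of "[a]"] words[of x y]] interp_lin_tens[OF strand[of a y] homs_id[of x]]
    by (simp add: Cons.IH interp_braid_strand interp_lin_dia)
qed (simp add: interp_lin_dia)

end

end

lemma layer_dia:
  "dia (u @ pdom p @ w) [(u, p, w)] (u @ pcod p @ w) =
   lin_id u \<otimes> dia (pdom p) [([], p, [])] (pcod p) \<otimes> lin_id w"
  by simp

text \<open>Diagrams are built from pieces by stacking and juxtaposition, and cups and caps are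
  coevaluations and evaluations of one-letter words. So a rigid functor with given objects is free
  only on vertices.\<close>

lemma rigid_functor_diagram_cat_eqI:
  fixes D :: "('p, 'n, 'r::{comm_ring,comm_monoid_mult}, 'd) rigid_cat_scheme"
    and F F' :: "(obj, ('v::plane_vertex, 'r) lincomb, 'p, 'n) cat_map"
  assumes D: "linear_tensor_cat D"
    and F: "rigid_functor diagram_cat D F" and F': "rigid_functor diagram_cat D F'"
    and ob: "ob_map F = ob_map F'"
    and vertex: "\<And>v. mor_map F (vdom v) (vcod v) (dia (vdom v) [([], Vertex v, [])] (vcod v)) =
       mor_map F' (vdom v) (vcod v) (dia (vdom v) [([], Vertex v, [])] (vcod v))"
    and "f \<in> homs x y"
  shows "mor_map F x y f = mor_map F' x y f"
proof -
  interpret D: linear_tensor_cat D by (rule D)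
  note F_simps = rigid_functor_simps[OF F, simplified] rigid_functor_simps[OF F', simplified]
  have piece: "mor_map F (pdom p) (pcod p) (dia (pdom p) [([], p, [])] (pcod p)) =
      mor_map F' (pdom p) (pcod p) (dia (pdom p) [([], p, [])] (pcod p))" for p
  proof (cases p)
    case (Cap a)
    then show ?thesis
      using rigid_functor_simps(9)[OF F, of "[a]"] rigid_functor_simps(9)[OF F', of "[a]"] ob by simp
  next
    case (Cup a)
    then show ?thesis
      using rigid_functor_simps(11)[OF F, of "[a]"] rigid_functor_simps(11)[OF F', of "[a]"] ob by simp
  qed (simp add: vertex)
  have tens: "mor_map F x x' g = mor_map F' x x' g \<Longrightarrow> mor_map F y y' h = mor_map F' y y' h \<Longrightarrow>
      mor_map F (x @ y) (x' @ y') (g \<otimes> h) = mor_map F' (x @ y) (x' @ y') (g \<otimes> h)"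
    if "g \<in> homs x x'" "h \<in> homs y y'" for x x' y y' g h
    using rigid_functor_simps(8)[OF F, of g x x' h y y'] rigid_functor_simps(8)[OF F', of g x x' h y y'] that ob by simp
  have comp: "mor_map F x y g = mor_map F' x y g \<Longrightarrow> mor_map F y z h = mor_map F' y z h \<Longrightarrow>
      mor_map F x z (h \<diamondop> g) = mor_map F' x z (h \<diamondop> g)"
    if "g \<in> homs x y" "h \<in> homs y z" for x y z g h
    using rigid_functor_simps(5)[OF F, of g x y h z] rigid_functor_simps(5)[OF F', of g x y h z] that ob by simp
  have ident: "mor_map F x x (lin_id x) = mor_map F' x x (lin_id x)" for x
    using rigid_functor_simps(4)[OF F, of x] rigid_functor_simps(4)[OF F', of x] ob by simp
  have scal: "mor_map F x y (smult r g) = mor_map F' x y (smult r g)"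
    if "mor_map F x y g = mor_map F' x y g" "g \<in> homs x y" for x y r g
    using rigid_functor_simps(7)[OF F, of g x y r] rigid_functor_simps(7)[OF F', of g x y r] that ob by simp
  have layers: "mor_map F x y (dia x ls y) = mor_map F' x y (dia x ls y)" if "layered x ls y" for x y ls
    using that
  proof (induction ls arbitrary: x)
    case Nil
    then show ?case by (simp add: ident)
  next
    case (Cons l ls)
    obtain u p w where l: "l = (u, p, w)" by (cases l)
    let ?z = "u @ pcod p @ w" and ?P = "dia (pdom p) [([], p, [])] (pcod p) :: ('v, 'r) lincomb"
    have x: "x = u @ pdom p @ w" and ls: "layered ?z ls y" using Cons.prems by (auto simp: l)
    have P: "?P \<in> homs (pdom p) (pcod p)" by (simp add: dia_in_homs)
    have "mor_map F x ?z (dia x [l] ?z) = mor_map F' x ?z (dia x [l] ?z)"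
      unfolding x l layer_dia
      by (rule tens[OF homs_id homs_tens[OF P homs_id] ident tens[OF P homs_id piece ident]])
    moreover have "dia x (l # ls) y = dia ?z ls y \<diamondop> dia x [l] ?z"
      using ls by (simp add: x l)
    ultimately show ?case
      using comp[of "dia x [l] ?z" x ?z "dia ?z ls y" y] Cons.IH[OF ls] ls by (simp add: dia_in_homs x l)
  qed
  from \<open>f \<in> homs x y\<close> show ?thesis
  proof (induction rule: homs_induct)
    case zero
    have "mor_map F x y (smult 0 0) = zer D (ob_map F x) (ob_map F y)"
      using rigid_functor_simps(7)[OF F, of 0 x y 0] rigid_functor_hom[OF F, of 0 x y]
      by (simp add: homs_zero D.scal_0)
    moreover have "mor_map F' x y (smult 0 0) = zer D (ob_map F' x) (ob_map F' y)"
      using rigid_functor_simps(7)[OF F', of 0 x y 0] rigid_functor_hom[OF F', of 0 x y]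
      by (simp add: homs_zero D.scal_0)
    ultimately show ?case by (simp add: ob)
  next
    case (dia ls)
    then show ?case by (rule layers)
  next
    case (smult r g)
    then show ?case by (intro scal)
  next
    case (add g h)
    then show ?case
      using rigid_functor_simps(6)[OF F, of g x y h] rigid_functor_simps(6)[OF F', of g x y h] ob by simp
  qed
qed

section \<open>The functor on tangles\<close>

context moy_parameters
begin

sublocale P: quotient_of_linear
  "diagram_cat :: (obj, (crossing, 'r) lincomb, 'r) rigid_cat" reidemeister
  by (simp add: quotient_of_linear_def linear_tensor_cat_diagram_cat)

abbreviation "tangles \<equiv> (TD :: (obj, (crossing, 'r) lincomb set, 'r) rigid_braided_cat)"
abbreviation "moy \<equiv> MOY \<alpha> \<zeta> n"

lemma TD_eq: "tangles = quotient_cat diagram_cat reidemeister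
    (braid_words diagram_cat (\<lambda>a b. dia [a, b] [cross [] True a b []] [b, a]))"
  by (simp add: TD_def plane_tangle_diagrams_def)

lemma MOY_eq: "moy = quotient_cat diagram_cat (moy_rel \<alpha> \<zeta> n) (braid_words diagram_cat (moy_sigma \<alpha> \<zeta>))"
  by (simp add: MOY_def TrPD_def)

lemma linear_TD: "linear_tensor_cat tangles"
  unfolding TD_eq by (rule P.linear_tensor_cat_quotient)

lemma linear_MOY: "linear_tensor_cat moy"
  unfolding MOY_eq by (rule T.linear_tensor_cat_quotient)

definition diagram_functor :: "(obj, (crossing, 'r) lincomb, obj, (fork, 'r) lincomb set) cat_map" where
  "diagram_functor = functor_comp diagram_cat (quotient_functor diagram_cat (moy_rel \<alpha> \<zeta> n)) V.interp_functor"

definition tangle_functor :: "(obj, (crossing, 'r) lincomb set, obj, (fork, 'r) lincomb set) cat_map" where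
  "tangle_functor = quotient_lift diagram_cat reidemeister diagram_functor"

lemma rigid_diagram_functor: "rigid_functor diagram_cat moy diagram_functor"
  unfolding diagram_functor_def MOY_eq
  by (rule rigid_functor_comp[OF linear_tensor_cat_diagram_cat V.rigid_functor_interp
        T.rigid_functor_quotient_functor])

lemma ob_map_diagram_functor [simp]: "ob_map diagram_functor x = x"
  by (simp add: diagram_functor_def functor_comp_def quotient_functor_def V.interp_functor_def)

lemma ob_map_tangle_functor [simp]: "ob_map tangle_functor x = x"
  by (simp add: tangle_functor_def quotient_lift_def)

lemma diagram_functor_eq:
  "f \<in> homs x y \<Longrightarrow> mor_map diagram_functor x y f = coset diagram_cat (moy_rel \<alpha> \<zeta> n) x y (V.interp_lin x y f)"
  by (simp add: diagram_functor_def functor_comp_def quotient_functor_def V.interp_functor_def V.interp_lin_hom)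

lemma diagram_functor_zero:
  assumes "f \<in> homs x y" "cong_moy x y (V.interp_lin x y f) 0"
  shows "mor_map diagram_functor x y f = zer moy x y"
  using assms T.coset_eq_iff[of "V.interp_lin x y f" x y 0]
  by (simp add: diagram_functor_eq MOY_eq V.interp_lin_hom homs_zero cong_moy_def)

lemma diagram_functor_reidemeister:
  "reidemeister x y f \<Longrightarrow> f \<in> homs x y \<and>
   mor_map diagram_functor x y f = zer moy (ob_map diagram_functor x) (ob_map diagram_functor y)"
  using reidemeister_ideal[of x y f]
  by (auto simp: cong_moy_iff homs_zero V.interp_lin_hom intro!: diagram_functor_zero)

lemma rigid_tangle_functor: "rigid_functor tangles moy tangle_functor"
  unfolding tangle_functor_def TD_eq
  by (rule P.rigid_functor_quotient_lift[OF linear_MOY rigid_diagram_functor diagram_functor_reidemeister])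

lemma tangle_functor_coset:
  "f \<in> homs x y \<Longrightarrow> mor_map tangle_functor x y (coset diagram_cat reidemeister x y f) = mor_map diagram_functor x y f"
  unfolding tangle_functor_def
  by (rule P.quotient_lift_coset[OF linear_MOY rigid_diagram_functor diagram_functor_reidemeister])

section \<open>Preservation of braidings\<close>

lemma crossing_hom: "(dia [a, b] [cross [] h a b []] [b, a] :: (crossing, 'r) lincomb) \<in> homs [a, b] [b, a]"
  by (simp add: dia_in_homs cross_def)

lemma interp_lin_crossing:
  "V.interp_lin [a, b] [b, a] (dia [a, b] [cross [] h a b []] [b, a]) = crossing_val \<alpha> \<zeta> (Crossing h a b)"
  using interp_cross[of "[]" a b "[]" h] by (subst V.interp_lin_dia) (simp_all add: cross_def del: interp.simps)

lemma rigid_braided_tangle_functor: "rigid_braided_functor tangles moy tangle_functor"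
proof -
  have "mor_map tangle_functor (x @ y) (y @ x) (braiding tangles x y) = braiding moy x y" for x y
  proof -
    let ?s = "\<lambda>a b. dia [a, b] [cross [] True a b []] [b, a] :: (crossing, 'r) lincomb"
    have "braid_words diagram_cat ?s x y \<in> homs (x @ y) (y @ x)"
      by (rule braid_words_hom[OF crossing_hom])
    moreover have "moy_sigma \<alpha> \<zeta> = (\<lambda>a b. crossing_val \<alpha> \<zeta> (Crossing True a b))"
      by (simp add: fun_eq_iff moy_sigma_eq del: crossing_val.simps)
    ultimately show ?thesis
      using V.interp_braid_words[of ?s x y, OF crossing_hom]
      by (simp add: TD_eq MOY_eq tangle_functor_coset diagram_functor_eq interp_lin_crossing
          del: crossing_val.simps)
  qed
  moreover have "tens_ob tangles = (@)" by (simp add: TD_eq)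
  ultimately show ?thesis
    by (simp add: rigid_braided_functor_iff rigid_tangle_functor)
qed

section \<open>Uniqueness\<close>

lemma functor_ob_map_id:
  assumes "rigid_braided_functor tangles moy Z" "ob_map Z [Up] = [Up]"
  shows "ob_map Z x = x"
proof (induction x)
  case Nil
  then show ?case
    using assms(1) by (simp add: rigid_braided_functor_def TD_eq MOY_eq)
next
  case (Cons a x)
  have tens: "ob_map Z (u @ v) = ob_map Z u @ ob_map Z v" for u v
    using assms(1) by (simp add: rigid_braided_functor_def TD_eq MOY_eq)
  have "ob_map Z (dual_obj [Up]) = dual_obj (ob_map Z [Up])"
    using assms(1) by (simp add: rigid_braided_functor_def TD_eq MOY_eq del: dual_obj_simps)
  with assms(2) have "ob_map Z [a] = [a]" by (cases a) simp_all
  with Cons show ?case using tens[of "[a]" x] by simp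
qed

abbreviation tangle_coset :: "obj \<Rightarrow> obj \<Rightarrow> (crossing, 'r) lincomb \<Rightarrow> (crossing, 'r) lincomb set" where
  "tangle_coset \<equiv> coset diagram_cat reidemeister"

lemma crossing_inverse:
  "tangle_coset [a, b] [a, b] (dia [b, a] [cross [] (\<not> h) b a []] [a, b] \<diamondop> dia [a, b] [cross [] h a b []] [b, a])
   = tangle_coset [a, b] [a, b] (lin_id [a, b])"
  using tensor_ideal.gen[of reidemeister, OF reidemeister.R2[of a b h, where 'r = 'r], of diagram_cat]
  by (subst P.coset_eq_iff) (auto simp: P.cong_mod_iff smult_distribs cross_def dia_in_homs intro!: homs_comp dia_in_homs)

lemma braiding_crossing:
  "braiding tangles [a] [b] = tangle_coset [a, b] [b, a] (dia [a, b] [cross [] True a b []] [b, a])"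
  by (simp add: TD_eq cross_def)

lemma tangle_functor_unique:
  assumes Z: "rigid_braided_functor tangles moy Z" "ob_map Z [Up] = [Up]"
    and Z': "rigid_braided_functor tangles moy Z'" "ob_map Z' [Up] = [Up]"
  shows "Z = Z'"
proof -
  interpret M: linear_tensor_cat moy by (rule linear_MOY)
  let ?q = "quotient_functor diagram_cat reidemeister"
  have q: "rigid_functor diagram_cat tangles ?q"
    unfolding TD_eq by (rule P.rigid_functor_quotient_functor)
  have rigid: "rigid_functor tangles moy Z" "rigid_functor tangles moy Z'"
    using Z(1) Z'(1) by (simp_all add: rigid_braided_functor_iff)
  let ?F = "functor_comp diagram_cat Z ?q" and ?F' = "functor_comp diagram_cat Z' ?q"
  have F: "rigid_functor diagram_cat moy ?F" "rigid_functor diagram_cat moy ?F'"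
    by (rule rigid_functor_comp[OF linear_tensor_cat_diagram_cat q] rigid)+
  have F_eq: "mor_map ?F x y f = mor_map Z x y (tangle_coset x y f)"
    "mor_map ?F' x y f = mor_map Z' x y (tangle_coset x y f)" if "f \<in> homs x y" for x y f
    using that by (simp_all add: functor_comp_def quotient_functor_def)
  note ob = functor_ob_map_id[OF Z] functor_ob_map_id[OF Z']
  have ob_F: "ob_map ?F x = x" "ob_map ?F' x = x" for x
    by (simp_all add: functor_comp_def quotient_functor_def ob)
  have pos: "mor_map ?F [a, b] [b, a] (dia [a, b] [cross [] True a b []] [b, a]) = braiding moy [a] [b]"
    "mor_map ?F' [a, b] [b, a] (dia [a, b] [cross [] True a b []] [b, a]) = braiding moy [a] [b]" for a b
  proof -
    have "tens_ob tangles = (@)" by (simp add: TD_eq)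
    then show "mor_map ?F [a, b] [b, a] (dia [a, b] [cross [] True a b []] [b, a]) = braiding moy [a] [b]"
      "mor_map ?F' [a, b] [b, a] (dia [a, b] [cross [] True a b []] [b, a]) = braiding moy [a] [b]"
      using Z(1) Z'(1) braiding_crossing[of a b]
      by (simp_all add: F_eq crossing_hom rigid_braided_functor_iff ob)
        (metis append_Cons append_Nil)+
  qed
  \<comment> \<open>The prescribed braiding of \<open>[b]\<close> and \<open>[a]\<close> is inverted
    by both values. The left inverse law is taken from the first functor and the right one from the
    second.\<close>
  have neg: "mor_map ?F [a, b] [b, a] (dia [a, b] [cross [] False a b []] [b, a])
      = mor_map ?F' [a, b] [b, a] (dia [a, b] [cross [] False a b []] [b, a])" (is "?g = ?g'") for a b
  proof (rule M.inverse_unique)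
    let ?X = "\<lambda>h a b. dia [a, b] [cross [] h a b []] [b, a] :: (crossing, 'r) lincomb"
    show "braiding moy [b] [a] \<in> hom moy [b, a] [a, b]"
      using rigid_functor_hom[OF F(1) crossing_hom[of b a True]] by (simp add: pos ob_F)
    show "?g \<in> hom moy [a, b] [b, a]" "?g' \<in> hom moy [a, b] [b, a]"
      using rigid_functor_hom[OF F(1) crossing_hom[of a b False]]
        rigid_functor_hom[OF F(2) crossing_hom[of a b False]] by (simp_all add: ob_F)
    have "mor_map ?F [b, a] [b, a] (?X False a b \<diamondop> ?X True b a) = mor_map ?F [b, a] [b, a] (lin_id [b, a])"
      using crossing_inverse[of b a True] homs_comp[OF crossing_hom[of a b False] crossing_hom[of b a True]]
      by (simp add: F_eq homs_id del: dia_comp)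
    then show "cmp moy [b, a] [a, b] [b, a] ?g (braiding moy [b] [a]) = ident moy [b, a]"
      using rigid_functor_simps(5)[OF F(1) crossing_hom[of b a True] crossing_hom[of a b False]]
        rigid_functor_simps(4)[OF F(1), of "[b, a]"]
      by (simp add: pos ob_F del: dia_comp)
    have "mor_map ?F' [a, b] [a, b] (?X True b a \<diamondop> ?X False a b) = mor_map ?F' [a, b] [a, b] (lin_id [a, b])"
      using crossing_inverse[of a b False] homs_comp[OF crossing_hom[of b a True] crossing_hom[of a b False]]
      by (simp add: F_eq homs_id del: dia_comp)
    then show "cmp moy [a, b] [b, a] [a, b] (braiding moy [b] [a]) ?g' = ident moy [a, b]"
      using rigid_functor_simps(5)[OF F(2) crossing_hom[of a b False] crossing_hom[of b a True]]
        rigid_functor_simps(4)[OF F(2), of "[a, b]"]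
      by (simp add: pos ob_F del: dia_comp)
  qed
  have vertex: "mor_map ?F (vdom v) (vcod v) (dia (vdom v) [([], Vertex v, [])] (vcod v)) =
       mor_map ?F' (vdom v) (vcod v) (dia (vdom v) [([], Vertex v, [])] (vcod v))" for v
  proof (cases v)
    case (Crossing h a b)
    then show ?thesis using pos[of a b] neg[of a b] by (cases h) (simp_all add: cross_def)
  qed
  have F_F': "mor_map ?F x y f = mor_map ?F' x y f" if "f \<in> homs x y" for x y f
    by (rule rigid_functor_diagram_cat_eqI[OF linear_MOY F _ vertex that]) (simp add: fun_eq_iff ob_F)
  have "mor_map Z x y A = mor_map Z' x y A" for x y A
  proof (cases "A \<in> hom tangles x y")
    case True
    then obtain f where "f \<in> homs x y" "A = tangle_coset x y f"
      unfolding TD_eq by (auto simp: P.quotient_hom)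
    then show ?thesis using F_F'[of f x y] F_eq[of f x y] by simp
  qed (simp add: rigid_functor_undefined[OF rigid(1)] rigid_functor_undefined[OF rigid(2)])
  then show "Z = Z'"
    by (intro cat_map.equality) (auto simp: fun_eq_iff ob)
qed

text \<open>The crossing relation holds already between combinations of graphs: the forks cancel and
  \<zeta>^-1 - \<zeta> is z. The unknot is where a MOY relation enters, with \<open>[n]\<close>
  rewritten in terms of z.\<close>

lemma tangle_functor_skein:
  assumes z: "unit_inv \<zeta> - \<zeta> = z" "z dvd 1" and "skein \<alpha> z x y A"
  shows "A \<in> hom tangles x y \<and>
    mor_map tangle_functor x y A = zer moy (ob_map tangle_functor x) (ob_map tangle_functor y)"
proof -
  have *: "tangle_coset x y f \<in> hom tangles x y \<and> mor_map tangle_functor x y (tangle_coset x y f) = zer moy x y"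
    if "f \<in> homs x y" "cong_moy x y (V.interp_lin x y f) 0" for x y f
    using that diagram_functor_zero[OF that] tangle_functor_coset[OF that(1)] P.coset_in_hom[OF that(1)]
    by (simp add: TD_eq)
  from assms(3) show ?thesis
  proof cases
    case crossing_change
    let ?f = "smult \<alpha> (dia [Up, Up] [cross [] True Up Up []] [Up, Up])
       - smult (unit_inv \<alpha>) (dia [Up, Up] [cross [] False Up Up []] [Up, Up])
       - smult z (dia [Up, Up] [] [Up, Up]) :: (crossing, 'r) lincomb"
    let ?I = "lin_id [Up, Up] :: (fork, 'r) lincomb" and ?S = "dia [Up, Up] [fork [] Up []] [Up, Up] :: (fork, 'r) lincomb"
    have hom: "?f \<in> homs [Up, Up] [Up, Up]"
      by (intro homs_diff homs_smult crossing_hom homs_id)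
    have val: "crossing_val \<alpha> \<zeta> (Crossing True Up Up) = smult (unit_inv \<alpha>) (smult (unit_inv \<zeta>) ?I + ?S)"
      "crossing_val \<alpha> \<zeta> (Crossing False Up Up) = smult \<alpha> (smult \<zeta> ?I + ?S)"
      by (simp_all add: crossing_gain_def crossing_shift_def smoothing_def forking_def)
    have "V.interp_lin [Up, Up] [Up, Up] ?f =
        smult (\<alpha> * unit_inv \<alpha>) (smult (unit_inv \<zeta>) ?I + ?S) - smult (\<alpha> * unit_inv \<alpha>) (smult \<zeta> ?I + ?S) - smult z ?I"
      by (simp add: V.interp_lin_diff V.interp_lin_smult interp_lin_crossing val V.interp_lin_dia mult.commute
          del: crossing_val.simps)
    also have "\<dots> = 0"
      by (simp add: unit_inv_right[OF \<alpha>_unit] smult_distribs flip: z(1))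
    finally have "V.interp_lin [Up, Up] [Up, Up] ?f = 0" .
    then have "cong_moy [Up, Up] [Up, Up] (V.interp_lin [Up, Up] [Up, Up] ?f) 0"
      by (simp add: cong_refl homs_zero)
    from *[OF hom this] crossing_change show ?thesis
      by (simp add: plane_tangle_diagrams_def)
  next
    case unknot
    let ?c = "(\<alpha> - unit_inv \<alpha>) * unit_inv z"
    let ?f = "dia [] [([], Cup Up, []), ([], Cap Up, [])] [] - smult ?c (dia [] [] []) :: (crossing, 'r) lincomb"
    have hom: "?f \<in> homs [] []"
      by (auto intro!: homs_diff homs_smult dia_in_homs)
    have "unit_inv (\<zeta> - unit_inv \<zeta>) = - unit_inv z"
      by (rule unit_inv_unique) (use unit_inv_right[OF z(2)] in \<open>simp flip: z(1) add: algebra_simps\<close>)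
    then have c: "bracket (int n) = ?c"
      by (simp add: bracket_0 algebra_simps)
    have "V.interp_lin [] [] ?f = dia [] [([], Cup Up, []), ([], Cap Up, [])] [] - smult ?c (lin_id [])"
      by (simp add: V.interp_lin_diff V.interp_lin_smult V.interp_lin_dia)
    then have "cong_moy [] [] (V.interp_lin [] [] ?f) 0"
      using circle_cong[of Up] V.interp_lin_hom[OF hom] by (simp add: cong_moy_iff c homs_zero)
    from *[OF hom this] unknot show ?thesis
      by (simp add: plane_tangle_diagrams_def)
  qed
qed

lemma tangle_functor_factors:
  assumes z: "unit_inv \<zeta> - \<zeta> = z" "z dvd 1"
  shows "\<exists>W. rigid_braided_functor (HOMFLYPT \<alpha> z) moy W \<and>
    tangle_functor = functor_comp tangles W (to_HOMFLYPT \<alpha> z)"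
proof -
  interpret H: quotient_of_linear tangles "skein \<alpha> z"
    by (simp add: quotient_of_linear_def linear_TD)
  note lift = linear_MOY rigid_tangle_functor tangle_functor_skein[OF z]
  let ?W = "quotient_lift tangles (skein \<alpha> z) tangle_functor"
  have "rigid_functor (HOMFLYPT \<alpha> z) moy ?W"
    unfolding HOMFLYPT_def by (rule H.rigid_functor_quotient_lift[OF lift])
  \<comment> \<open>The braiding of the skein quotient is the coset of the braiding of tangles, so
    its image under the lift is already known.\<close>
  moreover have "mor_map ?W (x @ y) (y @ x) (braiding (HOMFLYPT \<alpha> z) x y) = braiding moy x y" for x y
  proof -
    have "braiding tangles x y \<in> hom tangles (x @ y) (y @ x)"
      unfolding TD_eq P.quotient_ops diagram_cat_simps
      by (rule P.coset_in_hom[OF braid_words_hom[OF crossing_hom]])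
    moreover have "tens_ob tangles = (@)" by (simp add: TD_eq)
    moreover have "mor_map tangle_functor (x @ y) (y @ x) (braiding tangles x y) = braiding moy x y"
      using rigid_braided_tangle_functor \<open>tens_ob tangles = (@)\<close> by (simp add: rigid_braided_functor_iff)
    ultimately show ?thesis
      by (simp add: HOMFLYPT_def H.quotient_lift_coset[OF lift])
  qed
  moreover have "tens_ob (HOMFLYPT \<alpha> z) = (@)" "ob_map ?W = (\<lambda>x. x)"
    by (simp_all add: HOMFLYPT_def quotient_lift_def fun_eq_iff) (simp add: TD_eq)
  ultimately have "rigid_braided_functor (HOMFLYPT \<alpha> z) moy ?W"
    by (simp add: rigid_braided_functor_iff)
  moreover have "functor_comp tangles ?W (to_HOMFLYPT \<alpha> z) = tangle_functor"
    unfolding to_HOMFLYPT_def by (rule H.functor_comp_quotient_lift[OF lift])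
  ultimately show ?thesis by metis
qed

end

theorem proposition3p3p2:
  fixes \<alpha> z \<zeta> :: "'r::{comm_ring,comm_monoid_mult}" and n :: nat
  assumes "\<alpha> dvd 1" and "z dvd 1" and "\<zeta> dvd 1" and "unit_inv \<zeta> - \<zeta> = z" and "n \<ge> 2"
  shows "(\<exists>!Z. rigid_braided_functor TD (MOY \<alpha> \<zeta> n) Z \<and> ob_map Z [Up] = [Up]) \<and>
    (\<forall>Z. rigid_braided_functor TD (MOY \<alpha> \<zeta> n) Z \<and> ob_map Z [Up] = [Up] \<longrightarrow>
      (\<exists>W. rigid_braided_functor (HOMFLYPT \<alpha> z) (MOY \<alpha> \<zeta> n) W \<and>
           Z = functor_comp TD W (to_HOMFLYPT \<alpha> z)))"
proof -
  \<comment> \<open>The denominator of the MOY integers is \<open>- z\<close>, hence invertible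
    along with \<open>z\<close>.\<close>
  have "(\<zeta> - unit_inv \<zeta>) * - unit_inv z = z * unit_inv z"
    unfolding assms(4)[symmetric] by (simp add: algebra_simps)
  then have "(\<zeta> - unit_inv \<zeta>) dvd 1"
    using unit_inv_right[OF assms(2)] by (metis dvdI)
  then interpret moy_parameters \<alpha> \<zeta> n
    using assms by unfold_locales
  have exists: "rigid_braided_functor TD (MOY \<alpha> \<zeta> n) tangle_functor \<and> ob_map tangle_functor [Up] = [Up]"
    by (simp add: rigid_braided_tangle_functor)
  \<comment> \<open>Every admissible functor is this one, so a single factorization settles the
    second claim.\<close>
  have unique: "Z = tangle_functor"
    if "rigid_braided_functor TD (MOY \<alpha> \<zeta> n) Z \<and> ob_map Z [Up] = [Up]" for Z
    using that exists tangle_functor_unique by blast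
  show ?thesis
    using exists unique tangle_functor_factors[OF assms(4,2)] by blast
qed

end
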